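(* Let $n\ge 1$, let $f:\mathbf{C}\to\mathbf{P}^n$ be a linearly non-degenerate holomorphic curve, and let $A$ be an arbitrary finite complete set of hyperplanes in $\mathbf{P}^n$. Then $$\sum_{k=1}^n m_k(r,f)+N_1(r,f)\le (n+1)T(r,f)+S(r,f),$$ where $S(r,f)$ is an error term with the property that $S(r,f)=o(T(r,f))$ as $r\to\infty$, $r\notin E$, for some exceptional set $E\subset(0,\infty)$ of finite length (finite Lebesgue measure). Here the proximity functions $m_k(r,f)$ are defined with respect to $A$.
   Context: A holomorphic curve $f:\mathbf{C}\to\mathbf{P}^n$ is written in homogeneous coordinates as $f=(f_0:\ldots:f_n)$ with $f_j$ entire, not all identically zero. The representation is reduced if the $f_j$ have no zeros common to all of them; a reduced representation is fixed below (the quantities do not depend on its choice). The curve is linearly non-degenerate if $f_0,\ldots,f_n$ are linearly independent over $\mathbf{C}$. Characteristic: with $\|f\|=\sqrt{|f_0|^2+\ldots+|f_n|^2}$, $$T(r,f)=\frac1{2\pi}\int_{-\pi}^{\pi}\log\|f(re^{i\theta})\|\,d\theta-\log\|f(0)\|.$$ Ramification term: let $W_f=W(f_0,\ldots,f_n)$ be the Wronskian determinant, $n_1(r,f)$ the number of zeros of $W_f$ in $|z|\le r$ counted with multiplicity, and $$N_1(r,f)=\int_0^r (n_1(t,f)-n_1(0,f))\frac{dt}{t}+n_1(0,f)\log r.$$ Hyperplanes: a hyperplane $a$ in $\mathbf{P}^n$ is given by an equation $\alpha_0w_0+\ldots+\alpha_nw_n=0$ with $\alpha=(\alpha_0,\ldots,\alpha_n)\ne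 0$. A set $A$ of hyperplanes is complete if the corresponding vectors $\alpha$ span $\mathbf{C}^{n+1}$ (equivalently, the intersection of all hyperplanes of $A$ is empty). The set $F(A)$ of flats generated by $A$ consists of all intersections of subsets of $A$; these are projective subspaces (the empty set is given codimension $n+1$). If $A$ is complete, flats of every codimension $1,\ldots,n+1$ exist in $F(A)$. Distance: $\mathbf{P}^n$ is equipped with the chordal metric $\mathrm{dist}(x,y)=\|x\wedge y\|/(\|x\|\|y\|)$ (on homogeneous coordinate vectors), and the distance between two subsets is the infimum of distances between their points; for a hyperplane $a$ with vector $\alpha$ one has $\mathrm{dist}(w,a)=|\alpha_0w_0+\ldots+\alpha_nw_n|/(\|\alpha\|\|w\|)$. For $w\in\mathbf{P}^n$ and $k\in\{1,\ldots,n\}$, $d_k(w)$ is the shortest distance from $w$ to a flat of codimension $k$ in $F(A)$. The $k$-proximity function is $$m_k(r,f)=\frac1{2\pi}\int_{-\pi}^{\pi}\log\frac{1}{d_k(f(re^{it}))}\,dt.$$ *)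

theory Defs
  imports "HOL-Complex_Analysis.Complex_Analysis" "HOL-Library.Landau_Symbols"
begin

text \<open>
  With \<open>CARD('i) = n + 1\<close>, points of complex projective n-space are given by nonzero vectors of
  \<open>complex^'i\<close> (homogeneous coordinates), and a projective subspace by the linear subspace of
  \<open>complex^'i\<close> lying over it; the empty projective subspace corresponds to \<open>{0}\<close>.
\<close>

definition reduced_representation :: "(complex \<Rightarrow> complex^'i) \<Rightarrow> bool" where
  "reduced_representation f \<longleftrightarrow>
     (\<forall>i. (\<lambda>z. f z $ i) holomorphic_on UNIV) \<and> (\<forall>z. \<exists>i. f z $ i \<noteq> 0)"

definition linearly_nondegenerate :: "(complex \<Rightarrow> complex^'i) \<Rightarrow> bool" where
  "linearly_nondegenerate f \<longleftrightarrow>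
     (\<forall>c. (\<forall>z. (\<Sum>i\<in>UNIV. c i * f z $ i) = 0) \<longrightarrow> (\<forall>i. c i = 0))"

definition characteristic :: "real \<Rightarrow> (complex \<Rightarrow> complex^'i) \<Rightarrow> real" where
  "characteristic r f =
     1 / (2 * pi) * integral {-pi..pi} (\<lambda>t. ln (norm (f (complex_of_real r * cis t))))
       - ln (norm (f 0))"

text \<open>
  The order on the index type enumerates the coordinates as \<open>f\<^sub>0, \<dots>, f\<^sub>n\<close>; row \<open>i\<close> contains the
  derivatives of order \<open>card {j. j < i}\<close>, the position of \<open>i\<close> counted from 0.
\<close>

definition wronskian :: "(complex \<Rightarrow> complex^'i::{finite,linorder}) \<Rightarrow> complex \<Rightarrow> complex" where
  "wronskian f z = det (\<chi> i j. (deriv ^^ card {l. l < i}) (\<lambda>w. f w $ j) z)"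

definition ramification_count :: "real \<Rightarrow> (complex \<Rightarrow> complex^'i::{finite,linorder}) \<Rightarrow> nat" where
  "ramification_count r f =
     (\<Sum>z\<in>{z. norm z \<le> r \<and> wronskian f z = 0}. nat (zorder (wronskian f) z))"

definition ramification :: "real \<Rightarrow> (complex \<Rightarrow> complex^'i::{finite,linorder}) \<Rightarrow> real" where
  "ramification r f =
     integral {0..r} (\<lambda>t. (real (ramification_count t f) - real (ramification_count 0 f)) / t)
       + real (ramification_count 0 f) * ln r"

definition hyperplane :: "complex^'i \<Rightarrow> (complex^'i) set" where
  "hyperplane \<alpha> = {w. (\<Sum>i\<in>UNIV. \<alpha> $ i * w $ i) = 0}"

definition is_hyperplane :: "(complex^'i) set \<Rightarrow> bool" where
  "is_hyperplane H \<longleftrightarrow> (\<exists>\<alpha>. \<alpha> \<noteq> 0 \<and> H = hyperplane \<alpha>)"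

text \<open>
  The operations \<open>vec.span\<close> and \<open>vec.dim\<close> are taken over the complex field, unlike \<open>span\<close> and \<open>dim\<close>.
\<close>

definition complete_hyperplanes :: "(complex^'i) set set \<Rightarrow> bool" where
  "complete_hyperplanes A \<longleftrightarrow> vec.span {\<alpha>. \<alpha> \<noteq> 0 \<and> hyperplane \<alpha> \<in> A} = UNIV"

definition flats :: "(complex^'i) set set \<Rightarrow> (complex^'i) set set" where
  "flats A = {\<Inter>B | B. B \<subseteq> A}"

definition codim :: "(complex^'i) set \<Rightarrow> nat" where
  "codim L = CARD('i) - vec.dim L"

text \<open>
  The norm of the bivector \<open>x \<and> y\<close>: each coordinate \<open>x\<^sub>i y\<^sub>j - x\<^sub>j y\<^sub>i\<close> with \<open>i < j\<close> occurs twice,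
  up to sign, in the double sum.
\<close>

definition wedge_norm :: "complex^'i \<Rightarrow> complex^'i \<Rightarrow> real" where
  "wedge_norm x y =
     sqrt ((\<Sum>i\<in>UNIV. \<Sum>j\<in>UNIV. (cmod (x $ i * y $ j - x $ j * y $ i))\<^sup>2) / 2)"

definition chordal_dist :: "complex^'i \<Rightarrow> complex^'i \<Rightarrow> real" where
  "chordal_dist x y = wedge_norm x y / (norm x * norm y)"

definition dist_to_flat :: "complex^'i \<Rightarrow> (complex^'i) set \<Rightarrow> real" where
  "dist_to_flat w L = (INF x\<in>L - {0}. chordal_dist w x)"

definition flat_dist :: "(complex^'i) set set \<Rightarrow> nat \<Rightarrow> complex^'i \<Rightarrow> real" where
  "flat_dist A k w = Min (dist_to_flat w ` {L \<in> flats A. codim L = k})"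

definition proximity ::
    "(complex^'i) set set \<Rightarrow> nat \<Rightarrow> real \<Rightarrow> (complex \<Rightarrow> complex^'i) \<Rightarrow> real" where
  "proximity A k r f =
     1 / (2 * pi) * integral {-pi..pi} (\<lambda>t. ln (1 / flat_dist A k (f (complex_of_real r * cis t))))"

end

theory Submission imports Defs "HOL-Real_Asymp.Real_Asymp" begin

text \<open>
  At each point \<open>w\<close> order a basis of normal vectors of \<open>A\<close> greedily by the distance of \<open>w\<close> to the
  hyperplane.  A flat of codimension \<open>k\<close> lies in a hyperplane not spanned by the first \<open>k - 1\<close> of them,
  so \<open>d\<^sub>k(w)\<close> is bounded below by the distance to the \<open>k\<close>-th, up to the factor \<open>sqrt 2\<close>.  Hence the sum
  of the \<open>ln (1 / d\<^sub>k(w))\<close> is at most \<open>(n + 1) ln \<parallel>f\<parallel> - ln |W\<^sub>f| + ln |W(g\<^sub>0,\<dots>,g\<^sub>n) / (g\<^sub>0 \<dots> g\<^sub>n)|\<close> for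
  linear forms \<open>g\<^sub>j\<close> of \<open>f\<close> depending on \<open>w\<close>; Jensen's formula turns the mean of \<open>ln |W\<^sub>f|\<close> into \<open>N\<^sub>1\<close>.

  The last quotient is a determinant of expressions \<open>\<phi>\<^bsup>(k)\<^esup> / \<phi>\<close> with \<open>\<phi> = g\<^sub>j / g\<^sub>0\<close>.  These are bounded
  pointwise: \<open>\<phi>\<close> is written on a disc as a quotient of products over zeros times \<open>exp h\<close>, the derivative
  of \<open>h\<close> is controlled by the Schwarz integral, and Cauchy's inequality is applied on a disc so small that
  \<open>\<phi>\<close> stays comparable to its value at the centre.  Zeros near the circle are avoided by removing an
  interval of length \<open>2 / k\<^sup>2\<close> around the \<open>k\<close>-th zero radius, of finite total length.  The comparison
  radius is \<open>2 r\<close> if \<open>T(r) = O(ln r)\<close>; otherwise \<open>ln r = o(T(r))\<close>, and it is \<open>r + 1 / T(r)\<close> with Borel's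
  lemma.  Convexity properties of \<open>T\<close> show that there is no third case.
\<close>

unbundle no fps_syntax

section \<open>Circle means\<close>

text \<open>Quotients of linear forms are forced: multiplying \<open>f\<close> by the exponential of
  an entire function changes neither \<open>T\<close> nor any distance to a flat, but changes
  \<open>g' / g\<close> for a linear form \<open>g\<close> by a term without control in terms of
  \<open>T\<close>. For a quotient, \<open>|x - y| = 2 max(x, y) - x - y\<close> with
  \<open>x\<close>, \<open>y\<close> the logarithms of the two moduli bounds the mean of
  \<open>|x - y|\<close> by \<open>2 T\<close> plus a constant, because both are at most
  \<open>ln \<parallel>f\<parallel>\<close> plus a constant and Jensen's formula bounds their means
  from below. A bound at every point of the circle covers every choice of linear forms at once, so
  only continuous functions need to be averaged. The price is that radii close to zeros are lost.
  One number \<open>B\<close>, dominating the growth at radius \<open>r + d\<close> and the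
  reciprocals of the gap \<open>d\<close>, controls all estimates polynomially. Only
  \<open>ln B\<close> reaches the error term, so crude exponents do no harm, and \<open>d\<close>
  can be chosen last: large if \<open>T\<close> is of logarithmic growth, small otherwise. Since
  \<open>ln 0 = 0\<close>, means over circles through zeros would be meaningless; those radii are
  countable and join the exceptional set.\<close>

definition circle_mean :: "real \<Rightarrow> (complex \<Rightarrow> real) \<Rightarrow> real" where
  "circle_mean r u = 1 / (2 * pi) * integral {-pi..pi} (\<lambda>t. u (complex_of_real r * cis t))"

lemma integral_periodic_shift:
  fixes u :: "real \<Rightarrow> 'a::banach"
  assumes cont: "continuous_on UNIV u" and per: "\<And>t. u (t + p) = u t" and p: "p \<ge> 0"
  shows "integral {a..a+p} u = integral {b..b+p} u"
proof -
  have int: "u integrable_on {c..d}" for c d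
    using cont continuous_on_subset integrable_continuous_interval by blast
  have shift: "integral {c+p..d+p} u = integral {c..d} u" if "c \<le> d" for c d
  proof -
    have "(u has_integral integral {c+p..d+p} u) {c+p..d+p}"
      using int by (simp add: has_integral_integral)
    then have "((\<lambda>x. u (x + p)) has_integral integral {c+p..d+p} u) {c..d}"
      using has_integral_shift_Icc_real[of u p "integral {c+p..d+p} u" c d] by (simp add: o_def add.commute)
    then have "(u has_integral integral {c+p..d+p} u) {c..d}"
      using per by simp
    then show ?thesis by (simp add: integral_unique)
  qed
  have eq: "integral {a..a+p} u = integral {b..b+p} u" if "a \<le> b" for a b
  proof -
    have "integral {a..a+p} u + integral {a+p..b+p} u = integral {a..b+p} u"
      by (rule Henstock_Kurzweil_Integration.integral_combine) (use that p int in auto)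
    moreover have "integral {a..b} u + integral {b..b+p} u = integral {a..b+p} u"
      by (rule Henstock_Kurzweil_Integration.integral_combine) (use that p int in auto)
    ultimately show ?thesis using shift[OF that] by (metis add.commute add_left_cancel)
  qed
  show ?thesis
  proof (cases "a \<le> b")
    case True
    then show ?thesis by (rule eq)
  next
    case False
    then show ?thesis by (intro eq[symmetric]) simp
  qed
qed

lemma continuous_on_circle_param:
  assumes "continuous_on (sphere 0 r) u" "r \<ge> 0"
  shows "continuous_on S (\<lambda>t. u (complex_of_real r * cis t))"
  by (rule continuous_on_compose2[OF assms(1)])
     (use assms(2) in \<open>auto intro!: continuous_intros simp: norm_mult\<close>)

lemma circle_integrable:
  fixes u :: "complex \<Rightarrow> 'a::banach"
  assumes "continuous_on (sphere 0 r) u" "r \<ge> 0"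
  shows "(\<lambda>t. u (complex_of_real r * cis t)) integrable_on {a..b}"
  by (intro integrable_continuous_interval continuous_on_circle_param assms)

lemma integral_circle_shift:
  fixes u :: "complex \<Rightarrow> 'a::banach"
  assumes "continuous_on (sphere 0 r) u" "r \<ge> 0"
  shows "integral {a..a+2*pi} (\<lambda>t. u (complex_of_real r * cis t)) = 
         integral {-pi..pi} (\<lambda>t. u (complex_of_real r * cis t))"
proof -
  have "cis (t + 2*pi) = cis t" for t
    by (metis cis_2pi cis_mult mult.right_neutral)
  then have "integral {a..a+2*pi} (\<lambda>t. u (complex_of_real r * cis t)) = 
        integral {-pi..-pi+2*pi} (\<lambda>t. u (complex_of_real r * cis t))"
    by (intro integral_periodic_shift continuous_on_circle_param assms) auto
  then show ?thesis by simp
qed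

text \<open>On \<open>\<zeta> = r * cis t\<close> the differential is i \<zeta> dt, which turns the
  factor 2 pi i of Cauchy's formula into 2 pi and adds the factor \<open>r * cis t\<close> to the
  integrand. The case \<open>k = 0\<close>, \<open>w = 0\<close> is the mean value property;
  \<open>k = 1\<close> feeds the Schwarz formula.\<close>

lemma Cauchy_has_integral_circle:
  fixes F :: "complex \<Rightarrow> complex"
  assumes hol: "F holomorphic_on ball 0 R'" and r: "0 < r" "r < R'" and w: "norm w < r"
  shows "((\<lambda>t. F (of_real r * cis t) * (of_real r * cis t) / (of_real r * cis t - w) ^ Suc k)
           has_integral 2 * pi / fact k * (deriv ^^ k) F w) {-pi..pi}"
proof -
  define G where "G = (\<lambda>z. F z * z / (z - w) ^ Suc k)"
  have contF: "continuous_on (cball 0 r) F"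
    by (rule continuous_on_subset[OF holomorphic_on_imp_continuous_on[OF hol]]) (use r in auto)
  have holF: "F holomorphic_on ball 0 r"
    by (rule holomorphic_on_subset[OF hol]) (use r in auto)
  have "((\<lambda>u. F u / (u-w) ^ (Suc k)) has_contour_integral 
         ((2 * pi * \<i>) / (fact k) * (deriv ^^ k) F w)) (part_circlepath 0 r 0 (2*pi))"
    using Cauchy_has_contour_integral_higher_derivative_circlepath[OF contF holF, of w k] w
    by (simp add: circlepath_def)
  then have "((\<lambda>t. F (of_real r * cis t) / (of_real r * cis t - w) ^ Suc k * r * \<i> * cis t)
       has_integral ((2 * pi * \<i>) / (fact k) * (deriv ^^ k) F w)) {0..2*pi}"
    by (subst (asm) has_contour_integral_part_circlepath_iff) auto
  from has_integral_mult_right[OF this, of "-\<i>"]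
  have 1: "((\<lambda>t. G (of_real r * cis t)) has_integral (2 * pi / fact k * (deriv ^^ k) F w)) {0..2*pi}"
    by (simp add: G_def mult_ac)
  have contG: "continuous_on (sphere 0 r) G"
    unfolding G_def using w
    by (intro continuous_intros continuous_on_subset[OF contF]) auto
  have "integral {-pi..pi} (\<lambda>t. G (of_real r * cis t)) = (2 * pi / fact k * (deriv ^^ k) F w)"
    using integral_circle_shift[OF contG, of 0] r integral_unique[OF 1] by simp
  then have "((\<lambda>t. G (of_real r * cis t)) has_integral (2 * pi / fact k * (deriv ^^ k) F w)) {-pi..pi}"
    using circle_integrable[OF contG, of "-pi" pi] r by (simp add: has_integral_integral)
  then show ?thesis by (simp add: G_def)
qed

lemma holomorphic_mean_value:
  fixes F :: "complex \<Rightarrow> complex"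
  assumes hol: "F holomorphic_on ball 0 R'" and r: "0 < r" "r < R'"
  shows "((\<lambda>t. F (of_real r * cis t)) has_integral 2 * pi * F 0) {-pi..pi}"
  using Cauchy_has_integral_circle[OF hol r, of 0 0] r by simp

lemma circle_mean_Re:
  fixes F :: "complex \<Rightarrow> complex"
  assumes hol: "F holomorphic_on ball 0 R'" and r: "0 < r" "r < R'"
  shows "circle_mean r (\<lambda>z. Re (F z)) = Re (F 0)"
  using integral_unique[OF has_integral_Re[OF holomorphic_mean_value[OF assms]]]
  by (simp add: circle_mean_def)

lemma circle_mean_mono:
  assumes "continuous_on (sphere 0 r) u" "continuous_on (sphere 0 r) v" "r \<ge> 0"
    "\<And>z. norm z = r \<Longrightarrow> u z \<le> v z"
  shows "circle_mean r u \<le> circle_mean r v"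
  unfolding circle_mean_def
  by (intro mult_left_mono integral_le circle_integrable assms) (use assms in \<open>auto simp: norm_mult\<close>)

lemma circle_mean_add:
  assumes "continuous_on (sphere 0 r) u" "continuous_on (sphere 0 r) v" "r \<ge> 0"
  shows "circle_mean r (\<lambda>z. u z + v z) = circle_mean r u + circle_mean r v"
  using Henstock_Kurzweil_Integration.integral_add[OF circle_integrable[OF assms(1,3)] circle_integrable[OF assms(2,3)], of "-pi" pi]
  by (simp add: circle_mean_def algebra_simps add_divide_distrib)

lemma circle_mean_diff:
  assumes "continuous_on (sphere 0 r) u" "continuous_on (sphere 0 r) v" "r \<ge> 0"
  shows "circle_mean r (\<lambda>z. u z - v z) = circle_mean r u - circle_mean r v"
  using Henstock_Kurzweil_Integration.integral_diff[OF circle_integrable[OF assms(1,3)] circle_integrable[OF assms(2,3)], of "-pi" pi]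
  by (simp add: circle_mean_def right_diff_distrib diff_divide_distrib)

lemma circle_mean_const [simp]: "circle_mean r (\<lambda>z. c) = c"
  by (simp add: circle_mean_def)

lemma circle_mean_cmult: "circle_mean r (\<lambda>z. c * u z) = c * circle_mean r u"
  by (simp add: circle_mean_def)

lemma circle_mean_sum:
  assumes "finite I" "\<And>i. i \<in> I \<Longrightarrow> continuous_on (sphere 0 r) (u i)" "r \<ge> 0"
  shows "circle_mean r (\<lambda>z. \<Sum>i\<in>I. u i z) = (\<Sum>i\<in>I. circle_mean r (u i))"
  using assms(1,2)
proof (induction I rule: finite_induct)
  case (insert i I)
  then show ?case
    by (simp add: circle_mean_add continuous_on_sum assms(3))
qed simp

lemma circle_mean_cong:
  assumes "\<And>z. norm z = r \<Longrightarrow> u z = v z" "r \<ge> 0"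
  shows "circle_mean r u = circle_mean r v"
  unfolding circle_mean_def
  by (intro arg_cong2[where f="(*)"] refl Henstock_Kurzweil_Integration.integral_cong)
     (use assms in \<open>auto simp: norm_mult\<close>)

text \<open>Reflection in the circle: |z - a| equals r |1 - cnj a z / r^2| for |z| = r, and the
  second factor is zero-free on a disc of radius larger than r. The real part of its logarithm
  therefore has mean 0, the value at the origin.\<close>

lemma circle_mean_ln_dist:
  assumes "norm a < r"
  shows "circle_mean r (\<lambda>z. ln (norm (z - a))) = ln r"
proof -
  have r: "r > 0" using assms norm_ge_zero order_le_less_trans by blast
  \<comment> \<open>The zero of \<open>1 - cnj a * z / r ^ 2\<close> has modulus
    \<open>r * r / norm a\<close>; for \<open>a = 0\<close> any radius beyond \<open>r\<close>
    serves.\<close>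
  define R' where "R' = (if a = 0 then 2*r else r * r / norm a)"
  define F where "F = (\<lambda>z::complex. Ln (1 - cnj a * z / of_real r ^ 2))"
  have R': "r < R'" using r assms by (auto simp: R'_def field_simps)
  have lt1: "norm (cnj a * z / of_real r ^ 2) < 1" if "norm z < R'" for z :: complex
  proof (cases "a = 0")
    case False
    then have "norm z * norm a < r * r" using that by (simp add: R'_def field_simps)
    then show ?thesis using r by (simp add: norm_mult norm_divide norm_power power2_eq_square mult.commute)
  qed auto
  have nonneg: "1 - w \<notin> \<real>\<^sub>\<le>\<^sub>0" if "norm w < 1" for w :: complex
  proof -
    have "Re w < 1" using complex_Re_le_cmod[of w] that by linarith
    then show ?thesis by (auto simp: complex_nonpos_Reals_iff)
  qed
  have hol: "F holomorphic_on ball 0 R'"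
    unfolding F_def by (intro holomorphic_intros) (use nonneg[OF lt1] r in auto)
  have "circle_mean r (\<lambda>z. ln (norm (z - a))) = circle_mean r (\<lambda>z. ln r + Re (F z))"
  proof (rule circle_mean_cong)
    fix z :: complex assume z: "norm z = r"
    define q where "q = 1 - cnj a * z / of_real r ^ 2"
    have q0: "q \<noteq> 0" using nonneg[OF lt1, of z] z R' by (auto simp: q_def)
    have "z * cnj z = of_real r ^ 2" using z by (simp add: complex_norm_square[symmetric])
    then have "cnj z * q = cnj (z - a)" using r
      by (simp add: q_def field_simps power2_eq_square)
    then have "norm (z - a) = r * norm q"
      by (metis complex_mod_cnj norm_mult z)
    then show "ln (norm (z - a)) = ln r + Re (F z)"
      using r q0 by (simp add: ln_mult F_def q_def[symmetric])
  qed (use r in auto)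
  also have "\<dots> = ln r + circle_mean r (\<lambda>z. Re (F z))"
  proof -
    have "continuous_on (sphere 0 r) (\<lambda>z. Re (F z))"
      by (intro continuous_intros continuous_on_subset[OF holomorphic_on_imp_continuous_on[OF hol]])
         (use R' in auto)
    then show ?thesis using r by (subst circle_mean_add) auto
  qed
  also have "circle_mean r (\<lambda>z. Re (F z)) = Re (F 0)"
    by (rule circle_mean_Re[OF hol r R'])
  finally show ?thesis by (simp add: F_def)
qed

section \<open>Zeros of entire functions and Jensen's formula\<close>

definition nontrivial_entire :: "(complex \<Rightarrow> complex) \<Rightarrow> bool" where
  "nontrivial_entire g \<longleftrightarrow> g holomorphic_on UNIV \<and> (\<exists>w. g w \<noteq> 0)"

definition zeros_in :: "(complex \<Rightarrow> complex) \<Rightarrow> real \<Rightarrow> complex set" where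
  "zeros_in g R = {a. norm a \<le> R \<and> g a = 0}"

definition zero_mult :: "(complex \<Rightarrow> complex) \<Rightarrow> complex \<Rightarrow> nat" where
  "zero_mult g a = nat (zorder g a)"

definition zero_count :: "(complex \<Rightarrow> complex) \<Rightarrow> real \<Rightarrow> nat" where
  "zero_count g R = (\<Sum>a\<in>zeros_in g R. zero_mult g a)"

lemma nontrivial_entire_holomorphic: "nontrivial_entire g \<Longrightarrow> g holomorphic_on S"
  unfolding nontrivial_entire_def using holomorphic_on_subset by blast

lemma nontrivial_entire_analytic: "nontrivial_entire g \<Longrightarrow> g analytic_on S"
  using analytic_on_holomorphic nontrivial_entire_holomorphic by blast

lemma nontrivial_entire_continuous: "nontrivial_entire g \<Longrightarrow> continuous_on S g"
  using nontrivial_entire_holomorphic holomorphic_on_imp_continuous_on by blast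

lemma nontrivial_entire_eventually_nz:
  assumes "nontrivial_entire g"
  shows "eventually (\<lambda>z. g z \<noteq> 0) (at a)"
proof (cases "g a = 0")
  case True
  obtain w where "g w \<noteq> 0" using assms nontrivial_entire_def by blast
  then obtain r where "0 < r" "\<And>z. z \<in> ball a r - {a} \<Longrightarrow> g z \<noteq> 0"
    using isolated_zeros[OF nontrivial_entire_holomorphic[OF assms] open_UNIV connected_UNIV _ True]
    by (metis UNIV_I)
  then show ?thesis
    by (auto simp: eventually_at dist_commute intro!: exI[of _ r])
next
  case False
  have "isCont g a"
    using nontrivial_entire_continuous[OF assms, of UNIV] by (simp add: continuous_on_eq_continuous_at)
  then show ?thesis
    using False by (simp add: isCont_def tendsto_imp_eventually_ne)
qed

lemma finite_zeros_in:
  assumes "nontrivial_entire g"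
  shows "finite (zeros_in g R)"
proof (cases "g constant_on UNIV")
  case True
  then have "zeros_in g R = {}"
    using assms by (auto simp: constant_on_def zeros_in_def nontrivial_entire_def)
  then show ?thesis by simp
next
  case False
  have "finite {z \<in> cball 0 R. g z = 0}"
    by (rule holomorphic_compact_finite_zeros[OF nontrivial_entire_holomorphic[OF assms] open_UNIV
       connected_UNIV compact_cball _ False]) simp
  moreover have "{z \<in> cball 0 R. g z = 0} = zeros_in g R" by (auto simp: zeros_in_def)
  ultimately show ?thesis by simp
qed

lemma countable_zeros:
  assumes "nontrivial_entire g"
  shows "countable {a. g a = 0}"
proof -
  have "{a. g a = 0} = (\<Union>n::nat. zeros_in g (real n))"
    by (auto simp: zeros_in_def real_arch_simple)
  then show ?thesis using finite_zeros_in[OF assms] countable_UN[of UNIV] by (metis countable_finite countableI_type)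
qed

lemma zero_mult_pos_iff:
  assumes "nontrivial_entire g"
  shows "zero_mult g a > 0 \<longleftrightarrow> g a = 0"
  using zorder_pos_iff'[OF nontrivial_entire_analytic[OF assms]
      eventually_frequently[OF at_neq_bot nontrivial_entire_eventually_nz[OF assms]]]
  by (auto simp: zero_mult_def)

text \<open>The polynomial with the zeros of \<open>g\<close> in the closed disc has the same orders
  as \<open>g\<close> on a slightly larger disc, so the quotient is zero-free there and has a
  logarithm. \<open>R < R'\<close> makes \<open>h\<close> holomorphic across the circle of radius
  \<open>R\<close>, over which it is integrated later.\<close>

lemma entire_factorization:
  assumes g: "nontrivial_entire g" and "R > 0"
  obtains R' h where "R < R'" "h holomorphic_on ball 0 R'"
    "\<And>z. z \<in> ball 0 R' \<Longrightarrow> g z = (\<Prod>a\<in>zeros_in g R. (z - a) ^ zero_mult g a) * exp (h z)"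
proof -
  \<comment> \<open>The smallest modulus of a zero outside the closed disc, capped at
    \<open>R + 1\<close> so that the minimum is over a finite nonempty set.\<close>
  define R' where "R' = Min (insert (R+1) (norm ` (zeros_in g (R+1) - zeros_in g R)))"
  have R': "R < R'"
    unfolding R'_def using finite_zeros_in[OF g] by (subst Min_gr_iff) (auto simp: zeros_in_def)
  have no_more: "norm a \<le> R" if "g a = 0" "norm a < R'" for a
  proof (rule ccontr)
    assume "\<not> norm a \<le> R"
    moreover have "R' \<le> R + 1" using finite_zeros_in[OF g] by (simp add: R'_def)
    ultimately have "a \<in> zeros_in g (R+1) - zeros_in g R"
      using that by (auto simp: zeros_in_def)
    then have "R' \<le> norm a" using finite_zeros_in[OF g] by (auto simp: R'_def intro: Min_le)
    then show False using that by simp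
  qed
  define Z where "Z = zeros_in g R"
  have Zfin: "finite Z" using finite_zeros_in[OF g] by (simp add: Z_def)
  define m where "m = zero_mult g"
  have mpos: "a \<in> Z \<Longrightarrow> m a > 0" for a
    using zero_mult_pos_iff[OF g] by (auto simp: m_def Z_def zeros_in_def)
  define P where "P = (\<lambda>z. \<Prod>a\<in>Z. (z - a) ^ m a)"
  have P_hol: "P holomorphic_on S" for S unfolding P_def by (intro holomorphic_intros)
  have P0: "P z = 0 \<longleftrightarrow> z \<in> Z" for z
    using Zfin mpos by (auto simp: P_def)
  have same: "P z = 0 \<longleftrightarrow> g z = 0" if "z \<in> ball 0 R'" for z
    using that no_more P0 by (auto simp: Z_def zeros_in_def)
  have ord: "zorder P z = zorder g z" if z: "z \<in> ball 0 R'" for z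
  proof (cases "z \<in> Z")
    case True
    define Q where "Q = (\<lambda>w. \<Prod>a\<in>Z-{z}. (w - a) ^ m a)"
    have "zorder P z = int (m z)"
    proof (rule zorder_eqI[of UNIV _ Q])
      show "Q holomorphic_on UNIV" unfolding Q_def by (intro holomorphic_intros)
      show "Q z \<noteq> 0" using Zfin by (auto simp: Q_def)
      show "P w = Q w * (w - z) powi int (m z)" for w
        using True Zfin by (simp add: P_def Q_def prod.remove[of Z z])
    qed auto
    moreover have "zorder g z = int (m z)"
      using mpos[OF True] by (simp add: m_def zero_mult_def)
    ultimately show ?thesis by simp
  next
    case False
    then have "P z \<noteq> 0" using P0 by simp
    moreover from this have "g z \<noteq> 0" using same[OF z] by simp
    moreover have "P analytic_on {z}" using P_hol analytic_on_holomorphic by blast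
    ultimately show ?thesis
      using zorder_eq_0I nontrivial_entire_analytic[OF g] by metis
  qed
  obtain u where u: "u holomorphic_on ball 0 R'" "\<And>z. z \<in> ball 0 R' \<Longrightarrow> u z \<noteq> 0"
     "\<And>z. z \<in> ball 0 R' \<Longrightarrow> g z = u z * P z"
    using holomorphic_zorder_factorization[OF nontrivial_entire_holomorphic[OF g] open_ball connected_ball P_hol same ord]
    by blast
  obtain h where h: "h holomorphic_on ball 0 R'" "\<And>z. z \<in> ball 0 R' \<Longrightarrow> u z = exp (h z)"
    using u(1,2) simply_connected_eq_holomorphic_log[OF open_ball, of 0 R'] 
    by (metis convex_ball convex_imp_simply_connected)
  show ?thesis
    by (rule that[OF R' h(1)]) (use u(3) h(2) in \<open>simp add: P_def Z_def m_def mult.commute\<close>)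
qed

lemma ln_norm_factorization:
  assumes "finite Z" "z \<notin> Z"
  shows "ln (norm ((\<Prod>a\<in>Z. (z - a) ^ m a) * exp w)) = (\<Sum>a\<in>Z. real (m a) * ln (norm (z - a))) + Re w"
proof -
  have "(\<Prod>a\<in>Z. norm (z - a) ^ m a) > 0"
    using assms by (intro prod_pos) (auto intro!: zero_less_power)
  moreover have "ln (\<Prod>a\<in>Z. norm (z - a) ^ m a) = (\<Sum>a\<in>Z. ln (norm (z - a) ^ m a))"
    using assms by (intro ln_prod) auto
  ultimately show ?thesis
    using assms by (simp add: norm_mult ln_mult prod_norm[symmetric] norm_power ln_realpow)
qed

text \<open>The logarithm of the modulus of the first nonzero Taylor coefficient of \<open>g\<close>
  at 0. It replaces \<open>ln (norm (g 0))\<close> in Jensen's formula when \<open>g\<close>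
  vanishes at 0 and does not depend on the radius, so it ends in the constants.\<close>

definition leading_ln :: "(complex \<Rightarrow> complex) \<Rightarrow> real" where
  "leading_ln g = Lim (at 0) (\<lambda>z. ln (norm (g z)) - real (zero_mult g 0) * ln (norm z))"

text \<open>In the factorisation every zero contributes \<open>ln R\<close> per multiplicity, by
  \<open>circle_mean_ln_dist\<close>, and the zero-free factor contributes \<open>Re (h 0)\<close>,
  which is identified by letting z tend to 0. The denominator 1 serves a zero at the origin.\<close>

lemma Jensen:
  assumes g: "nontrivial_entire g" and R: "R > 0" and nz: "\<And>z. norm z = R \<Longrightarrow> g z \<noteq> 0"
  shows "circle_mean R (\<lambda>z. ln (norm (g z))) =
    leading_ln g + (\<Sum>a\<in>zeros_in g R. real (zero_mult g a) * ln (R / (if a = 0 then 1 else norm a)))"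
proof -
  obtain R' h where R': "R < R'" and h: "h holomorphic_on ball 0 R'" and
    fact: "\<And>z. z \<in> ball 0 R' \<Longrightarrow> g z = (\<Prod>a\<in>zeros_in g R. (z - a) ^ zero_mult g a) * exp (h z)"
    using entire_factorization[OF g R] by blast
  define Z where "Z = zeros_in g R"
  define m where "m = zero_mult g"
  have Zfin: "finite Z" using finite_zeros_in[OF g] by (simp add: Z_def)
  have Zlt: "norm a < R" if "a \<in> Z" for a
    using nz that by (force simp: Z_def zeros_in_def less_le)
  have lng: "ln (norm (g z)) = (\<Sum>a\<in>Z. real (m a) * ln (norm (z - a))) + Re (h z)"
    if "norm z < R'" "z \<notin> Z" for z
    using ln_norm_factorization[OF Zfin that(2), of m "h z"] fact[of z] that(1) by (simp add: Z_def m_def)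
  have conth: "continuous_on (sphere 0 R) (\<lambda>z. Re (h z))"
    by (intro continuous_intros continuous_on_subset[OF holomorphic_on_imp_continuous_on[OF h]])
       (use R' in auto)
  have conta: "continuous_on (sphere 0 R) (\<lambda>z. real (m a) * ln (norm (z - a)))" if "a \<in> Z" for a
    by (intro continuous_intros) (use Zlt[OF that] in auto)
  have "circle_mean R (\<lambda>z. ln (norm (g z))) =
      circle_mean R (\<lambda>z. (\<Sum>a\<in>Z. real (m a) * ln (norm (z - a))) + Re (h z))"
    by (rule circle_mean_cong, rule lng) (use R' R Zlt in auto)
  also have "\<dots> = circle_mean R (\<lambda>z. (\<Sum>a\<in>Z. real (m a) * ln (norm (z - a)))) + circle_mean R (\<lambda>z. Re (h z))"
    by (rule circle_mean_add[OF _ conth]) (use R conta in \<open>auto intro!: continuous_on_sum\<close>)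
  also have "circle_mean R (\<lambda>z. (\<Sum>a\<in>Z. real (m a) * ln (norm (z - a)))) 
       = (\<Sum>a\<in>Z. circle_mean R (\<lambda>z. real (m a) * ln (norm (z - a))))"
    by (rule circle_mean_sum[OF Zfin conta]) (use R in auto)
  also have "\<dots> = (\<Sum>a\<in>Z. real (m a) * ln R)"
    by (intro sum.cong refl) (use Zlt in \<open>simp add: circle_mean_cmult circle_mean_ln_dist\<close>)
  also have "circle_mean R (\<lambda>z. Re (h z)) = Re (h 0)"
    by (rule circle_mean_Re[OF h R R'])
  finally have mean: "circle_mean R (\<lambda>z. ln (norm (g z))) = (\<Sum>a\<in>Z. real (m a) * ln R) + Re (h 0)" .
  \<comment> \<open>The term of the origin can thus be split off whether or not \<open>g\<close>
    vanishes there.\<close>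
  have m0: "m 0 = 0" if "0 \<notin> Z"
    using that zero_mult_pos_iff[OF g, of 0] R by (auto simp: Z_def zeros_in_def m_def)
  have "((\<lambda>z. (\<Sum>a\<in>Z-{0}. real (m a) * ln (norm (z - a))) + Re (h z)) \<longlongrightarrow> 
         (\<Sum>a\<in>Z-{0}. real (m a) * ln (norm (0 - a))) + Re (h 0)) (at 0)"
  proof -
    have "isCont h 0"
      using holomorphic_on_imp_continuous_on[OF h] R R' by (auto simp: continuous_on_eq_continuous_at)
    then have "(h \<longlongrightarrow> h 0) (at 0)" by (simp add: isCont_def)
    then show ?thesis by (intro tendsto_intros) auto
  qed
  moreover have "\<forall>\<^sub>F z in at 0. (\<Sum>a\<in>Z-{0}. real (m a) * ln (norm (z - a))) + Re (h z)
     = ln (norm (g z)) - real (zero_mult g 0) * ln (norm z)"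
  proof -
    have "\<forall>\<^sub>F z in at (0::complex). z \<in> ball 0 R' - {0}" using R R' by (intro eventually_at_in_open) auto
    then show ?thesis
    proof (rule eventually_rev_mp, intro eventually_mono[OF nontrivial_entire_eventually_nz[OF g, of 0]] impI)
      fix z assume z: "g z \<noteq> 0" "z \<in> ball 0 R' - {0}"
      have "ln (norm (g z)) = (\<Sum>a\<in>Z. real (m a) * ln (norm (z - a))) + Re (h z)"
        by (rule lng) (use z in \<open>auto simp: Z_def zeros_in_def\<close>)
      also have "(\<Sum>a\<in>Z. real (m a) * ln (norm (z - a))) = 
          real (m 0) * ln (norm z) + (\<Sum>a\<in>Z-{0}. real (m a) * ln (norm (z - a)))"
        using Zfin m0 by (cases "0 \<in> Z") (simp_all add: sum.remove[of Z 0])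
      finally show "(\<Sum>a\<in>Z-{0}. real (m a) * ln (norm (z - a))) + Re (h z)
          = ln (norm (g z)) - real (zero_mult g 0) * ln (norm z)" by (simp add: m_def)
    qed
  qed
  ultimately have "((\<lambda>z. ln (norm (g z)) - real (zero_mult g 0) * ln (norm z)) \<longlongrightarrow> 
         (\<Sum>a\<in>Z-{0}. real (m a) * ln (norm (0 - a))) + Re (h 0)) (at 0)"
    by (rule Lim_transform_eventually)
  then have lead: "leading_ln g = (\<Sum>a\<in>Z-{0}. real (m a) * ln (norm a)) + Re (h 0)"
    unfolding leading_ln_def by (simp add: tendsto_Lim)
  have "(\<Sum>a\<in>Z. real (m a) * ln R) = (\<Sum>a\<in>Z-{0}. real (m a) * ln (norm a)) 
     + (\<Sum>a\<in>Z. real (m a) * ln (R / (if a = 0 then 1 else norm a)))"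
  proof -
    have "(\<Sum>a\<in>Z-{0}. real (m a) * ln (norm a)) = (\<Sum>a\<in>Z. if a = 0 then 0 else real (m a) * ln (norm a))"
      using Zfin by (intro sum.mono_neutral_cong_left) auto
    moreover have "(\<Sum>a\<in>Z. real (m a) * ln R) = (\<Sum>a\<in>Z. (if a = 0 then 0 else real (m a) * ln (norm a))
        + real (m a) * ln (R / (if a = 0 then 1 else norm a)))"
      by (intro sum.cong refl) (use R in \<open>auto simp: ln_div algebra_simps\<close>)
    ultimately show ?thesis by (simp add: sum.distrib)
  qed
  then show ?thesis using mean lead by (simp add: Z_def m_def)
qed

text \<open>In Jensen's sum only the zeros up to \<open>R1\<close> are kept, each contributing at
  least \<open>ln (R / R1)\<close>; \<open>1 \<le> R1\<close> ensures this for a zero at the origin,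
  whose denominator is 1. With \<open>R1 = 1\<close> this serves as a lower bound for the mean, with
  larger \<open>R1\<close> as an upper bound for the number of zeros.\<close>

lemma circle_mean_ge_leading_ln:
  assumes g: "nontrivial_entire g" and R: "1 \<le> R1" "R1 < R" and nz: "\<And>z. norm z = R \<Longrightarrow> g z \<noteq> 0"
  shows "leading_ln g + real (zero_count g R1) * ln (R / R1) \<le> circle_mean R (\<lambda>z. ln (norm (g z)))"
proof -
  have "real (zero_count g R1) * ln (R / R1) = (\<Sum>a\<in>zeros_in g R1. real (zero_mult g a) * ln (R / R1))"
    by (simp add: zero_count_def sum_distrib_right)
  also have "\<dots> \<le> (\<Sum>a\<in>zeros_in g R1. real (zero_mult g a) * ln (R / (if a = 0 then 1 else norm a)))"
    by (intro sum_mono mult_left_mono) (use R in \<open>auto simp: zeros_in_def divide_simps\<close>)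
  also have "\<dots> \<le> (\<Sum>a\<in>zeros_in g R. real (zero_mult g a) * ln (R / (if a = 0 then 1 else norm a)))"
    using finite_zeros_in[OF g] R by (intro sum_mono2) (auto simp: zeros_in_def ln_ge_zero_iff)
  finally show ?thesis using Jensen[OF g _ nz] R by simp
qed

text \<open>A zero \<open>a\<close> other than 0 adds \<open>1 / t\<close> to the integrand on
  \<open>{norm a..r}\<close>, hence \<open>ln (r / norm a)\<close> to the integral; a zero at the
  origin is carried by the separate logarithmic term. The integrated counting function is therefore
  Jensen's sum.\<close>

lemma counting_integral:
  assumes g: "nontrivial_entire g" and r: "r > 0"
  shows "integral {0..r} (\<lambda>t. (real (zero_count g t) - real (zero_count g 0)) / t)
          + real (zero_count g 0) * ln r
     = (\<Sum>a\<in>zeros_in g r. real (zero_mult g a) * ln (r / (if a = 0 then 1 else norm a)))"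
proof -
  define Z where "Z = zeros_in g r"
  have Zfin: "finite Z" using finite_zeros_in[OF g] by (simp add: Z_def)
  have z0: "zero_count g 0 = (\<Sum>a\<in>Z \<inter> {0}. zero_mult g a)"
    unfolding zero_count_def by (rule sum.cong) (use r in \<open>auto simp: Z_def zeros_in_def\<close>)
  have zt: "real (zero_count g t) - real (zero_count g 0) = 
      (\<Sum>a\<in>Z-{0}. real (zero_mult g a) * (if norm a \<le> t then 1 else 0))" if "t \<in> {0..r}" for t
  proof -
    have "real (zero_count g t) = (\<Sum>a\<in>Z. real (zero_mult g a) * (if norm a \<le> t then 1 else 0))"
      unfolding zero_count_def of_nat_sum
      by (rule sum.mono_neutral_cong_left) (use that Zfin in \<open>auto simp: Z_def zeros_in_def\<close>)
    also have "\<dots> = (\<Sum>a\<in>Z\<inter>{0}. real (zero_mult g a) * (if norm a \<le> t then 1 else 0)) 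
        + (\<Sum>a\<in>Z-{0}. real (zero_mult g a) * (if norm a \<le> t then 1 else 0))"
      using Zfin by (rule sum.Int_Diff)
    finally show ?thesis using that by (simp add: z0)
  qed
  have one: "((\<lambda>t. if t \<in> {norm a..r} then 1 / t else 0) has_integral ln (r / norm a)) {0..r}"
    if "a \<in> Z - {0}" for a
  proof -
    have a: "0 < norm a" "norm a \<le> r" using that by (auto simp: Z_def zeros_in_def)
    have "((\<lambda>t. 1 / t) has_integral (ln r - ln (norm a))) {norm a..r}"
    proof (rule fundamental_theorem_of_calculus)
      fix x assume "x \<in> {norm a..r}"
      then have "norm a \<le> x" by simp
      with a(1) have "x > 0" by linarith
      then show "(ln has_vector_derivative 1 / x) (at x within {norm a..r})"
        by (auto intro!: derivative_eq_intros simp flip: has_real_derivative_iff_has_vector_derivative)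
    qed (use a in simp)
    then show ?thesis using a r by (subst has_integral_restrict) (auto simp: ln_div)
  qed
  have "((\<lambda>t. \<Sum>a\<in>Z-{0}. real (zero_mult g a) * (if t \<in> {norm a..r} then 1 / t else 0)) has_integral 
     (\<Sum>a\<in>Z-{0}. real (zero_mult g a) * ln (r / norm a))) {0..r}"
    using Zfin by (intro has_integral_sum has_integral_mult_right one) auto
  then have "((\<lambda>t. (real (zero_count g t) - real (zero_count g 0)) / t) has_integral 
     (\<Sum>a\<in>Z-{0}. real (zero_mult g a) * ln (r / norm a))) {0..r}"
    by (rule has_integral_eq[rotated]) 
       (auto simp: zt sum_divide_distrib intro!: sum.cong split: if_splits)
  then have "integral {0..r} (\<lambda>t. (real (zero_count g t) - real (zero_count g 0)) / t) = 
     (\<Sum>a\<in>Z-{0}. real (zero_mult g a) * ln (r / norm a))"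
    by (rule integral_unique)
  moreover have "(\<Sum>a\<in>Z. real (zero_mult g a) * ln (r / (if a = 0 then 1 else norm a))) =
     (\<Sum>a\<in>Z\<inter>{0}. real (zero_mult g a) * ln (r / (if a = 0 then 1 else norm a))) +
     (\<Sum>a\<in>Z-{0}. real (zero_mult g a) * ln (r / (if a = 0 then 1 else norm a)))"
    using Zfin by (rule sum.Int_Diff)
  moreover have "(\<Sum>a\<in>Z\<inter>{0}. real (zero_mult g a) * ln (r / (if a = 0 then 1 else norm a)))
     = real (zero_count g 0) * ln r"
    by (simp add: z0 sum_distrib_right)
  moreover have "(\<Sum>a\<in>Z-{0}. real (zero_mult g a) * ln (r / (if a = 0 then 1 else norm a))) = 
    (\<Sum>a\<in>Z-{0}. real (zero_mult g a) * ln (r / norm a))"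
    by (intro sum.cong) auto
  ultimately show ?thesis by (simp add: Z_def)
qed

lemma ramification_eq:
  fixes f :: "complex \<Rightarrow> complex^'i::{finite,linorder}"
  assumes W: "nontrivial_entire (wronskian f)" and r: "r > 0" 
    and nz: "\<And>z. norm z = r \<Longrightarrow> wronskian f z \<noteq> 0"
  shows "ramification r f = circle_mean r (\<lambda>z. ln (norm (wronskian f z))) - leading_ln (wronskian f)"
proof -
  have "ramification_count t f = zero_count (wronskian f) t" for t
    by (simp add: ramification_count_def zero_count_def zeros_in_def zero_mult_def)
  then show ?thesis
    using counting_integral[OF W r] Jensen[OF W r nz] by (simp add: ramification_def)
qed

section \<open>Higher derivatives of quotients\<close>

text \<open>Derivative of the Schwarz integral: \<open>deriv h z\<close> is the mean of
  \<open>2 * Re (h \<zeta>) * \<zeta> / (\<zeta> - z)^2\<close>. Cauchy's formula has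
  \<open>h\<close> in place of twice the real part, and the missing term with the conjugate of
  \<open>h\<close> has mean 0. Only the real part is under control later, since it comes from the
  logarithm of a modulus.\<close>

lemma Schwarz_derivative_bound:
  fixes h :: "complex \<Rightarrow> complex"
  assumes hol: "h holomorphic_on ball 0 R'" and R: "0 < R" "R < R'" and z: "norm z < R"
  shows "norm (deriv h z) \<le> 2 * R / (R - norm z)\<^sup>2 * circle_mean R (\<lambda>\<zeta>. \<bar>Re (h \<zeta>)\<bar>)"
proof -
  define \<zeta> where "\<zeta> = (\<lambda>t. of_real R * cis t)"
  have norm\<zeta>: "norm (\<zeta> t) = R" for t using R by (simp add: \<zeta>_def norm_mult)
  have 1: "((\<lambda>t. h (\<zeta> t) * \<zeta> t / (\<zeta> t - z)\<^sup>2) has_integral 2 * pi * deriv h z) {-pi..pi}"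
    using Cauchy_has_integral_circle[OF hol R z, of 1] by (simp add: \<zeta>_def power2_eq_square)
  define R'' where "R'' = (if z = 0 then R' else min R' (R * R / norm z))"
  have R'': "R < R''" using R z by (auto simp: R''_def field_simps)
  \<comment> \<open>On the circle \<open>cnj \<zeta> = R^2 / \<zeta>\<close>, so the boundary values
    of \<open>F\<close> are the conjugates of the missing term. The factor \<open>w\<close> gives
    \<open>F 0 = 0\<close>, hence mean 0; the pole of \<open>F\<close> is the reflection of
    \<open>z\<close> in the circle and lies outside \<open>ball 0 R''\<close>.\<close>
  define F where "F = (\<lambda>w. h w * of_real (R\<^sup>2) * w / (of_real (R\<^sup>2) - cnj z * w)\<^sup>2)"
  have nz: "of_real (R\<^sup>2) - cnj z * w \<noteq> 0" if "norm w < R''" for w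
  proof
    assume "of_real (R\<^sup>2) - cnj z * w = 0"
    then have "norm (cnj z * w) = norm (of_real (R\<^sup>2) :: complex)" by simp
    then have "norm z * norm w = R\<^sup>2" by (simp add: norm_mult norm_power)
    moreover have "norm z * norm w < R\<^sup>2"
      using that R by (cases "z = 0") (auto simp: R''_def field_simps power2_eq_square)
    ultimately show False by simp
  qed
  have "F holomorphic_on ball 0 R''"
    unfolding F_def
    by (intro holomorphic_intros holomorphic_on_subset[OF hol]) (use nz in \<open>auto simp: R''_def split: if_splits\<close>)
  from holomorphic_mean_value[OF this R(1) R''] 
  have "((\<lambda>t. F (\<zeta> t)) has_integral 0) {-pi..pi}" by (simp add: \<zeta>_def F_def)
  then have "((\<lambda>t. cnj (F (\<zeta> t))) has_integral 0) {-pi..pi}"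
    using has_integral_cnj[of "\<lambda>t. F (\<zeta> t)" 0 "{-pi..pi}"] by (simp add: o_def)
  moreover have "cnj (F (\<zeta> t)) = cnj (h (\<zeta> t)) * \<zeta> t / (\<zeta> t - z)\<^sup>2" for t
  proof -
    have c: "cnj (\<zeta> t) = of_real (R\<^sup>2) / \<zeta> t"
    proof -
      have "\<zeta> t * cnj (\<zeta> t) = of_real (R\<^sup>2)" using complex_norm_square[of "\<zeta> t"] norm\<zeta>[of t] by simp
      moreover have "\<zeta> t \<noteq> 0" using norm\<zeta>[of t] R by auto
      ultimately show ?thesis by (simp add: eq_divide_eq mult.commute)
    qed
    have ne: "\<zeta> t \<noteq> 0" "\<zeta> t - z \<noteq> 0" using norm\<zeta>[of t] R z by auto
    have "cnj (F (\<zeta> t)) = cnj (h (\<zeta> t)) * of_real (R\<^sup>2) * cnj (\<zeta> t) / (of_real (R\<^sup>2) - z * cnj (\<zeta> t))\<^sup>2"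
      by (simp add: F_def)
    also have "of_real (R\<^sup>2) - z * cnj (\<zeta> t) = of_real (R\<^sup>2) * (\<zeta> t - z) / \<zeta> t"
      using ne by (simp add: c field_simps)
    also have "cnj (h (\<zeta> t)) * of_real (R\<^sup>2) * cnj (\<zeta> t) / (of_real (R\<^sup>2) * (\<zeta> t - z) / \<zeta> t)\<^sup>2 = 
       cnj (h (\<zeta> t)) * \<zeta> t / (\<zeta> t - z)\<^sup>2"
      using ne R by (simp add: c power2_eq_square)
    finally show ?thesis .
  qed
  ultimately have "((\<lambda>t. h (\<zeta> t) * \<zeta> t / (\<zeta> t - z)\<^sup>2 + cnj (h (\<zeta> t)) * \<zeta> t / (\<zeta> t - z)\<^sup>2) has_integral 
      (2 * pi * deriv h z + 0)) {-pi..pi}"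
    by (intro has_integral_add 1) simp
  moreover have "h (\<zeta> t) * \<zeta> t / (\<zeta> t - z)\<^sup>2 + cnj (h (\<zeta> t)) * \<zeta> t / (\<zeta> t - z)\<^sup>2 = 
      of_real (2 * Re (h (\<zeta> t))) * \<zeta> t / (\<zeta> t - z)\<^sup>2" for t
  proof -
    have "of_real (2 * Re (h (\<zeta> t))) = h (\<zeta> t) + cnj (h (\<zeta> t))" by (simp only: complex_add_cnj)
    then show ?thesis by (simp only: distrib_right add_divide_distrib)
  qed
  ultimately have 2: "((\<lambda>t. of_real (2 * Re (h (\<zeta> t))) * \<zeta> t / (\<zeta> t - z)\<^sup>2) has_integral (2 * pi * deriv h z)) {-pi..pi}"
    by simp
  have conth: "continuous_on (sphere 0 R) h"
    by (rule continuous_on_subset[OF holomorphic_on_imp_continuous_on[OF hol]]) (use R in auto)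
  have 3: "(\<lambda>t. \<bar>Re (h (\<zeta> t))\<bar> * (2 * R / (R - norm z)\<^sup>2)) integrable_on {-pi..pi}"
    unfolding \<zeta>_def
    by (rule circle_integrable[where u = "\<lambda>z'. \<bar>Re (h z')\<bar> * (2 * R / (R - norm z)\<^sup>2)"])
       (use R z conth in \<open>auto intro!: continuous_intros\<close>)
  have "norm (integral {-pi..pi} (\<lambda>t. of_real (2 * Re (h (\<zeta> t))) * \<zeta> t / (\<zeta> t - z)\<^sup>2)) \<le> 
      integral {-pi..pi} (\<lambda>t. \<bar>Re (h (\<zeta> t))\<bar> * (2 * R / (R - norm z)\<^sup>2))"
  proof (rule integral_norm_bound_integral[OF has_integral_integrable[OF 2] 3])
    fix t
    have "norm (\<zeta> t - z) \<ge> R - norm z" using norm\<zeta>[of t] norm_triangle_ineq2[of "\<zeta> t" z] by simp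
    then have "(R - norm z)\<^sup>2 \<le> norm (\<zeta> t - z)^2" using z by (intro power_mono) auto
    then have "2 * \<bar>Re (h (\<zeta> t))\<bar> * R / norm (\<zeta> t - z)^2 \<le> 2 * \<bar>Re (h (\<zeta> t))\<bar> * R / (R - norm z)\<^sup>2"
      using R z by (intro divide_left_mono mult_pos_pos) (auto intro!: zero_less_power norm\<zeta>)
    then show "norm (of_real (2 * Re (h (\<zeta> t))) * \<zeta> t / (\<zeta> t - z)\<^sup>2) \<le> \<bar>Re (h (\<zeta> t))\<bar> * (2 * R / (R - norm z)\<^sup>2)"
      by (simp add: norm_mult norm_divide norm_power norm\<zeta> mult_ac)
  qed
  moreover have "integral {-pi..pi} (\<lambda>t. \<bar>Re (h (\<zeta> t))\<bar> * c) = 2 * pi * (c * circle_mean R (\<lambda>\<zeta>. \<bar>Re (h \<zeta>)\<bar>))" for c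
    by (simp add: circle_mean_def \<zeta>_def)
  ultimately have "norm (2 * pi * deriv h z) \<le> 2 * pi * (2 * R / (R - norm z)\<^sup>2 * circle_mean R (\<lambda>\<zeta>. \<bar>Re (h \<zeta>)\<bar>))"
    by (simp only: integral_unique[OF 2])
  moreover have "norm (2 * pi * deriv h z) = 2 * pi * norm (deriv h z)" by (simp add: norm_mult)
  ultimately show ?thesis by (simp only: mult_le_cancel_left_pos[of "2 * pi"] pi_gt_zero mult_pos_pos zero_less_numeral)
qed

lemma prod_power_le_scaled:
  fixes p q :: "'a \<Rightarrow> real"
  assumes "\<And>a. a \<in> Z \<Longrightarrow> 0 \<le> p a" "\<And>a. a \<in> Z \<Longrightarrow> p a \<le> c * q a"
  shows "(\<Prod>a\<in>Z. p a ^ m a) \<le> c ^ (\<Sum>a\<in>Z. m a) * (\<Prod>a\<in>Z. q a ^ m a)"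
proof -
  have "(\<Prod>a\<in>Z. p a ^ m a) \<le> (\<Prod>a\<in>Z. (c * q a) ^ m a)"
    by (intro prod_mono conjI power_mono zero_le_power assms)
  also have "\<dots> = c ^ (\<Sum>a\<in>Z. m a) * (\<Prod>a\<in>Z. q a ^ m a)"
    by (simp add: power_mult_distrib prod.distrib power_sum)
  finally show ?thesis .
qed

text \<open>\<open>D\<close> bounds the reciprocal distance from \<open>z\<close> to the zeros and
  poles. On the disc of radius \<open>1 / (2 * X)\<close> all linear factors together change the
  modulus by at most a factor e, and so does \<open>exp h\<close>. Hence
  \<open>exp 2 * norm (\<phi> z)\<close> bounds \<phi> on the small circle, and Cauchy's inequality
  applies to every order \<open>k\<close> at once.\<close>

lemma quotient_higher_deriv_bound:
  fixes \<phi> h :: "complex \<Rightarrow> complex"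
  assumes fin: "finite Z" "finite Z0"
    and h: "h holomorphic_on ball 0 R'" and R: "norm z < R" "R < R'"
    and \<phi>: "\<And>w. w \<in> ball 0 R' \<Longrightarrow> 
      \<phi> w = (\<Prod>a\<in>Z. (w - a) ^ m a) * exp (h w) / (\<Prod>a\<in>Z0. (w - a) ^ m0 a)"
    and D: "D > 0" "\<And>a. a \<in> Z \<union> Z0 \<Longrightarrow> 1 \<le> D * norm (z - a)"
    and Y: "\<And>w. norm w \<le> (norm z + R) / 2 \<Longrightarrow> norm (deriv h w) \<le> X"
    and X: "D \<le> X" "real (sum m Z + sum m0 Z0) * D \<le> X" "1 / (R - norm z) \<le> X"
  shows "norm ((deriv ^^ k) \<phi> z) \<le> fact k * exp 2 * (2 * X) ^ k * norm (\<phi> z)"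
proof -
  have X0: "X > 0" using D X by linarith
  \<comment> \<open>The 2 keeps the disc off the zeros and poles, through
    \<open>\<rho> * D \<le> 1 / 2\<close>, and inside the radius midway between
    \<open>norm z\<close> and \<open>R\<close>, where \<open>deriv h\<close> is bounded by
    \<open>X\<close>.\<close>
  define \<rho> where "\<rho> = 1 / (2 * X)"
  have \<rho>: "\<rho> > 0" using X0 by (simp add: \<rho>_def)
  have \<rho>D: "\<rho> * D \<le> 1 / 2" using X(1) X0 by (simp add: \<rho>_def field_simps)
  have "\<rho> \<le> (R - norm z) / 2"
    using X(3) X0 R by (simp add: \<rho>_def field_simps)
  then have cb: "norm w \<le> (norm z + R) / 2" if "w \<in> cball z \<rho>" for w
    using that norm_triangle_ineq2[of w z] by (simp add: dist_norm norm_minus_commute)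
  then have sub: "cball z \<rho> \<subseteq> ball 0 R'" using R by (force simp: )
  have up: "norm (w - a) \<le> exp (2 * \<rho> * D) * norm (z - a)" and lo: "norm (z - a) \<le> exp (2 * \<rho> * D) * norm (w - a)"
    and wne: "w \<noteq> a"
    if w: "w \<in> cball z \<rho>" and a: "a \<in> Z \<union> Z0" for w a
  proof -
    have wz: "norm (w - z) \<le> \<rho>" using w by (simp add: dist_norm norm_minus_commute)
    have e: "1 + 2 * \<rho> * D \<le> exp (2 * \<rho> * D)" by (rule exp_ge_add_one_self)
    have "norm (w - a) \<le> norm (w - z) + norm (z - a)" using norm_triangle_ineq[of "w - z" "z - a"] by simp
    also have "\<dots> \<le> \<rho> * (D * norm (z - a)) + norm (z - a)"
      using wz D(2)[OF a] \<rho> mult_left_mono[of 1 "D * norm (z - a)" \<rho>] by linarith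
    also have "\<dots> \<le> (1 + 2 * \<rho> * D) * norm (z - a)" using \<rho> D by (simp add: algebra_simps)
    also have "\<dots> \<le> exp (2 * \<rho> * D) * norm (z - a)" by (intro mult_right_mono e) auto
    finally show "norm (w - a) \<le> exp (2 * \<rho> * D) * norm (z - a)" .
    have tri: "norm (z - a) \<le> norm (w - z) + norm (w - a)" 
      using norm_triangle_ineq[of "z - w" "w - a"] by (simp add: norm_minus_commute)
    have "\<rho> * D \<le> 1/2 * (D * norm (z - a))" using \<rho>D D(2)[OF a] by linarith
    then have "\<rho> \<le> norm (z - a) / 2" using D(1) by (simp add: field_simps)
    then have half: "norm (w - a) \<ge> norm (z - a) / 2" using tri wz by linarith
    have "D * norm (z - a) \<le> D * (2 * norm (w - a))"
      using half D(1) by (intro mult_left_mono) auto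
    then have d1: "1 \<le> 2 * D * norm (w - a)" using D(2)[OF a] by simp
    then show "w \<noteq> a" by auto
    have "norm (z - a) \<le> \<rho> * (2 * D * norm (w - a)) + norm (w - a)"
      using tri wz d1 \<rho> mult_left_mono[of 1 "2 * D * norm (w - a)" \<rho>] by linarith
    also have "\<dots> = (1 + 2 * \<rho> * D) * norm (w - a)" by (simp add: algebra_simps)
    also have "\<dots> \<le> exp (2 * \<rho> * D) * norm (w - a)" by (intro mult_right_mono e) auto
    finally show "norm (z - a) \<le> exp (2 * \<rho> * D) * norm (w - a)" .
  qed
  have hol: "\<phi> holomorphic_on (ball 0 R' - Z0)"
  proof (rule holomorphic_transform)
    show "(\<lambda>w. (\<Prod>a\<in>Z. (w - a) ^ m a) * exp (h w) / (\<Prod>a\<in>Z0. (w - a) ^ m0 a)) holomorphic_on (ball 0 R' - Z0)"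
      using fin by (intro holomorphic_intros holomorphic_on_subset[OF h]) auto
  qed (use \<phi> in auto)
  have sub2: "cball z \<rho> \<subseteq> ball 0 R' - Z0" using sub wne by blast
  have "norm ((deriv ^^ k) \<phi> z) \<le> fact k * (exp 2 * norm (\<phi> z)) / \<rho> ^ k"
  proof (rule Cauchy_inequality[OF _ _ \<rho>])
    show "\<phi> holomorphic_on ball z \<rho>" 
      using hol sub2 by (meson ball_subset_cball holomorphic_on_subset)
    show "continuous_on (cball z \<rho>) \<phi>"
      using hol sub2 by (meson holomorphic_on_imp_continuous_on holomorphic_on_subset)
    fix w assume "norm (z - w) = \<rho>"
    then have w: "w \<in> cball z \<rho>" by (simp add: dist_norm)
    define E where "E = exp (2 * \<rho> * D)"
    have E: "E \<ge> 1" using \<rho> D by (simp add: E_def)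
    have P: "(\<Prod>a\<in>Z. norm (w - a) ^ m a) \<le> E ^ sum m Z * (\<Prod>a\<in>Z. norm (z - a) ^ m a)"
      by (intro prod_power_le_scaled) (use up[OF w] in \<open>auto simp: E_def\<close>)
    have P0: "(\<Prod>a\<in>Z0. norm (z - a) ^ m0 a) \<le> E ^ sum m0 Z0 * (\<Prod>a\<in>Z0. norm (w - a) ^ m0 a)"
      by (intro prod_power_le_scaled) (use lo[OF w] in \<open>auto simp: E_def\<close>)
    have pos: "(\<Prod>a\<in>Z0. norm (y - a) ^ m0 a) > 0" if "y \<in> cball z \<rho>" for y
      by (intro prod_pos zero_less_power) (use wne[OF that] in auto)
    have zc: "z \<in> cball z \<rho>" using \<rho> by simp
    have "norm (h w - h z) \<le> X * norm (w - z)"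
    proof (rule field_differentiable_bound[of "cball z \<rho>" h "deriv h"])
      fix y assume y: "y \<in> cball z \<rho>"
      show "(h has_field_derivative deriv h y) (at y within cball z \<rho>)"
        using holomorphic_derivI[OF h open_ball] y sub has_field_derivative_at_within by blast
      show "norm (deriv h y) \<le> X" using Y cb[OF y] by simp
    qed (use w zc in auto)
    also have "\<dots> \<le> X * \<rho>" using w X0 by (intro mult_left_mono) (auto simp: dist_norm norm_minus_commute)
    also have "\<dots> \<le> 1" using X0 by (simp add: \<rho>_def)
    finally have "Re (h w) - Re (h z) \<le> 1" using complex_Re_le_cmod[of "h w - h z"] by simp
    then have H: "norm (exp (h w)) \<le> exp 1 * norm (exp (h z))" by (simp add: exp_add[symmetric])
    have n: "norm (\<phi> y) = (\<Prod>a\<in>Z. norm (y - a) ^ m a) * norm (exp (h y)) / (\<Prod>a\<in>Z0. norm (y - a) ^ m0 a)"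
      if "y \<in> cball z \<rho>" for y
      using \<phi>[of y] sub that by (auto simp: norm_mult norm_divide prod_norm[symmetric] norm_power)
    have "norm (\<phi> w) \<le> (E ^ sum m Z * (\<Prod>a\<in>Z. norm (z - a) ^ m a)) * (exp 1 * norm (exp (h z))) /
        ((\<Prod>a\<in>Z0. norm (z - a) ^ m0 a) / E ^ sum m0 Z0)"
      unfolding n[OF w]
    proof (intro frac_le mult_mono P H)
      show "(\<Prod>a\<in>Z0. norm (z - a) ^ m0 a) / E ^ sum m0 Z0 \<le> (\<Prod>a\<in>Z0. norm (w - a) ^ m0 a)"
        using P0 E by (simp add: divide_le_eq mult.commute)
    qed (use E pos[OF zc] in \<open>simp_all add: mult_nonneg_nonneg prod_nonneg\<close>)
    also have "\<dots> = E ^ (sum m Z + sum m0 Z0) * exp 1 * norm (\<phi> z)"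
      using E by (simp add: n[OF zc] power_add field_simps)
    also have "E ^ (sum m Z + sum m0 Z0) \<le> exp 1"
    proof -
      have "E ^ (sum m Z + sum m0 Z0) = exp (2 * \<rho> * (real (sum m Z + sum m0 Z0) * D))"
        by (simp add: E_def exp_of_nat_mult[symmetric] mult_ac)
      also have "2 * \<rho> * (real (sum m Z + sum m0 Z0) * D) \<le> 2 * \<rho> * X"
        using X(2) \<rho> by (intro mult_left_mono) auto
      also have "\<dots> = 1" using X0 by (simp add: \<rho>_def)
      finally show ?thesis by simp
    qed
    finally show "norm (\<phi> w) \<le> exp 2 * norm (\<phi> z)"
      by (simp add: mult_right_mono exp_add[symmetric])
  qed
  moreover have "fact k * (exp 2 * norm (\<phi> z)) / \<rho> ^ k = fact k * (exp 2 * norm (\<phi> z)) * (1 / \<rho>) ^ k"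
    by (simp add: power_one_over)
  moreover have "1 / \<rho> = 2 * X" by (simp add: \<rho>_def)
  ultimately show ?thesis by (simp add: mult_ac)
qed

section \<open>Hyperplanes and flats\<close>

definition lin_form :: "complex^'i \<Rightarrow> complex^'i \<Rightarrow> complex" where
  "lin_form \<alpha> w = (\<Sum>i\<in>UNIV. \<alpha> $ i * w $ i)"

definition coord_pos :: "'i::{finite,linorder} \<Rightarrow> nat" where
  "coord_pos i = card {l. l < i}"

lemma coord_pos_less_iff: "coord_pos i < coord_pos j \<longleftrightarrow> i < j"
proof -
  have lt: "coord_pos i < coord_pos j" if "i < j" for i j :: 'a
    unfolding coord_pos_def by (rule psubset_card_mono) (use that in auto)
  show ?thesis using lt[of i j] lt[of j i] by (metis linorder_neqE order_less_asym)
qed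

lemma bij_betw_coord_pos: "bij_betw (coord_pos :: 'i \<Rightarrow> nat) UNIV {..<CARD('i::{finite,linorder})}"
proof -
  have inj: "inj (coord_pos :: 'i \<Rightarrow> nat)"
    by (rule injI) (metis coord_pos_less_iff linorder_neqE less_irrefl)
  have "coord_pos i < CARD('i)" for i :: 'i
    unfolding coord_pos_def by (rule psubset_card_mono) auto
  then have "range (coord_pos :: 'i \<Rightarrow> nat) \<subseteq> {..<CARD('i)}" by auto
  moreover have "card (range (coord_pos :: 'i \<Rightarrow> nat)) = CARD('i)"
    using inj by (rule card_image)
  ultimately have "range (coord_pos :: 'i \<Rightarrow> nat) = {..<CARD('i)}"
    by (intro card_subset_eq) auto
  then show ?thesis using inj by (simp add: bij_betw_def)
qed

lemma lin_form_add: "lin_form \<alpha> (v + w) = lin_form \<alpha> v + lin_form \<alpha> w"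
  and lin_form_scale: "lin_form \<alpha> (c *s w) = c * lin_form \<alpha> w"
  and lin_form_diff: "lin_form \<alpha> (v - w) = lin_form \<alpha> v - lin_form \<alpha> w"
  and lin_form_zero: "lin_form \<alpha> 0 = 0"
  by (simp_all add: lin_form_def algebra_simps sum.distrib sum_subtractf sum_distrib_left)

lemma lin_form_commute: "lin_form \<alpha> w = lin_form w \<alpha>"
  by (simp add: lin_form_def mult.commute)

lemma hyperplane_eq: "hyperplane \<alpha> = {w. lin_form \<alpha> w = 0}"
  by (simp add: hyperplane_def lin_form_def)

lemma subspace_hyperplane: "vec.subspace (hyperplane \<alpha>)"
  by (simp add: vec.subspace_def hyperplane_eq lin_form_add lin_form_scale lin_form_zero)

lemma norm_vec_sq: "(norm (w :: complex^'i))\<^sup>2 = (\<Sum>i\<in>UNIV. (norm (w $ i))\<^sup>2)"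
  by (simp add: norm_vec_def L2_set_def real_sqrt_pow2 sum_nonneg)

lemma norm_lin_form_le: "norm (lin_form \<alpha> w) \<le> norm \<alpha> * norm w"
proof -
  have "norm (lin_form \<alpha> w) \<le> (\<Sum>i\<in>UNIV. \<bar>norm (\<alpha> $ i)\<bar> * \<bar>norm (w $ i)\<bar>)"
    unfolding lin_form_def by (rule sum_norm_le) (simp add: norm_mult)
  also have "\<dots> \<le> norm \<alpha> * norm w"
    unfolding norm_vec_def by (rule L2_set_mult_ineq)
  finally show ?thesis .
qed

lemma ln_norm_lin_form_le:
  assumes "\<alpha> \<noteq> 0" "w \<noteq> 0" "lin_form \<alpha> w \<noteq> 0"
  shows "ln (norm (lin_form \<alpha> w)) \<le> ln (norm \<alpha>) + ln (norm w)"
proof -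
  have "ln (norm (lin_form \<alpha> w)) \<le> ln (norm \<alpha> * norm w)"
    using norm_lin_form_le[of \<alpha> w] assms by (intro ln_mono) auto
  then show ?thesis using assms by (simp add: ln_mult)
qed

text \<open>Contracting the bivector of \<open>w\<close> and \<open>x\<close> with \<alpha> leaves
  \<open>lin_form \<alpha> w\<close> times \<open>x\<close>, because \<alpha> kills
  \<open>x\<close>; Cauchy-Schwarz is applied to each column \<open>y j\<close>. The double sum
  counts every coordinate of the bivector twice, hence \<open>sqrt 2\<close>.\<close>

lemma norm_lin_form_le_wedge:
  assumes "lin_form \<alpha> x = 0"
  shows "norm (lin_form \<alpha> w) * norm x \<le> sqrt 2 * norm \<alpha> * wedge_norm w x"
proof -
  define y where "y = (\<lambda>j. \<chi> i. w $ i * x $ j - w $ j * x $ i)"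
  have "lin_form \<alpha> (y j) = lin_form \<alpha> w * x $ j - w $ j * lin_form \<alpha> x" for j
    by (simp add: y_def lin_form_def sum_distrib_left sum_distrib_right sum_subtractf algebra_simps)
  then have y: "lin_form \<alpha> (y j) = lin_form \<alpha> w * x $ j" for j using assms by simp
  have "(norm (lin_form \<alpha> w) * norm x)\<^sup>2 = (\<Sum>j\<in>UNIV. (norm (lin_form \<alpha> (y j)))\<^sup>2)"
    by (simp add: y power_mult_distrib norm_vec_sq norm_mult sum_distrib_left)
  also have "\<dots> \<le> (\<Sum>j\<in>UNIV. (norm \<alpha>)\<^sup>2 * (norm (y j))\<^sup>2)"
    by (intro sum_mono) (metis norm_lin_form_le norm_ge_zero power_mono power_mult_distrib)
  also have "\<dots> = (norm \<alpha>)\<^sup>2 * (\<Sum>j\<in>UNIV. \<Sum>i\<in>UNIV. (norm (w $ i * x $ j - w $ j * x $ i))\<^sup>2)"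
    by (simp add: sum_distrib_left norm_vec_sq y_def)
  also have "(\<Sum>j\<in>UNIV. \<Sum>i\<in>UNIV. (norm (w $ i * x $ j - w $ j * x $ i))\<^sup>2) = 
      (\<Sum>i\<in>UNIV. \<Sum>j\<in>UNIV. (norm (w $ i * x $ j - w $ j * x $ i))\<^sup>2)"
    by (rule sum.swap)
  also have "\<dots> = 2 * (wedge_norm w x)\<^sup>2"
    by (simp add: wedge_norm_def sum_nonneg)
  also have "(norm \<alpha>)\<^sup>2 * (2 * (wedge_norm w x)\<^sup>2) = (sqrt 2 * norm \<alpha> * wedge_norm w x)\<^sup>2"
    by (simp add: power_mult_distrib)
  finally show ?thesis
    by (rule power2_le_imp_le) (simp add: wedge_norm_def sum_nonneg)
qed

text \<open>Rests on |a - b|^2 \<le> 2 |a|^2 + 2 |b|^2 in each coordinate. Its constant is the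
  reason why \<open>ln (sqrt 2)\<close> is later added to \<open>ln (1 / d)\<close> to obtain a
  nonnegative quantity.\<close>

lemma wedge_norm_le: "wedge_norm w x \<le> sqrt 2 * (norm w * norm x)"
proof -
  have le: "(norm (a - b))\<^sup>2 \<le> 2 * (norm a)\<^sup>2 + 2 * (norm b)\<^sup>2" for a b :: complex
  proof -
    have "(norm (a - b))\<^sup>2 \<le> (norm a + norm b)\<^sup>2"
      by (intro power_mono norm_triangle_ineq4) auto
    also have "\<dots> \<le> 2 * (norm a)\<^sup>2 + 2 * (norm b)\<^sup>2"
      using zero_le_power2[of "norm a - norm b"] by (simp add: power2_eq_square algebra_simps)
    finally show ?thesis .
  qed
  have "(\<Sum>i\<in>UNIV. \<Sum>j\<in>UNIV. (norm (w $ i * x $ j - w $ j * x $ i))\<^sup>2) \<le>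
        (\<Sum>i\<in>UNIV. \<Sum>j\<in>UNIV. 2 * ((norm (w $ i))\<^sup>2 * (norm (x $ j))\<^sup>2) + 2 * ((norm (w $ j))\<^sup>2 * (norm (x $ i))\<^sup>2))"
    by (intro sum_mono order.trans[OF le]) (simp add: norm_mult power_mult_distrib)
  also have "\<dots> = 4 * (norm w * norm x)\<^sup>2"
    by (simp add: sum.distrib sum_distrib_left[symmetric] sum_distrib_right[symmetric] norm_vec_sq power_mult_distrib)
  finally have "wedge_norm w x \<le> sqrt (4 * (norm w * norm x)\<^sup>2 / 2)"
    unfolding wedge_norm_def by (intro real_sqrt_le_mono) simp
  also have "\<dots> = sqrt 2 * (norm w * norm x)"
    by (simp add: real_sqrt_mult)
  finally show ?thesis .
qed

lemma dist_to_flat_bounds: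
  assumes w: "w \<noteq> 0" and ne: "L - {0} \<noteq> {}"
  shows "dist_to_flat w L \<le> sqrt 2"
    and "\<alpha> \<noteq> 0 \<Longrightarrow> L \<subseteq> hyperplane \<alpha> \<Longrightarrow> norm (lin_form \<alpha> w) / norm \<alpha> / (sqrt 2 * norm w) \<le> dist_to_flat w L"
proof -
  have pos: "chordal_dist w x \<ge> 0" for x
    by (auto simp: chordal_dist_def wedge_norm_def sum_nonneg)
  obtain x where x: "x \<in> L - {0}" using ne by blast
  have "chordal_dist w x \<le> sqrt 2"
    using wedge_norm_le[of w x] w x by (simp add: chordal_dist_def divide_le_eq)
  then show "dist_to_flat w L \<le> sqrt 2"
    unfolding dist_to_flat_def
    by (intro cINF_lower2[OF _ x] bdd_belowI2[of _ 0]) (auto simp: pos)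
  assume \<alpha>: "\<alpha> \<noteq> 0" "L \<subseteq> hyperplane \<alpha>"
  show "norm (lin_form \<alpha> w) / norm \<alpha> / (sqrt 2 * norm w) \<le> dist_to_flat w L"
    unfolding dist_to_flat_def
  proof (rule cINF_greatest[OF ne])
    fix x assume x: "x \<in> L - {0}"
    then have "lin_form \<alpha> x = 0" using \<alpha> by (auto simp: hyperplane_eq)
    from norm_lin_form_le_wedge[OF this, of w] 
    have "norm (lin_form \<alpha> w) * norm x \<le> sqrt 2 * norm \<alpha> * wedge_norm w x" .
    then show "norm (lin_form \<alpha> w) / norm \<alpha> / (sqrt 2 * norm w) \<le> chordal_dist w x"
      using \<alpha> w x by (simp add: chordal_dist_def field_simps)
  qed
qed

lemma dim_Int_hyperplane:
  fixes L :: "(complex^'i) set"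
  assumes L: "vec.subspace L"
  shows "vec.dim L \<le> Suc (vec.dim (L \<inter> hyperplane \<alpha>))"
proof (cases "L \<subseteq> hyperplane \<alpha>")
  case True
  then show ?thesis by (simp add: inf_absorb1)
next
  case False
  then obtain v where v: "v \<in> L" "lin_form \<alpha> v \<noteq> 0" by (auto simp: hyperplane_eq)
  have "L \<subseteq> vec.span (insert v (L \<inter> hyperplane \<alpha>))"
  proof
    fix x assume x: "x \<in> L"
    define c where "c = lin_form \<alpha> x / lin_form \<alpha> v"
    have "x - c *s v \<in> L" using x v L by (intro vec.subspace_diff vec.subspace_scale)
    moreover have "lin_form \<alpha> (x - c *s v) = 0" using v by (simp add: lin_form_diff lin_form_scale c_def)
    ultimately have "x - c *s v \<in> vec.span (L \<inter> hyperplane \<alpha>)"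
      by (intro vec.span_base) (simp add: hyperplane_eq)
    then show "x \<in> vec.span (insert v (L \<inter> hyperplane \<alpha>))"
      by (auto simp: vec.span_insert)
  qed
  then have "vec.dim L \<le> vec.dim (insert v (L \<inter> hyperplane \<alpha>))"
    by (metis vec.dim_span vec.dim_subset)
  also have "\<dots> \<le> Suc (vec.dim (L \<inter> hyperplane \<alpha>))" by (simp add: vec.dim_insert)
  finally show ?thesis .
qed

section \<open>Flats cut out by a greedily chosen basis of normals\<close>

definition meet :: "(nat \<Rightarrow> complex^'i) \<Rightarrow> nat \<Rightarrow> (complex^'i) set" where
  "meet b j = (\<Inter>i<j. hyperplane (b i))"

lemma subspace_meet: "vec.subspace (meet b j)"
  unfolding meet_def by (intro vec.subspace_Inter) (auto simp: subspace_hyperplane)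

lemma dim_meet_step: "vec.dim (meet b j) \<le> vec.dim (meet b (j + d)) + d"
proof (induction d)
  case (Suc d)
  have "meet b (j + Suc d) = meet b (j + d) \<inter> hyperplane (b (j + d))"
    by (auto simp: meet_def less_Suc_eq)
  then show ?case using Suc dim_Int_hyperplane[OF subspace_meet, of b "j+d" "b (j+d)"] by simp
qed simp

text \<open>Fewer than \<open>CARD('i)\<close> vectors have a proper span, so the spanning set
  \<open>V\<close> still has candidates outside it, and one with least \<delta> is taken. In the
  application \<delta> is the distance of a fixed point to the hyperplane, up to the norm of the
  point.\<close>

lemma greedy_independent:
  fixes V :: "(complex^'i) set" and \<delta> :: "complex^'i \<Rightarrow> real"
  assumes V: "finite V" "vec.span V = UNIV"
  obtains b where "\<And>j. j < CARD('i) \<Longrightarrow> b j \<in> V"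
    "\<And>j. j < CARD('i) \<Longrightarrow> b j \<notin> vec.span (b ` {..<j})"
    "\<And>j c. j < CARD('i) \<Longrightarrow> c \<in> V \<Longrightarrow> c \<notin> vec.span (b ` {..<j}) \<Longrightarrow> \<delta> (b j) \<le> \<delta> c"
proof -
  have "\<exists>b. \<forall>j<m. b j \<in> V \<and> b j \<notin> vec.span (b ` {..<j}) \<and> 
      (\<forall>c\<in>V. c \<notin> vec.span (b ` {..<j}) \<longrightarrow> \<delta> (b j) \<le> \<delta> c)" if "m \<le> CARD('i)" for m
    using that
  proof (induction m)
    case (Suc m)
    then obtain b where b: "\<And>j. j < m \<Longrightarrow> b j \<in> V \<and> b j \<notin> vec.span (b ` {..<j}) \<and> 
      (\<forall>c\<in>V. c \<notin> vec.span (b ` {..<j}) \<longrightarrow> \<delta> (b j) \<le> \<delta> c)" by auto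
    define U where "U = V - vec.span (b ` {..<m})"
    have "vec.dim (b ` {..<m}) \<le> card (b ` {..<m})"
      by (intro vec.dim_le_card) (auto intro: vec.span_base)
    also have "\<dots> \<le> m" using card_image_le[of "{..<m}" b] by simp
    finally have "vec.dim (b ` {..<m}) < CARD('i)" using Suc.prems by simp
    then have "vec.span (b ` {..<m}) \<noteq> UNIV" by (metis vec.dim_span vec_dim_card less_irrefl)
    then have "U \<noteq> {}" using V(2) vec.span_minimal[OF _ vec.subspace_span, of V "b ` {..<m}"]
      by (auto simp: U_def)
    moreover have "finite U" using V by (simp add: U_def)
    ultimately obtain x where x: "x \<in> U" "\<And>c. c \<in> U \<Longrightarrow> \<delta> x \<le> \<delta> c"
      by (metis ex_is_arg_min_if_finite is_arg_min_linorder)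
    define b' where "b' = b(m := x)"
    have im: "b' ` {..<j} = b ` {..<j}" if "j \<le> m" for j using that by (auto simp: b'_def)
    have "\<forall>j<Suc m. b' j \<in> V \<and> b' j \<notin> vec.span (b' ` {..<j}) \<and> 
      (\<forall>c\<in>V. c \<notin> vec.span (b' ` {..<j}) \<longrightarrow> \<delta> (b' j) \<le> \<delta> c)"
    proof (intro allI impI)
      fix j assume "j < Suc m"
      then consider "j < m" | "j = m" by linarith
      then show "b' j \<in> V \<and> b' j \<notin> vec.span (b' ` {..<j}) \<and> 
        (\<forall>c\<in>V. c \<notin> vec.span (b' ` {..<j}) \<longrightarrow> \<delta> (b' j) \<le> \<delta> c)"
      proof cases
        case 1 then show ?thesis using b[of j] im[of j] by (simp add: b'_def)
      next
        case 2 then show ?thesis using x im[of m] by (simp add: b'_def U_def)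
      qed
    qed
    then show ?case by blast
  qed simp
  from this[OF order_refl] that show ?thesis by metis
qed

lemma greedy_dim:
  assumes "\<And>j. j < m \<Longrightarrow> b j \<notin> vec.span (b ` {..<j})"
  shows "vec.dim (b ` {..<m}) = m"
  using assms
proof (induction m)
  case (Suc m)
  have "b ` {..<Suc m} = insert (b m) (b ` {..<m})" by (auto simp: less_Suc_eq)
  then show ?case using Suc by (simp add: vec.dim_insert)
qed simp

text \<open>By symmetry of the bilinear form, a vector \<open>w\<close> on all hyperplanes
  \<open>b i\<close> has all \<open>b i\<close>, and so their span, in \<open>hyperplane w\<close>;
  the span is everything, and the unit vectors give \<open>w = 0\<close>.\<close>

lemma meet_full:
  fixes b :: "nat \<Rightarrow> complex^'i"
  assumes "\<And>j. j < CARD('i) \<Longrightarrow> b j \<notin> vec.span (b ` {..<j})"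
  shows "meet b CARD('i) = {0}"
proof -
  have "vec.dim (vec.span (b ` {..<CARD('i)})) = vec.dim (UNIV :: (complex^'i) set)"
    using greedy_dim[OF assms] by (simp only: vec.dim_span vec_dim_card)
  then have sp: "vec.span (b ` {..<CARD('i)}) = UNIV"
    by (intro vec.subspace_dim_equal) auto
  show ?thesis
  proof (intro equalityI subsetI)
    fix w assume w: "w \<in> meet b CARD('i)"
    have "vec.span (b ` {..<CARD('i)}) \<subseteq> hyperplane w"
      by (rule vec.span_minimal[OF _ subspace_hyperplane])
         (use w in \<open>auto simp: meet_def hyperplane_eq lin_form_commute\<close>)
    then have "lin_form w (axis i 1) = 0" for i using sp by (auto simp: hyperplane_eq)
    then have "w $ i = 0" for i by (simp add: lin_form_def axis_def if_distrib cong: if_cong)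
    then show "w \<in> {0}" by (simp add: vec_eq_iff)
  qed (simp add: meet_def hyperplane_eq lin_form_zero)
qed

text \<open>Each hyperplane lowers the dimension by at most one. Counting on to
  \<open>meet_full\<close> bounds the dimension from above, counting from the whole space bounds it
  from below.\<close>

lemma dim_meet:
  fixes b :: "nat \<Rightarrow> complex^'i"
  assumes "\<And>j. j < CARD('i) \<Longrightarrow> b j \<notin> vec.span (b ` {..<j})" "j \<le> CARD('i)"
  shows "vec.dim (meet b j) = CARD('i) - j"
proof -
  have "vec.dim (meet b j) \<le> CARD('i) - j"
    using dim_meet_step[of b j "CARD('i) - j"] meet_full[of b] assms by simp
  moreover have "meet b 0 = UNIV" by (simp add: meet_def)
  then have "CARD('i) \<le> vec.dim (meet b j) + j"
    using dim_meet_step[of b 0 j] by (simp add: card_cart_basis)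
  ultimately show ?thesis by simp
qed

text \<open>The test vectors with entry \<open>\<beta> $ i\<close> at place \<open>j\<close> and
  \<open>- \<beta> $ j\<close> at place \<open>i\<close> lie in the hyperplane and reveal the ratios
  of the coordinates of \<alpha>.\<close>

lemma hyperplane_parallel:
  fixes \<alpha> \<beta> :: "complex^'i"
  assumes "hyperplane \<alpha> = hyperplane \<beta>" "\<beta> \<noteq> 0"
  shows "\<exists>c. \<alpha> = c *s \<beta>"
proof -
  obtain i where i: "\<beta> $ i \<noteq> 0" using assms(2) by (metis vec_eq_iff zero_index)
  have ax: "lin_form \<gamma> (axis k 1) = \<gamma> $ k" for \<gamma> and k :: 'i
    by (simp add: lin_form_def axis_def if_distrib cong: if_cong)
  have "\<alpha> $ j = (\<alpha> $ i / \<beta> $ i) * \<beta> $ j" for j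
  proof -
    define w where "w = \<beta> $ i *s axis j 1 - \<beta> $ j *s axis i 1"
    have "w \<in> hyperplane \<beta>" by (simp add: hyperplane_eq w_def lin_form_diff lin_form_scale ax)
    then have "w \<in> hyperplane \<alpha>" by (simp only: assms(1))
    then have "\<beta> $ i * \<alpha> $ j = \<beta> $ j * \<alpha> $ i" by (simp add: hyperplane_eq w_def lin_form_diff lin_form_scale ax)
    then have "\<alpha> $ j = \<beta> $ j * \<alpha> $ i / \<beta> $ i" using i by (metis nonzero_mult_div_cancel_left)
    then show ?thesis by simp
  qed
  then have "\<alpha> = (\<alpha> $ i / \<beta> $ i) *s \<beta>" by (metis vec_eq_iff vector_smult_component)
  then show ?thesis by blast
qed

text \<open>Completeness speaks of all normals, an infinite set when \<open>A\<close> is nonempty.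
  One normal per hyperplane has the same span, since the others are multiples of it, and finiteness
  of \<open>V\<close> makes later constants uniform.\<close>

lemma complete_hyperplanes_normals:
  fixes A :: "(complex^'i) set set"
  assumes "finite A" "\<forall>H\<in>A. is_hyperplane H" "complete_hyperplanes A"
  obtains V where "finite V" "0 \<notin> V" "hyperplane ` V = A" "vec.span V = UNIV"
proof -
  obtain nv where nv: "\<And>H. H \<in> A \<Longrightarrow> nv H \<noteq> 0 \<and> H = hyperplane (nv H)"
    using assms(2) unfolding is_hyperplane_def by metis
  define V where "V = nv ` A"
  have "{\<alpha>. \<alpha> \<noteq> 0 \<and> hyperplane \<alpha> \<in> A} \<subseteq> vec.span V"
  proof safe
    fix \<alpha> :: "complex^'i" assume a: "hyperplane \<alpha> \<in> A"
    then have "hyperplane \<alpha> = hyperplane (nv (hyperplane \<alpha>))" "nv (hyperplane \<alpha>) \<noteq> 0" using nv by blast+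
    then obtain c where c: "c *s nv (hyperplane \<alpha>) = \<alpha>" using hyperplane_parallel by metis
    have "nv (hyperplane \<alpha>) \<in> vec.span V" using a by (auto simp: V_def intro: vec.span_base)
    then have "c *s nv (hyperplane \<alpha>) \<in> vec.span V" by (rule vec.span_scale)
    then show "\<alpha> \<in> vec.span V" by (simp only: c)
  qed
  then have "vec.span {\<alpha>. \<alpha> \<noteq> 0 \<and> hyperplane \<alpha> \<in> A} \<subseteq> vec.span V"
    by (rule vec.span_minimal) simp
  then have "vec.span V = UNIV" using assms(3) by (auto simp: complete_hyperplanes_def)
  moreover have "hyperplane ` V = A" using nv by (force simp: V_def)
  moreover have "finite V" "0 \<notin> V" using assms(1) nv by (auto simp: V_def)
  ultimately show ?thesis using that by blast
qed

text \<open>If all normals of the hyperplanes meeting in a flat \<open>L\<close> of codimension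
  \<open>k\<close> lay in the span of the first \<open>k - 1\<close> vectors, \<open>L\<close> would
  contain \<open>meet b (k-1)\<close>, of codimension \<open>k - 1\<close>. So some normal escapes
  this span, and the greedy choice compares it with \<open>b (k-1)\<close>, the \<open>k\<close>-th
  vector since counting starts at 0.\<close>

lemma flat_dist_bounds:
  fixes V :: "(complex^'i) set"
  assumes V: "finite V" "0 \<notin> V" and w: "w \<noteq> 0"
    and b: "\<And>j. j < CARD('i) \<Longrightarrow> b j \<in> V" "\<And>j. j < CARD('i) \<Longrightarrow> b j \<notin> vec.span (b ` {..<j})"
    "\<And>j c. j < CARD('i) \<Longrightarrow> c \<in> V \<Longrightarrow> c \<notin> vec.span (b ` {..<j}) \<Longrightarrow> 
       norm (lin_form (b j) w) / norm (b j) \<le> norm (lin_form c w) / norm c"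
    and k: "1 \<le> k" "k < CARD('i)"
  shows "flat_dist (hyperplane ` V) k w \<le> sqrt 2"
    and "norm (lin_form (b (k-1)) w) / norm (b (k-1)) / (sqrt 2 * norm w) \<le> flat_dist (hyperplane ` V) k w"
proof -
  let ?A = "hyperplane ` V"
  define F where "F = {L \<in> flats ?A. codim L = k}"
  have "finite (flats ?A)"
    unfolding flats_def using V(1) by (simp add: Setcompr_eq_image)
  then have fin: "finite F" by (simp add: F_def)
  \<comment> \<open>A flat of codimension \<open>k\<close> must exist for \<open>Min\<close> in
    \<open>flat_dist\<close> to be a genuine minimum.\<close>
  have "meet b k \<in> flats ?A"
    unfolding flats_def meet_def using b(1) k(2) by (intro CollectI exI[of _ "(\<lambda>i. hyperplane (b i)) ` {..<k}"]) auto
  moreover have "codim (meet b k) = k"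
    using dim_meet[of b k, OF b(2)] k by (simp add: codim_def)
  ultimately have ne: "F \<noteq> {}" by (auto simp: F_def)
  \<comment> \<open>Since \<open>k < CARD('i)\<close>, the infimum in \<open>dist_to_flat\<close> is
    over a nonempty set.\<close>
  have nz: "L - {0} \<noteq> {}" if "L \<in> F" for L
  proof
    assume "L - {0} = {}"
    then have "vec.dim L = 0" by (subst vec.dim_eq_0) auto
    then show False using that k by (simp add: F_def codim_def del: vec.dim_eq_0)
  qed
  have lower: "norm (lin_form (b (k-1)) w) / norm (b (k-1)) / (sqrt 2 * norm w) \<le> dist_to_flat w L"
    if L: "L \<in> F" for L
  proof -
    obtain B where B: "L = \<Inter>B" "B \<subseteq> ?A" using L by (auto simp: F_def flats_def)
    have "\<exists>\<alpha>\<in>V. hyperplane \<alpha> \<in> B \<and> \<alpha> \<notin> vec.span (b ` {..<k-1})"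
    proof (rule ccontr)
      assume *: "\<not> ?thesis"
      have "meet b (k-1) \<subseteq> H" if H: "H \<in> B" for H
      proof
        fix x assume x: "x \<in> meet b (k-1)"
        obtain \<alpha> where \<alpha>: "\<alpha> \<in> V" "H = hyperplane \<alpha>" using H B by blast
        have "vec.span (b ` {..<k-1}) \<subseteq> hyperplane x"
          by (rule vec.span_minimal[OF _ subspace_hyperplane])
             (use x in \<open>auto simp: meet_def hyperplane_eq lin_form_commute\<close>)
        then show "x \<in> H" using * \<alpha> H by (auto simp: hyperplane_eq lin_form_commute)
      qed
      then have "meet b (k-1) \<subseteq> L" using B by blast
      then have "vec.dim (meet b (k-1)) \<le> vec.dim L" by (rule vec.dim_subset)
      moreover have "vec.dim (meet b (k-1)) = CARD('i) - (k-1)"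
        using k by (intro dim_meet b(2)) auto
      moreover have "CARD('i) - vec.dim L = k" using L by (simp add: F_def codim_def)
      ultimately show False using k by linarith
    qed
    then obtain \<alpha> where \<alpha>: "\<alpha> \<in> V" "hyperplane \<alpha> \<in> B" "\<alpha> \<notin> vec.span (b ` {..<k-1})" by blast
    have "norm (lin_form (b (k-1)) w) / norm (b (k-1)) / (sqrt 2 * norm w) \<le> norm (lin_form \<alpha> w) / norm \<alpha> / (sqrt 2 * norm w)"
      using k by (intro divide_right_mono b(3) \<alpha>) auto
    also have "\<dots> \<le> dist_to_flat w L"
      by (rule dist_to_flat_bounds(2)[OF w nz[OF L]]) (use \<alpha> V B in auto)
    finally show ?thesis .
  qed
  show "norm (lin_form (b (k-1)) w) / norm (b (k-1)) / (sqrt 2 * norm w) \<le> flat_dist ?A k w"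
    unfolding flat_dist_def F_def[symmetric]
  proof (rule Min.boundedI)
    fix x assume "x \<in> dist_to_flat w ` F"
    then show "norm (lin_form (b (k-1)) w) / norm (b (k-1)) / (sqrt 2 * norm w) \<le> x"
      using lower by blast
  qed (use fin ne in auto)
  obtain L where L: "L \<in> F" using ne by blast
  have "flat_dist ?A k w \<le> dist_to_flat w L"
    unfolding flat_dist_def F_def[symmetric] using fin L by (intro Min_le) auto
  also have "\<dots> \<le> sqrt 2" by (rule dist_to_flat_bounds(1)[OF w nz[OF L]])
  finally show "flat_dist ?A k w \<le> sqrt 2" .
qed

text \<open>There are n distances, but a Wronskian takes n + 1 forms: the last basis vector joins at
  no cost because its term is nonnegative. The matrix depends on \<open>w\<close>, yet all its rows
  come from \<open>V\<close>.\<close>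

lemma flat_dist_sum_bound:
  fixes V :: "(complex^'i::{finite,linorder}) set"
  assumes V: "finite V" "0 \<notin> V" "vec.span V = UNIV" and w: "w \<noteq> 0" and nz: "\<And>\<alpha>. \<alpha> \<in> V \<Longrightarrow> lin_form \<alpha> w \<noteq> 0"
  shows "\<And>k. k \<in> {1..<CARD('i)} \<Longrightarrow> 0 \<le> ln (1 / flat_dist (hyperplane ` V) k w) + ln (sqrt 2)"
    and "\<exists>B. (\<forall>i. B $ i \<in> V) \<and> det B \<noteq> 0 \<and>
      (\<Sum>k\<in>{1..<CARD('i)}. ln (1 / flat_dist (hyperplane ` V) k w) + ln (sqrt 2)) \<le>
      (\<Sum>i\<in>UNIV. ln 2 + ln (norm (B $ i) * norm w / norm (lin_form (B $ i) w)))"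
proof -
  let ?d = "\<lambda>k. flat_dist (hyperplane ` V) k w"
  obtain b where b: "\<And>j. j < CARD('i) \<Longrightarrow> b j \<in> V" "\<And>j. j < CARD('i) \<Longrightarrow> b j \<notin> vec.span (b ` {..<j})"
    "\<And>j c. j < CARD('i) \<Longrightarrow> c \<in> V \<Longrightarrow> c \<notin> vec.span (b ` {..<j}) \<Longrightarrow> 
       norm (lin_form (b j) w) / norm (b j) \<le> norm (lin_form c w) / norm c"
    using greedy_independent[OF V(1,3), of "\<lambda>\<alpha>. norm (lin_form \<alpha> w) / norm \<alpha>"] by blast
  have bn: "norm (b j) > 0" "norm (lin_form (b j) w) > 0" if "j < CARD('i)" for j
    using b(1)[OF that] V(2) nz by auto
  have wn: "norm w > 0" using w by simp
  \<comment> \<open>\<open>ln 2\<close> collects two factors \<open>sqrt 2\<close>: one from the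
    lower bound for the distance, one from the added \<open>ln (sqrt 2)\<close>.\<close>
  define T where "T = (\<lambda>j. ln 2 + ln (norm (b j) * norm w / norm (lin_form (b j) w)))"
  have dk: "?d k > 0" "0 \<le> ln (1 / ?d k) + ln (sqrt 2)" "ln (1 / ?d k) + ln (sqrt 2) \<le> T (k - 1)"
    if k: "k \<in> {1..<CARD('i)}" for k
  proof -
    define e where "e = norm (lin_form (b (k-1)) w) / norm (b (k-1)) / (sqrt 2 * norm w)"
    have k1: "k - 1 < CARD('i)" using k by auto
    have e0: "e > 0" using bn[OF k1] wn by (simp add: e_def)
    have d: "?d k \<le> sqrt 2" "e \<le> ?d k"
      using flat_dist_bounds[of V w b k] V w b k unfolding e_def by simp_all
    show d0: "?d k > 0" using d e0 by linarith
    have "ln (?d k) \<le> ln (sqrt 2)" using d d0 by simp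
    then show "0 \<le> ln (1 / ?d k) + ln (sqrt 2)" using d0 by (simp add: ln_div)
    have "ln e \<le> ln (?d k)" using d e0 by simp
    then have "ln (1 / ?d k) + ln (sqrt 2) \<le> ln (sqrt 2) - ln e" using d0 by (simp add: ln_div)
    also have "\<dots> = ln (sqrt 2 / e)" using e0 by (simp add: ln_div)
    also have "sqrt 2 / e = 2 * (norm (b (k-1)) * norm w / norm (lin_form (b (k-1)) w))"
      using bn[OF k1] wn by (simp add: e_def field_simps)
    also have "ln \<dots> = T (k - 1)" unfolding T_def using bn[OF k1] wn by (subst ln_mult) auto
    finally show "ln (1 / ?d k) + ln (sqrt 2) \<le> T (k - 1)" .
  qed
  show "\<And>k. k \<in> {1..<CARD('i)} \<Longrightarrow> 0 \<le> ln (1 / ?d k) + ln (sqrt 2)" by (rule dk(2))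
  define B where "B = (\<chi> (i::'i). b (coord_pos i))"
  have rk: "coord_pos i < CARD('i)" for i :: 'i using bij_betw_coord_pos by (auto simp: bij_betw_def)
  have T0: "T j \<ge> 0" if "j < CARD('i)" for j
  proof -
    have "norm (b j) * norm w / norm (lin_form (b j) w) \<ge> 1"
      using norm_lin_form_le[of "b j" w] bn[OF that] by (simp add: le_divide_eq)
    then show ?thesis by (simp add: T_def)
  qed
  have "(\<Sum>k\<in>{1..<CARD('i)}. ln (1 / ?d k) + ln (sqrt 2)) \<le> (\<Sum>k\<in>{1..<CARD('i)}. T (k - 1))"
    by (intro sum_mono dk(3))
  also have "\<dots> = (\<Sum>j\<in>{..<CARD('i) - 1}. T j)"
    by (rule sum.reindex_bij_witness[of _ Suc "\<lambda>k. k - 1"]) auto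
  also have "\<dots> \<le> (\<Sum>j\<in>{..<CARD('i)}. T j)"
    by (intro sum_mono2) (use T0 in auto)
  also have "\<dots> = (\<Sum>i\<in>UNIV. T (coord_pos (i::'i)))"
    by (rule sum.reindex_bij_betw[OF bij_betw_coord_pos, symmetric])
  finally have sum: "(\<Sum>k\<in>{1..<CARD('i)}. ln (1 / ?d k) + ln (sqrt 2)) \<le>
      (\<Sum>i\<in>UNIV. ln 2 + ln (norm (B $ i) * norm w / norm (lin_form (B $ i) w)))"
    by (simp add: T_def B_def)
  have "det B \<noteq> 0"
  proof -
    have "x = 0" if x: "B *v x = 0" for x
    proof -
      have *: "lin_form (b (coord_pos i)) x = 0" for i :: 'i
        using x by (simp add: vec_eq_iff matrix_vector_mult_def B_def lin_form_def)
      have "lin_form (b j) x = 0" if "j < CARD('i)" for j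
      proof -
        have "j \<in> range (coord_pos :: 'i \<Rightarrow> nat)"
          using that bij_betw_imp_surj_on[OF bij_betw_coord_pos] by blast
        then show ?thesis using * by auto
      qed
      then have "x \<in> meet b CARD('i)" by (auto simp: meet_def hyperplane_eq)
      then show ?thesis using meet_full[OF b(2)] by simp
    qed
    then have "\<exists>C. C ** B = mat 1" using matrix_left_invertible_ker[of B] by blast
    then show ?thesis using invertible_left_inverse invertible_det_nz by blast
  qed
  then show "\<exists>B. (\<forall>i. B $ i \<in> V) \<and> det B \<noteq> 0 \<and>
      (\<Sum>k\<in>{1..<CARD('i)}. ln (1 / ?d k) + ln (sqrt 2)) \<le>
      (\<Sum>i\<in>UNIV. ln 2 + ln (norm (B $ i) * norm w / norm (lin_form (B $ i) w)))"
  proof (intro exI[of _ B] conjI allI)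
    show "B $ i \<in> V" for i using b(1) rk by (simp add: B_def)
  qed (use sum in auto)
qed

section \<open>Wronskians\<close>

text \<open>The least index \<open>i\<close> moved by a permutation is sent upwards: a smaller
  \<open>p i\<close> would be fixed, so \<open>p (p i) = p i\<close>, against injectivity. Hence
  every product except that of the identity meets a zero entry.\<close>

lemma det_lower_triangular:
  fixes A :: "'a::comm_ring_1^'i::{finite,linorder}^'i::{finite,linorder}"
  assumes ld: "\<And>i j. i < j \<Longrightarrow> A $ i $ j = 0"
  shows "det A = (\<Prod>i\<in>UNIV. A $ i $ i)"
proof -
  have "(\<Prod>i\<in>UNIV. A $ i $ p i) = 0" if p: "p permutes UNIV" "p \<noteq> id" for p
  proof -
    define S where "S = {i. p i \<noteq> i}"
    have S: "finite S" "S \<noteq> {}" using p(2) by (auto simp: S_def fun_eq_iff)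
    define i where "i = Min S"
    have i: "p i \<noteq> i" using Min_in[OF S] by (simp add: i_def S_def)
    have "\<not> p i < i"
    proof
      assume "p i < i"
      then have "p i \<notin> S" using Min_le[OF S(1), of "p i"] by (auto simp: i_def[symmetric])
      then have "p (p i) = p i" by (simp add: S_def)
      then show False using i permutes_inj[OF p(1)] by (simp add: inj_eq)
    qed
    then have "A $ i $ p i = 0" using i by (intro ld) auto
    then show ?thesis by (intro prod_zero) auto
  qed
  then have "(\<Sum>p\<in>{p. p permutes UNIV}. of_int (sign p) * (\<Prod>i\<in>UNIV. A $ i $ p i)) = 
      (\<Sum>p\<in>{id}. of_int (sign p) * (\<Prod>i\<in>UNIV. A $ i $ p i))"
    by (intro sum.mono_neutral_right) (auto simp: permutes_id)
  then show ?thesis by (simp add: det_def sign_id)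
qed

lemma holomorphic_det [holomorphic_intros]:
  fixes F :: "complex \<Rightarrow> 'i::finite \<Rightarrow> 'i \<Rightarrow> complex"
  assumes "\<And>i j. (\<lambda>z. F z i j) holomorphic_on S"
  shows "(\<lambda>z. det (\<chi> i j. F z i j)) holomorphic_on S"
  unfolding det_def by (auto intro!: holomorphic_intros assms)

lemma higher_deriv_lin_comb:
  fixes u :: "'b \<Rightarrow> complex \<Rightarrow> complex"
  assumes "finite I" "\<And>i. i \<in> I \<Longrightarrow> u i holomorphic_on S" "open S" "z \<in> S"
  shows "(deriv ^^ k) (\<lambda>w. \<Sum>i\<in>I. c i * u i w) z = (\<Sum>i\<in>I. c i * (deriv ^^ k) (u i) z)"
  using assms(1,2)
proof (induction I rule: finite_induct)
  case empty
  then show ?case by (induction k) (simp_all add: higher_deriv_const del: funpow.simps)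
next
  case (insert i I)
  have "(deriv ^^ k) (\<lambda>w. c i * u i w + (\<Sum>i\<in>I. c i * u i w)) z = 
     (deriv ^^ k) (\<lambda>w. c i * u i w) z + (deriv ^^ k) (\<lambda>w. \<Sum>i\<in>I. c i * u i w) z"
    using insert.prems by (intro higher_deriv_add[of _ S]) (auto intro!: holomorphic_intros assms(3,4))
  also have "(deriv ^^ k) (\<lambda>w. c i * u i w) z = c i * (deriv ^^ k) (u i) z"
    using insert.prems by (intro higher_deriv_cmult[of _ S]) (auto simp: assms)
  finally show ?case using insert by simp
qed

lemma wronskian_eq: "wronskian f z = det (\<chi> i j. (deriv ^^ coord_pos i) (\<lambda>w. f w $ j) z)"
  by (simp add: wronskian_def coord_pos_def)

lemma wronskian_holomorphic:
  fixes f :: "complex \<Rightarrow> complex^'i::{finite,linorder}"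
  assumes "\<And>j. (\<lambda>w. f w $ j) holomorphic_on S" "open S"
  shows "wronskian f holomorphic_on S"
  unfolding wronskian_eq[abs_def] by (intro holomorphic_intros assms)

lemma wronskian_matrix_mult:
  fixes f :: "complex \<Rightarrow> complex^'i::{finite,linorder}" and B :: "complex^'i::{finite,linorder}^'i::{finite,linorder}"
  assumes f: "\<And>j. (\<lambda>w. f w $ j) holomorphic_on UNIV"
  shows "wronskian (\<lambda>w. \<chi> j. lin_form (B $ j) (f w)) z = det B * wronskian f z"
proof -
  have "(deriv ^^ k) (\<lambda>w. lin_form (B $ j) (f w)) z = (\<Sum>l\<in>UNIV. (deriv ^^ k) (\<lambda>w. f w $ l) z * B $ j $ l)" for k j
    unfolding lin_form_def by (subst higher_deriv_lin_comb[OF _ f open_UNIV]) (auto simp: mult.commute)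
  then have "(\<chi> (i::'i) j. (deriv ^^ coord_pos i) (\<lambda>w. (\<chi> j. lin_form (B $ j) (f w)) $ j) z) = 
        (\<chi> (i::'i) j. (deriv ^^ coord_pos i) (\<lambda>w. f w $ j) z) ** transpose B"
    by (simp add: vec_eq_iff matrix_matrix_mult_def transpose_def)
  then show ?thesis by (simp add: wronskian_eq det_mul)
qed

text \<open>Turns the Leibniz sum over orders of derivatives into a row of a matrix product over the
  index type.\<close>

lemma sum_coord_pos_atMost:
  fixes G :: "nat \<Rightarrow> 'a::comm_monoid_add"
  assumes "k < CARD('i::{finite,linorder})"
  shows "(\<Sum>l\<in>(UNIV::'i set). if coord_pos l \<le> k then G (coord_pos l) else 0) = (\<Sum>m=0..k. G m)"
proof -
  have "(\<Sum>l\<in>(UNIV::'i set). if coord_pos l \<le> k then G (coord_pos l) else 0) = 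
        (\<Sum>m<CARD('i). if m \<le> k then G m else 0)"
    by (rule sum.reindex_bij_betw[OF bij_betw_coord_pos, of "\<lambda>m. if m \<le> k then G m else 0"])
  also have "\<dots> = (\<Sum>m=0..k. G m)"
    by (rule sum.mono_neutral_cong_right) (use assms in auto)
  finally show ?thesis .
qed

lemma coord_pos_less_card: "coord_pos (i :: 'i) < CARD('i::{finite,linorder})"
  using bij_betw_coord_pos[where 'i = 'i] by (auto simp: bij_betw_def)

text \<open>By the Leibniz rule the derivative matrix of \<open>p\<close> times \<open>f\<close> is
  \<open>L\<close> times that of \<open>f\<close>, with \<open>L\<close> lower triangular and
  \<open>p z\<close> on the diagonal.\<close>

lemma wronskian_mult:
  fixes f :: "complex \<Rightarrow> complex^'i::{finite,linorder}"
  assumes f: "\<And>j. (\<lambda>w. f w $ j) holomorphic_on S" and p: "p holomorphic_on S" and S: "open S" "z \<in> S"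
  shows "wronskian (\<lambda>w. \<chi> j. p w * f w $ j) z = p z ^ CARD('i) * wronskian f z"
proof -
  define L :: "complex^'i::{finite,linorder}^'i::{finite,linorder}" where
    "L = (\<chi> i l. if coord_pos l \<le> coord_pos i 
        then of_nat (coord_pos i choose coord_pos l) * (deriv ^^ (coord_pos i - coord_pos l)) p z else 0)"
  have "(deriv ^^ coord_pos i) (\<lambda>w. p w * f w $ j) z = (\<Sum>l\<in>UNIV. L $ i $ l * (deriv ^^ coord_pos l) (\<lambda>w. f w $ j) z)"
    for i j
  proof -
    have "(deriv ^^ coord_pos i) (\<lambda>w. f w $ j * p w) z = (\<Sum>m=0..coord_pos i. of_nat (coord_pos i choose m) * 
        (deriv ^^ m) (\<lambda>w. f w $ j) z * (deriv ^^ (coord_pos i - m)) p z)"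
      by (rule higher_deriv_mult[OF f p S])
    also have "\<dots> = (\<Sum>l\<in>(UNIV::'i set). if coord_pos l \<le> coord_pos i then of_nat (coord_pos i choose coord_pos l) * 
        (deriv ^^ coord_pos l) (\<lambda>w. f w $ j) z * (deriv ^^ (coord_pos i - coord_pos l)) p z else 0)"
      by (rule sum_coord_pos_atMost[symmetric, OF coord_pos_less_card])
    also have "\<dots> = (\<Sum>l\<in>UNIV. L $ i $ l * (deriv ^^ coord_pos l) (\<lambda>w. f w $ j) z)"
      by (intro sum.cong refl) (simp add: L_def mult_ac)
    finally show ?thesis by (simp add: mult.commute)
  qed
  then have "(\<chi> i j. (deriv ^^ coord_pos i) (\<lambda>w. (\<chi> j. p w * f w $ j) $ j) z) = 
        L ** (\<chi> i j. (deriv ^^ coord_pos i) (\<lambda>w. f w $ j) z)"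
    by (simp add: vec_eq_iff matrix_matrix_mult_def)
  then have "wronskian (\<lambda>w. \<chi> j. p w * f w $ j) z = det L * wronskian f z"
    by (simp only: wronskian_eq det_mul)
  also have "det L = (\<Prod>i\<in>UNIV. L $ i $ i)"
  proof (rule det_lower_triangular)
    fix i j :: 'i assume "i < j"
    then have "coord_pos i < coord_pos j" by (simp add: coord_pos_less_iff)
    then show "L $ i $ j = 0" by (simp add: L_def)
  qed
  also have "\<dots> = p z ^ CARD('i)" by (simp add: L_def)
  finally show ?thesis .
qed

text \<open>Each of the \<open>CARD('i)\<close> factorial products in the determinant takes one
  entry from every row and is therefore at most the product of all \<open>1 + norm\<close> of the
  entries. That product does not depend on the permutation, so its logarithm is a plain double
  sum.\<close>

lemma ln_norm_det_le:
  fixes M :: "complex^'i::finite^'i::finite"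
  assumes "det M \<noteq> 0"
  shows "ln (norm (det M)) \<le> ln (fact CARD('i)) + (\<Sum>i\<in>UNIV. \<Sum>j\<in>UNIV. ln (1 + norm (M $ i $ j)))"
proof -
  define Q where "Q = (\<Prod>i\<in>UNIV. \<Prod>j\<in>UNIV. 1 + norm (M $ i $ j))"
  have Q: "Q > 0" unfolding Q_def by (intro prod_pos) (auto intro!: prod_pos add_pos_nonneg)
  have "norm (\<Prod>i\<in>UNIV. M $ i $ p i) \<le> Q" for p
  proof -
    have "norm (\<Prod>i\<in>UNIV. M $ i $ p i) = (\<Prod>i\<in>UNIV. norm (M $ i $ p i))" by (simp add: prod_norm)
    also have "\<dots> \<le> Q" unfolding Q_def
    proof (intro prod_mono conjI)
      fix i
      have "1 + norm (M $ i $ p i) = (\<Prod>j\<in>{p i}. 1 + norm (M $ i $ j))" by simp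
      also have "\<dots> \<le> (\<Prod>j\<in>UNIV. 1 + norm (M $ i $ j))"
        by (intro prod_mono2) auto
      finally show "norm (M $ i $ p i) \<le> (\<Prod>j\<in>UNIV. 1 + norm (M $ i $ j))" by simp
    qed auto
    finally show ?thesis .
  qed
  then have "norm (det M) \<le> (\<Sum>p | p permutes (UNIV::'i set). Q)"
    unfolding det_def by (intro sum_norm_le) (auto simp: norm_mult sign_def)
  also have "\<dots> = fact CARD('i) * Q" by (simp add: card_permutations)
  finally have "ln (norm (det M)) \<le> ln (fact CARD('i) * Q)" using assms Q by (subst ln_le_cancel_iff) auto
  also have "\<dots> = ln (fact CARD('i)) + ln Q" using Q by (simp add: ln_mult)
  also have "ln Q = (\<Sum>i\<in>UNIV. \<Sum>j\<in>UNIV. ln (1 + norm (M $ i $ j)))"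
  proof -
    have pos: "1 + norm (M $ i $ j) > 0" for i j by (simp add: add_pos_nonneg)
    have "ln Q = (\<Sum>i\<in>UNIV. ln (\<Prod>j\<in>UNIV. 1 + norm (M $ i $ j)))"
      unfolding Q_def by (rule ln_prod) (auto intro!: prod_pos pos simp: less_imp_neq[OF pos, symmetric])
    also have "\<dots> = (\<Sum>i\<in>UNIV. \<Sum>j\<in>UNIV. ln (1 + norm (M $ i $ j)))"
      by (intro sum.cong refl ln_prod) (auto simp: less_imp_neq[OF pos, symmetric] pos)
    finally show ?thesis .
  qed
  finally show ?thesis .
qed


text \<open>Expresses independence of derivatives by determinants: those of order below
  \<open>k\<close> are independent at \<open>z\<close> iff some completion \<open>u\<close> of the
  remaining rows gives a nonzero determinant.\<close>

definition mixed_rows :: "(complex \<Rightarrow> complex^'i::{finite,linorder}) \<Rightarrow> nat \<Rightarrow> ('i \<Rightarrow> complex^'i::{finite,linorder}) \<Rightarrow> complex \<Rightarrow> 'i \<Rightarrow> 'i \<Rightarrow> complex" where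
  "mixed_rows f k u z i j = (if coord_pos i < k then (deriv ^^ coord_pos i) (\<lambda>w. f w $ j) z else u i $ j)"

text \<open>
  If the Wronskian vanished identically, then near a suitable point the derivatives of \<open>f\<close> of order
  below some \<open>k \<le> n\<close> would be independent and the one of order \<open>k\<close> a combination of them with
  holomorphic coefficients, so that a linear form killing them at one point kills \<open>f\<close>.
\<close>

lemma wronskian_nontrivial:
  fixes f :: "complex \<Rightarrow> complex^'i::{finite,linorder}"
  assumes f: "\<And>j. (\<lambda>w. f w $ j) holomorphic_on UNIV" and nd: "linearly_nondegenerate f"
  shows "\<exists>z. wronskian f z \<noteq> 0"
proof (rule ccontr)
  assume W: "\<nexists>z. wronskian f z \<noteq> 0"
  define P where "P = (\<lambda>k. \<exists>z u. det (\<chi> i j. mixed_rows f k u z i j) \<noteq> 0)"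
  have f': "(\<lambda>w. f w $ j) holomorphic_on S" for j S using f holomorphic_on_subset by blast
  have "P 0"
  proof -
    have "(\<chi> i j. mixed_rows f 0 (\<lambda>i. axis i 1) z i j) = mat 1" for z
      by (simp add: mixed_rows_def mat_def axis_def vec_eq_iff)
    then have "det (\<chi> i j. mixed_rows f 0 (\<lambda>i. axis i 1) 0 i j) = det (mat 1 :: complex^'i::{finite,linorder}^'i::{finite,linorder})"
      by (simp only:)
    also have "\<dots> = 1" by (rule det_I)
    finally have "det (\<chi> i j. mixed_rows f 0 (\<lambda>i. axis i 1) 0 i j) \<noteq> 0" by simp
    then show ?thesis unfolding P_def by blast
  qed
  moreover have "\<not> P CARD('i)"
    using W coord_pos_less_card[where 'i = 'i] by (simp add: P_def mixed_rows_def wronskian_eq)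
  \<comment> \<open>The step at which independence is lost: derivatives of order below
    \<open>k\<close> are independent at some point, those up to order \<open>k\<close> at no
    point.\<close>
  ultimately obtain k where k: "k < CARD('i)" "P k" "\<not> P (Suc k)"
    by (metis inc_induct[of 0 "CARD('i)" "\<lambda>k. \<not> P k"] zero_le)
  obtain z0 u where z0: "det (\<chi> i j. mixed_rows f k u z0 i j) \<noteq> 0" using k(2) unfolding P_def by blast
  obtain ik :: 'i where ik: "coord_pos ik = k"
    using k(1) bij_betw_imp_surj_on[OF bij_betw_coord_pos[where 'i = 'i]] by (metis imageE lessThan_iff)
  define M where "M = (\<lambda>z. (\<chi> i j. mixed_rows f k u z i j))"
  define d where "d = (\<lambda>z. det (M z))"
  have rows_hol: "(\<lambda>z. mixed_rows f l u z i j) holomorphic_on S" for l u j S and i :: 'i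
    unfolding mixed_rows_def
    by (cases "coord_pos i < l") (auto intro!: holomorphic_intros holomorphic_on_subset[OF holomorphic_higher_deriv[OF f open_UNIV]])
  have d_hol: "d holomorphic_on S" for S unfolding d_def M_def by (intro holomorphic_intros rows_hol)
  have "isCont d z0" using holomorphic_on_imp_continuous_on[OF d_hol, of UNIV] by (simp add: continuous_on_eq_continuous_at)
  moreover have "d z0 \<noteq> 0" using z0 by (simp add: d_def M_def)
  ultimately obtain e where e: "e > 0" "\<And>z. dist z0 z < e \<Longrightarrow> d z \<noteq> 0"
    using continuous_at_avoid[of z0 d 0] by blast
  \<comment> \<open>The row \<open>ik\<close> is not a derivative row, since
    \<open>coord_pos ik = k\<close>. So \<alpha> kills all derivative rows at \<open>z0\<close>,
    while the entry 1 forces it to be nonzero.\<close>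
  obtain \<alpha> where \<alpha>: "M z0 *v \<alpha> = axis ik 1"
  proof -
    have "invertible (M z0)" using z0 by (simp add: invertible_det_nz M_def)
    then obtain N where "M z0 ** N = mat 1" unfolding invertible_def by blast
    then have "M z0 *v (N *v axis ik 1) = axis ik 1" by (simp add: matrix_vector_mul_assoc)
    then show ?thesis using that by blast
  qed
  have "\<alpha> \<noteq> 0"
  proof
    assume "\<alpha> = 0"
    then have "axis ik 1 = (0 :: complex^'i::{finite,linorder})" using \<alpha> by simp
    then show False by (simp add: axis_eq_0_iff)
  qed
  define y where "y = (\<lambda>w. \<Sum>j\<in>UNIV. \<alpha> $ j * f w $ j)"
  have y_hol: "y holomorphic_on S" for S unfolding y_def by (intro holomorphic_intros f')
  have y_deriv: "(deriv ^^ m) y z = (\<Sum>j\<in>UNIV. \<alpha> $ j * (deriv ^^ m) (\<lambda>w. f w $ j) z)" for m z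
    unfolding y_def by (rule higher_deriv_lin_comb[OF _ f open_UNIV]) auto
  have y_low: "(deriv ^^ coord_pos i) y z0 = 0" if "coord_pos i < k" for i :: 'i
  proof -
    have "(M z0 *v \<alpha>) $ i = 0" using that ik unfolding \<alpha> by (auto simp: axis_def)
    then show ?thesis using that
      by (simp add: y_deriv M_def matrix_vector_mult_def mixed_rows_def mult.commute)
  qed
  define Fk where "Fk = (\<lambda>z j. (deriv ^^ k) (\<lambda>w. f w $ j) z)"
  \<comment> \<open>Cramer's rule for the coefficients of \<open>Fk\<close> in the basis of rows of
    \<open>M z\<close>; as quotients of determinants they are holomorphic near
    \<open>z0\<close>.\<close>
  define c where "c = (\<lambda>i z. det (\<chi> a b. if a = i then Fk z b else mixed_rows f k u z a b) / d z)"
  have c_hol: "c i holomorphic_on ball z0 e" for i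
  proof -
    have "(\<lambda>z. if a = i then Fk z b else mixed_rows f k u z a b) holomorphic_on ball z0 e" for a b
      unfolding Fk_def using rows_hol by (cases "a = i") (auto intro!: holomorphic_intros f')
    then show ?thesis unfolding c_def
      by (intro holomorphic_intros d_hol) (use e in auto)
  qed
  \<comment> \<open>With \<open>Fk\<close> in row \<open>i\<close> and rows \<open>i\<close> and
    \<open>ik\<close> exchanged, the matrix has derivative rows up to order \<open>k\<close>, so its
    determinant vanishes by the choice of \<open>k\<close>.\<close>
  have c0: "c i z = 0" if i: "k \<le> coord_pos i" for i z
  proof -
    define N where "N = (\<chi> a b. if a = i then Fk z b else mixed_rows f k u z a b)"
    define p where "p = Transposition.transpose i ik"
    have "(\<chi> a. N $ p a) = (\<chi> a b. mixed_rows f (Suc k) (\<lambda>a. if a = i then u ik else u a) z a b)"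
    proof -
      have "N $ p a $ b = mixed_rows f (Suc k) (\<lambda>a. if a = i then u ik else u a) z a b" for a b
      proof -
        consider "a = ik" | "a \<noteq> ik" "a = i" | "a \<noteq> ik" "a \<noteq> i" by blast
        then show ?thesis
        proof cases
          case 1
          then have "p a = i" by (simp add: p_def)
          then show ?thesis using 1 ik by (simp add: N_def Fk_def mixed_rows_def)
        next
          case 2
          then have "p a = ik" by (simp add: p_def)
          moreover have "k < coord_pos a" using i 2 ik bij_betw_coord_pos[where 'i = 'i]
            by (metis bij_betw_imp_inj_on inj_eq le_neq_implies_less)
          ultimately show ?thesis using 2 ik by (simp add: N_def mixed_rows_def)
        next
          case 3
          then have "p a = a" by (simp add: p_def)
          moreover have "coord_pos a \<noteq> k" using 3 ik bij_betw_coord_pos[where 'i = 'i]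
            by (metis bij_betw_imp_inj_on inj_eq)
          ultimately show ?thesis using 3 by (simp add: N_def mixed_rows_def less_Suc_eq)
        qed
      qed
      then show ?thesis by (simp add: vec_eq_iff)
    qed
    then have "det (\<chi> a. N $ p a) = 0" using k(3) by (simp add: P_def)
    moreover have "p permutes UNIV" unfolding p_def by (rule permutes_swap_id) auto
    ultimately have "det N = 0" by (simp add: det_permute_rows sign_def split: if_splits)
    then show ?thesis by (simp add: c_def N_def)
  qed
  have Fk_comb: "Fk z j = (\<Sum>i\<in>UNIV. c i z * mixed_rows f k u z i j)" if z: "z \<in> ball z0 e" for z j
  proof -
    define x where "x = (\<chi> i. c i z)"
    have tr: "det (\<chi> a b. if b = i then (\<chi> j. Fk z j) $ a else transpose (M z) $ a $ b) = 
       det (\<chi> a b. if a = i then Fk z b else mixed_rows f k u z a b)" for i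
      by (subst det_transpose[symmetric]) (rule arg_cong[of _ _ det], simp add: transpose_def M_def vec_eq_iff)
    have "d z \<noteq> 0" using e(2) z by simp
    then have "det (transpose (M z)) \<noteq> 0" by (simp add: d_def)
    then have "transpose (M z) *v x = (\<chi> j. Fk z j)"
      by (subst cramer) (simp_all only: tr det_transpose x_def c_def d_def not_False_eq_True)
    then have "(transpose (M z) *v x) $ j = Fk z j" by simp
    then show ?thesis by (simp add: matrix_vector_mult_def transpose_def M_def x_def mult.commute)
  qed
  have y_comb: "(deriv ^^ k) y z = (\<Sum>i\<in>{i. coord_pos i < k}. c i z * (deriv ^^ coord_pos i) y z)" 
    if z: "z \<in> ball z0 e" for z
  proof -
    have *: "(deriv ^^ k) (\<lambda>w. f w $ j) z = (\<Sum>i\<in>UNIV. c i z * mixed_rows f k u z i j)" for j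
      using Fk_comb[OF z, of j] by (simp add: Fk_def)
    have "(deriv ^^ k) y z = (\<Sum>j\<in>UNIV. \<Sum>i\<in>UNIV. c i z * (\<alpha> $ j * mixed_rows f k u z i j))"
      unfolding y_deriv * sum_distrib_left by (simp add: mult.left_commute)
    also have "\<dots> = (\<Sum>i\<in>UNIV. c i z * (\<Sum>j\<in>UNIV. \<alpha> $ j * mixed_rows f k u z i j))"
      by (subst sum.swap) (simp add: sum_distrib_left)
    also have "\<dots> = (\<Sum>i\<in>{i. coord_pos i < k}. c i z * (deriv ^^ coord_pos i) y z)"
      by (rule sum.mono_neutral_cong_right) (auto simp: c0 y_deriv mixed_rows_def)
    finally show ?thesis .
  qed
  \<comment> \<open>\<open>y\<close> solves a linear differential equation of order \<open>k\<close>
    with holomorphic coefficients and zero initial values; differentiating the equation makes all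
    derivatives at \<open>z0\<close> vanish, hence \<open>y\<close> itself.\<close>
  have y_all: "(deriv ^^ q) y z0 = 0" for q
  proof (induction q rule: less_induct)
    case (less q)
    show ?case
    proof (cases "q < k")
      case True
      then have "q \<in> range (coord_pos :: 'i \<Rightarrow> nat)"
        using k(1) bij_betw_imp_surj_on[OF bij_betw_coord_pos[where 'i = 'i]] by simp
      then show ?thesis using y_low True by auto
    next
      case False
      define m where "m = q - k"
      have q: "q = m + k" using False by (simp add: m_def)
      have z0b: "z0 \<in> ball z0 e" using e by simp
      have "(deriv ^^ q) y z0 = (deriv ^^ m) ((deriv ^^ k) y) z0" by (simp add: q funpow_add)
      also have "\<dots> = (deriv ^^ m) (\<lambda>z. \<Sum>i\<in>{i. coord_pos i < k}. 1 * (c i z * (deriv ^^ coord_pos i) y z)) z0"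
      proof (rule higher_deriv_transform_within_open[OF _ _ open_ball z0b])
        show "(deriv ^^ k) y holomorphic_on ball z0 e" by (intro holomorphic_intros y_hol) auto
        show "(\<lambda>z. \<Sum>i\<in>{i. coord_pos i < k}. 1 * (c i z * (deriv ^^ coord_pos i) y z)) holomorphic_on ball z0 e"
          by (intro holomorphic_intros y_hol c_hol) auto
      qed (use y_comb in auto)
      also have "\<dots> = (\<Sum>i\<in>{i. coord_pos i < k}. 1 * (deriv ^^ m) (\<lambda>z. c i z * (deriv ^^ coord_pos i) y z) z0)"
        by (rule higher_deriv_lin_comb[OF _ _ open_ball z0b]) (auto intro!: holomorphic_intros y_hol c_hol)
      also have "\<dots> = 0"
      proof (intro sum.neutral ballI)
        fix i :: 'i assume i: "i \<in> {i. coord_pos i < k}"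
        have "(deriv ^^ m) (\<lambda>z. c i z * (deriv ^^ coord_pos i) y z) z0 = 
           (\<Sum>l = 0..m. of_nat (m choose l) * (deriv ^^ l) (c i) z0 * (deriv ^^ (m - l)) ((deriv ^^ coord_pos i) y) z0)"
          by (rule higher_deriv_mult[OF c_hol _ open_ball z0b]) (intro holomorphic_intros y_hol, auto)
        also have "\<dots> = 0"
        proof (intro sum.neutral ballI)
          fix l assume "l \<in> {0..m}"
          have "(deriv ^^ (m - l)) ((deriv ^^ coord_pos i) y) z0 = (deriv ^^ (m - l + coord_pos i)) y z0"
            by (simp add: funpow_add)
          also have "\<dots> = 0" by (rule less) (use i q in auto)
          finally show "of_nat (m choose l) * (deriv ^^ l) (c i) z0 * (deriv ^^ (m - l)) ((deriv ^^ coord_pos i) y) z0 = 0"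
            by simp
        qed
        finally show "1 * (deriv ^^ m) (\<lambda>z. c i z * (deriv ^^ coord_pos i) y z) z0 = 0" by simp
      qed
      finally show ?thesis .
    qed
  qed
  have "y w = 0" for w
    by (rule holomorphic_fun_eq_0_on_connected[OF y_hol open_UNIV connected_UNIV y_all]) auto
  then have "\<alpha> $ i = 0" for i
    using nd unfolding linearly_nondegenerate_def y_def by blast
  then show False using \<open>\<alpha> \<noteq> 0\<close> by (simp add: vec_eq_iff)
qed

section \<open>Growth of the characteristic\<close>

abbreviation log_mean :: "(complex \<Rightarrow> complex^'i) \<Rightarrow> real \<Rightarrow> real" where
  "log_mean f r \<equiv> circle_mean r (\<lambda>z. ln (norm (f z)))"

lemma integral_split_equal:
  fixes u :: "real \<Rightarrow> real"
  assumes "continuous_on UNIV u" "h \<ge> 0"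
  shows "integral {a..a + real N * h} u = (\<Sum>k<N. integral {a + real k * h..a + real k * h + h} u)"
proof (induction N)
  case (Suc N)
  have "integral {a..a + real N * h} u + integral {a + real N * h..a + real N * h + h} u = 
      integral {a..a + real N * h + h} u"
    by (rule Henstock_Kurzweil_Integration.integral_combine)
       (use assms in \<open>auto intro!: integrable_continuous_interval continuous_on_subset[OF assms(1)]\<close>)
  then show ?case using Suc by (simp add: algebra_simps)
qed simp

text \<open>The threshold \<open>N0\<close> is independent of the starting angle: the integral can
  be cut at \<phi> by periodicity, and \<open>{-pi..3*pi}\<close> contains all intervals of length 2
  pi starting in \<open>{-pi..pi}\<close>. This uniformity is needed along whole circles.\<close>

lemma periodic_Riemann_sum:
  fixes u :: "real \<Rightarrow> real"
  assumes cont: "continuous_on UNIV u" and per: "\<And>t. u (t + 2 * pi) = u t" and eps: "\<epsilon> > 0"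
  shows "\<exists>N0. \<forall>N\<ge>N0. N > 0 \<longrightarrow> (\<forall>\<phi>\<in>{-pi..pi}. 
     \<bar>(\<Sum>k<N. u (\<phi> + 2 * pi * real k / real N)) - real N * (1 / (2 * pi) * integral {-pi..pi} u)\<bar> \<le> real N * \<epsilon>)"
proof -
  have "uniformly_continuous_on {-pi..3*pi} u"
    by (intro compact_uniformly_continuous continuous_on_subset[OF cont]) auto
  then obtain \<delta> where \<delta>: "\<delta> > 0" "\<And>x x'. x \<in> {-pi..3*pi} \<Longrightarrow> x' \<in> {-pi..3*pi} \<Longrightarrow> dist x' x < \<delta> \<Longrightarrow> dist (u x') (u x) < \<epsilon>"
    using eps unfolding uniformly_continuous_on_def by metis
  obtain N0 :: nat where N0: "2 * pi / \<delta> < real N0" using reals_Archimedean2 by blast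
  have "\<bar>(\<Sum>k<N. u (\<phi> + 2 * pi * real k / real N)) - real N * (1 / (2 * pi) * integral {-pi..pi} u)\<bar> \<le> real N * \<epsilon>"
    if N: "N \<ge> N0" "N > 0" and \<phi>: "\<phi> \<in> {-pi..pi}" for N \<phi>
  proof -
    define h where "h = 2 * pi / real N"
    have "2 * pi / \<delta> < real N" using N0 N(1) by (meson less_le_trans of_nat_le_iff)
    then have h: "0 < h" "h < \<delta>" using N(2) \<delta>(1) by (auto simp: h_def field_simps)
    have Nh: "real N * h = 2 * pi" using N by (simp add: h_def)
    have eps2: "\<epsilon> * (2 * pi) = h * (real N * \<epsilon>)" by (simp add: Nh[symmetric])
    have one: "\<bar>integral {\<phi> + real k * h..\<phi> + real k * h + h} u - h * u (\<phi> + real k * h)\<bar> \<le> \<epsilon> * h" if k: "k < N" for k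
    proof -
      define c where "c = \<phi> + real k * h"
      have "real (Suc k) * h \<le> real N * h" using k h by (intro mult_right_mono) auto
      then have "h + real k * h \<le> 2 * pi" by (simp add: Nh distrib_right)
      moreover have "0 \<le> real k * h" "-pi \<le> \<phi>" "\<phi> \<le> pi" using h \<phi> by auto
      ultimately have c: "-pi \<le> c" "c + h \<le> 3 * pi" unfolding c_def by linarith+
      have int: "u integrable_on {c..c+h}"
        by (intro integrable_continuous_interval continuous_on_subset[OF cont]) auto
      have "integral {c..c+h} (\<lambda>t. u t - u c) = integral {c..c+h} u - integral {c..c+h} (\<lambda>t. u c)"
        by (intro Henstock_Kurzweil_Integration.integral_diff int integrable_const_ivl)
      also have "integral {c..c+h} (\<lambda>t. u c) = h * u c" using h by simp
      finally have "integral {c..c+h} u - h * u c = integral {c..c+h} (\<lambda>t. u t - u c)" by simp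
      moreover have "norm (integral {c..c+h} (\<lambda>t. u t - u c)) \<le> \<epsilon> * (c + h - c)"
      proof (rule integral_bound)
        show "continuous_on {c..c+h} (\<lambda>t. u t - u c)" 
          by (intro continuous_intros continuous_on_subset[OF cont]) auto
        fix t assume t: "t \<in> {c..c+h}"
        have "dist (u t) (u c) < \<epsilon>" by (rule \<delta>(2)) (use t c h in \<open>auto simp: dist_real_def\<close>)
        then show "norm (u t - u c) \<le> \<epsilon>" by (simp add: dist_norm)
      qed (use h in auto)
      ultimately show ?thesis by (simp add: c_def)
    qed
    have "integral {\<phi>..\<phi> + 2 * pi} u = integral {-pi..-pi + 2 * pi} u"
      by (rule integral_periodic_shift[OF cont per]) auto
    then have I: "integral {-pi..pi} u = (\<Sum>k<N. integral {\<phi> + real k * h..\<phi> + real k * h + h} u)"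
      using integral_split_equal[OF cont, of h \<phi> N] h Nh by simp
    have "\<bar>(\<Sum>k<N. integral {\<phi> + real k * h..\<phi> + real k * h + h} u - h * u (\<phi> + real k * h))\<bar> \<le> 
       (\<Sum>k<N. \<epsilon> * h)"
      by (intro order.trans[OF sum_abs] sum_mono one) auto
    moreover have sumeps: "(\<Sum>k<N. \<epsilon> * h) = \<epsilon> * (2 * pi)" by (simp add: Nh[symmetric])
    ultimately have "\<bar>integral {-pi..pi} u - h * (\<Sum>k<N. u (\<phi> + real k * h))\<bar> \<le> \<epsilon> * (2 * pi)"
      by (simp only: I sum_subtractf sum_distrib_left sumeps)
    then have "\<bar>h * (\<Sum>k<N. u (\<phi> + real k * h)) - integral {-pi..pi} u\<bar> \<le> \<epsilon> * (2 * pi)" by linarith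
    also have "h * (\<Sum>k<N. u (\<phi> + real k * h)) - integral {-pi..pi} u = 
       h * ((\<Sum>k<N. u (\<phi> + real k * h)) - real N * (1 / (2 * pi) * integral {-pi..pi} u))"
      using N by (simp add: h_def right_diff_distrib)
    also have "\<bar>\<dots>\<bar> = h * \<bar>(\<Sum>k<N. u (\<phi> + real k * h)) - real N * (1 / (2 * pi) * integral {-pi..pi} u)\<bar>"
      using h by (simp add: abs_mult)
    finally have "h * \<bar>(\<Sum>k<N. u (\<phi> + real k * h)) - real N * (1 / (2 * pi) * integral {-pi..pi} u)\<bar> \<le> h * (real N * \<epsilon>)"
      by (simp only: eps2)
    then have "\<bar>(\<Sum>k<N. u (\<phi> + real k * h)) - real N * (1 / (2 * pi) * integral {-pi..pi} u)\<bar> \<le> real N * \<epsilon>"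
      using h by simp
    moreover have "real k * h = 2 * pi * real k / real N" for k by (simp add: h_def)
    ultimately show ?thesis by simp
  qed
  then show ?thesis by blast
qed

lemma reduced_representation_holomorphic:
  "reduced_representation f \<Longrightarrow> (\<lambda>z. f z $ i) holomorphic_on S"
  unfolding reduced_representation_def using holomorphic_on_subset by blast

lemma reduced_representation_nz: "reduced_representation f \<Longrightarrow> f z \<noteq> 0"
  unfolding reduced_representation_def by (metis zero_index)

lemma reduced_representation_continuous:
  assumes "reduced_representation f"
  shows "continuous_on S f"
proof -
  have "continuous_on S (\<lambda>z. \<chi> i. f z $ i)"
    by (intro continuous_on_vec_lambda holomorphic_on_imp_continuous_on reduced_representation_holomorphic assms)
  then show ?thesis by simp
qed

lemma continuous_ln_norm:
  assumes "reduced_representation f"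
  shows "continuous_on S (\<lambda>z. ln (norm (f z)))"
  by (intro continuous_intros reduced_representation_continuous assms)
     (use reduced_representation_nz[OF assms] in auto)

lemma lin_form_holomorphic:
  assumes "reduced_representation f"
  shows "(\<lambda>z. lin_form \<alpha> (f z)) holomorphic_on S"
  unfolding lin_form_def by (intro holomorphic_intros reduced_representation_holomorphic assms)

text \<open>
  The product over \<open>N\<close> equidistant rotations of linear forms of \<open>f\<close>, each chosen to realise the
  norm of \<open>f\<close> at one point of the circle of radius \<open>r\<close>, transfers the maximum principle from
  holomorphic functions to the circle means of \<open>ln (norm (f z))\<close>.
\<close>

lemma log_mean_three_circles:
  fixes f :: "complex \<Rightarrow> complex^'i::finite"
  assumes f: "reduced_representation f" and r: "0 < r1" "r1 < r" "r < r2"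
  shows "log_mean f r - real p * ln r \<le> max (log_mean f r1 - real p * ln r1) (log_mean f r2 - real p * ln r2)"
    (is "_ \<le> ?mx")
proof -
  define u where "u = (\<lambda>s t. ln (norm (f (complex_of_real s * cis t))))"
  have mean: "log_mean f s = 1 / (2 * pi) * integral {-pi..pi} (u s)" for s
    by (simp add: circle_mean_def u_def)
  have u_cont: "continuous_on UNIV (u s)" for s
    unfolding u_def by (rule continuous_on_compose2[OF continuous_ln_norm[OF f, of UNIV]]) (auto intro!: continuous_intros)
  have u_per: "u s (t + 2 * pi) = u s t" for s t
    by (simp add: u_def cis_mult[symmetric])
  have key: "log_mean f r - real p * ln r \<le> ?mx + (\<epsilon> + \<epsilon>)" if \<epsilon>: "\<epsilon> > 0" for \<epsilon>
  proof -
    obtain Na where Na: "\<And>s N \<phi>. N \<ge> Na s \<Longrightarrow> N > 0 \<Longrightarrow> \<phi> \<in> {-pi..pi} \<Longrightarrow> 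
      \<bar>(\<Sum>k<N. u s (\<phi> + 2 * pi * real k / real N)) - real N * log_mean f s\<bar> \<le> real N * \<epsilon>"
      using periodic_Riemann_sum[OF u_cont u_per \<epsilon>] unfolding mean by metis
    \<comment> \<open>One number of rotations has to work for the two boundary circles and for the
      inner one; each comparison costs one \<epsilon>, whence
      \<open>\<epsilon> + \<epsilon>\<close>.\<close>
    define N where "N = Suc (Na r + Na r1 + Na r2)"
    have N: "N > 0" "N \<ge> Na r" "N \<ge> Na r1" "N \<ge> Na r2" by (auto simp: N_def)
    define \<theta> where "\<theta> = (\<lambda>k. 2 * pi * real k / real N)"
    \<comment> \<open>The conjugate unit vector is the equality case of Cauchy-Schwarz at the point
      \<open>r * cis (\<theta> k)\<close>.\<close>
    define v where "v = (\<lambda>k. \<chi> i. cnj (f (of_real r * cis (\<theta> k)) $ i) / of_real (norm (f (of_real r * cis (\<theta> k)))))"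
    define G where "G = (\<lambda>z. \<Prod>k<N. lin_form (v k) (f (z * cis (\<theta> k))))"
    \<comment> \<open>The power subtracts \<open>p * ln (norm z)\<close> after taking logarithms and
      dividing by \<open>N\<close>; its exponent is an integer, so \<open>H\<close> is single-valued
      on the annulus.\<close>
    define H where "H = (\<lambda>z. G z / z ^ (N * p))"
    have fpos: "norm (f z) > 0" for z using reduced_representation_nz[OF f] by simp
    have fexp: "exp (ln (norm (f z))) = norm (f z)" for z using fpos[of z] by simp
    have vnorm: "norm (v k) = 1" for k
    proof -
      define w where "w = f (of_real r * cis (\<theta> k))"
      have w: "norm w > 0" using fpos by (simp add: w_def)
      have "(norm (v k))\<^sup>2 = (\<Sum>i\<in>UNIV. (norm (v k $ i))\<^sup>2)" by (rule norm_vec_sq)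
      also have "\<dots> = (\<Sum>i\<in>UNIV. (norm (w $ i))\<^sup>2 / (norm w)\<^sup>2)" 
        by (simp add: v_def w_def norm_divide power_divide)
      also have "\<dots> = (norm w)\<^sup>2 / (norm w)\<^sup>2" by (simp only: norm_vec_sq[of w] sum_divide_distrib)
      also have "\<dots> = 1\<^sup>2"
        using w by simp
      finally show ?thesis by (rule power2_eq_imp_eq) auto
    qed
    have vr: "norm (lin_form (v k) (f (of_real r * cis (\<theta> k)))) = norm (f (of_real r * cis (\<theta> k)))" for k
    proof -
      define w where "w = f (of_real r * cis (\<theta> k))"
      have w: "norm w > 0" using fpos by (simp add: w_def)
      have "lin_form (v k) w = (\<Sum>i\<in>UNIV. of_real ((norm (w $ i))\<^sup>2)) / of_real (norm w)"
        by (simp only: lin_form_def v_def w_def[symmetric] complex_norm_square sum_divide_distrib) (simp add: mult.commute)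
      also have "\<dots> = of_real ((norm w)\<^sup>2 / norm w)" by (simp only: norm_vec_sq of_real_divide of_real_sum)
      also have "\<dots> = of_real (norm w)" using w by (simp add: power2_eq_square)
      finally show ?thesis using w by (simp add: w_def[symmetric])
    qed
    have G_hol: "G holomorphic_on S" for S
    proof -
      have "(\<lambda>z. lin_form (v k) (f (z * cis (\<theta> k)))) holomorphic_on S" for k
      proof -
        have "(\<lambda>z. z * cis (\<theta> k)) holomorphic_on S" by (intro holomorphic_intros)
        from holomorphic_on_compose[OF this, of "\<lambda>z. lin_form (v k) (f z)"] show ?thesis
          using lin_form_holomorphic[OF f] by (simp add: o_def)
      qed
      then show ?thesis unfolding G_def by (intro holomorphic_intros)
    qed
    have H_hol: "H holomorphic_on S" if "0 \<notin> S" for S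
      unfolding H_def by (intro holomorphic_intros G_hol) (use that in auto)
    define S where "S = cball (0::complex) r2 - ball 0 r1"
    have S0: "0 \<notin> S" using r by (simp add: S_def)
    have clS: "closed S" by (simp add: S_def closed_Diff)
    have bnd: "norm (H z) \<le> exp (real N * (?mx + \<epsilon>))" if z: "norm z = s" "s = r1 \<or> s = r2" for z s
    proof -
      have s: "s > 0" "N \<ge> Na s" using z r N by auto
      have zs: "z = of_real s * cis (Arg z)" using rcis_cmod_Arg[of z] z by (simp add: rcis_def)
      have "norm (G z) = (\<Prod>k<N. norm (lin_form (v k) (f (z * cis (\<theta> k)))))" by (simp add: G_def prod_norm)
      also have "\<dots> \<le> (\<Prod>k<N. norm (f (z * cis (\<theta> k))))"
        by (intro prod_mono conjI norm_ge_zero) (metis norm_lin_form_le vnorm mult_1)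
      also have "\<dots> = (\<Prod>k<N. exp (u s (Arg z + \<theta> k)))"
        by (subst (1) zs) (simp add: u_def fexp cis_mult mult.assoc)
      also have "\<dots> = exp (\<Sum>k<N. u s (Arg z + \<theta> k))" by (simp add: exp_sum)
      also have "\<dots> \<le> exp (real N * log_mean f s + real N * \<epsilon>)"
        using Na[OF s(2) N(1), of "Arg z"] Arg_bounded[of z] by (simp add: \<theta>_def)
      finally have "norm (G z) \<le> exp (real N * log_mean f s + real N * \<epsilon>)" .
      moreover have "norm (H z) = norm (G z) * exp (- (real N * real p * ln s))"
        using s z by (simp add: H_def norm_mult norm_inverse norm_divide norm_power exp_minus divide_inverse exp_of_nat_mult[symmetric] 
             ln_realpow[symmetric] flip: of_nat_mult)
      ultimately have "norm (H z) \<le> exp (real N * log_mean f s + real N * \<epsilon>) * exp (- (real N * real p * ln s))"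
        by simp
      also have "\<dots> = exp (real N * (log_mean f s - real p * ln s + \<epsilon>))"
        by (simp add: exp_add[symmetric] algebra_simps)
      also have "\<dots> \<le> exp (real N * (?mx + \<epsilon>))"
        using z by (auto intro!: mult_left_mono)
      finally show ?thesis .
    qed
    have "norm (H (of_real r)) \<le> exp (real N * (?mx + \<epsilon>))"
    proof (rule maximum_modulus_frontier[of H S])
      show "H holomorphic_on interior S" using S0 interior_subset[of S] by (intro H_hol) blast
      show "continuous_on (closure S) H" using clS S0 by (auto intro!: holomorphic_on_imp_continuous_on H_hol)
      show "bounded S" unfolding S_def by (meson bounded_cball bounded_diff)
      show "of_real r \<in> S" using r by (simp add: S_def)
      fix z assume z: "z \<in> frontier S"
      have "ball 0 r2 - cball 0 r1 \<subseteq> interior S"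
        by (rule interior_maximal) (auto simp: S_def open_Diff)
      then have "z \<in> S" "z \<notin> ball 0 r2 - cball 0 r1" using z clS by (auto simp: frontier_def)
      then have "norm z = r1 \<or> norm z = r2" by (auto simp: S_def)
      then show "norm (H z) \<le> exp (real N * (?mx + \<epsilon>))" using bnd by blast
    qed
    moreover have "norm (H (of_real r)) \<ge> exp (real N * (log_mean f r - real p * ln r - \<epsilon>))"
    proof -
      have "norm (G (of_real r)) = (\<Prod>k<N. exp (u r (\<theta> k)))" by (simp add: G_def prod_norm[symmetric] vr u_def fexp)
      also have "\<dots> = exp (\<Sum>k<N. u r (0 + \<theta> k))" by (simp add: exp_sum)
      also have "\<dots> \<ge> exp (real N * log_mean f r - real N * \<epsilon>)"
        using Na[OF N(2,1), of 0] by (simp add: \<theta>_def)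
      finally have "norm (G (of_real r)) \<ge> exp (real N * log_mean f r - real N * \<epsilon>)" .
      moreover have "norm (H (of_real r)) = norm (G (of_real r)) * exp (- (real N * real p * ln r))"
        using r by (simp add: H_def norm_mult norm_inverse norm_divide norm_power exp_minus divide_inverse exp_of_nat_mult[symmetric] 
             ln_realpow[symmetric] flip: of_nat_mult)
      ultimately have "norm (H (of_real r)) \<ge> exp (real N * log_mean f r - real N * \<epsilon>) * exp (- (real N * real p * ln r))"
        by simp
      then show ?thesis by (simp add: exp_add[symmetric] algebra_simps)
    qed
    ultimately have "exp (real N * (log_mean f r - real p * ln r - \<epsilon>)) \<le> exp (real N * (?mx + \<epsilon>))" by linarith
    then have "real N * (log_mean f r - real p * ln r - \<epsilon>) \<le> real N * (?mx + \<epsilon>)" by simp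
    then have "log_mean f r - real p * ln r - \<epsilon> \<le> ?mx + \<epsilon>"
      using N(1) by (simp only: mult_le_cancel_left_pos of_nat_0_less_iff)
    then show ?thesis by linarith
  qed
  show ?thesis
  proof (rule field_le_epsilon)
    fix e :: real assume "e > 0"
    then show "log_mean f r - real p * ln r \<le> ?mx + e" using key[of "e / 2"] by (simp only: field_sum_of_halves)
  qed
qed


section \<open>Lower growth bound, monotonicity and the logarithmic alternative\<close>

lemma exists_between_avoiding:
  fixes a b :: real
  assumes "countable C" "a < b"
  obtains s where "a < s" "s < b" "s \<notin> C"
proof -
  have "\<not> {a<..<b} \<subseteq> C"
    using assms uncountable_open_interval[of a b] countable_subset by blast
  then obtain s where "s \<in> {a<..<b}" "s \<notin> C" by blast
  then show ?thesis using that[of s] by simp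
qed

definition zero_radii :: "(complex \<Rightarrow> complex) \<Rightarrow> real set" where
  "zero_radii g = norm ` {a. g a = 0}"

lemma countable_zero_radii: "nontrivial_entire g \<Longrightarrow> countable (zero_radii g)"
  unfolding zero_radii_def by (intro countable_image countable_zeros)

lemma notin_zero_radii: "norm z \<notin> zero_radii g \<Longrightarrow> g z \<noteq> 0"
  by (auto simp: zero_radii_def)

lemma lin_form_nontrivial_entire:
  assumes f: "reduced_representation f" "linearly_nondegenerate f" and "\<alpha> \<noteq> 0"
  shows "nontrivial_entire (\<lambda>z. lin_form \<alpha> (f z))"
proof -
  have "\<exists>z. lin_form \<alpha> (f z) \<noteq> 0"
  proof (rule ccontr)
    assume "\<not> ?thesis"
    then have "\<alpha> $ i = 0" for i
      using f(2) unfolding linearly_nondegenerate_def lin_form_def by blast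
    then show False using assms(3) by (simp add: vec_eq_iff)
  qed
  then show ?thesis using lin_form_holomorphic[OF f(1)] by (simp add: nontrivial_entire_def)
qed

lemma continuous_ln_norm_entire:
  assumes "nontrivial_entire g" "r \<notin> zero_radii g"
  shows "continuous_on (sphere 0 r) (\<lambda>z. ln (norm (g z)))"
  by (intro continuous_intros nontrivial_entire_continuous[OF assms(1)])
     (use notin_zero_radii assms(2) in auto)

lemma circle_mean_lin_form_le:
  assumes f: "reduced_representation f" "linearly_nondegenerate f" and \<alpha>: "\<alpha> \<noteq> 0"
    and r: "r \<ge> 0" "r \<notin> zero_radii (\<lambda>z. lin_form \<alpha> (f z))"
  shows "circle_mean r (\<lambda>z. ln (norm (lin_form \<alpha> (f z)))) \<le> ln (norm \<alpha>) + log_mean f r"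
proof -
  have "circle_mean r (\<lambda>z. ln (norm (lin_form \<alpha> (f z)))) \<le> circle_mean r (\<lambda>z. ln (norm \<alpha>) + ln (norm (f z)))"
  proof (rule circle_mean_mono)
    show "continuous_on (sphere 0 r) (\<lambda>z. ln (norm (lin_form \<alpha> (f z))))"
      by (rule continuous_ln_norm_entire[OF lin_form_nontrivial_entire[OF f \<alpha>] r(2)])
    show "continuous_on (sphere 0 r) (\<lambda>z. ln (norm \<alpha>) + ln (norm (f z)))"
      by (intro continuous_on_add continuous_on_const continuous_ln_norm f)
    fix z :: complex assume "norm z = r"
    then have nz: "lin_form \<alpha> (f z) \<noteq> 0" using r(2) notin_zero_radii by blast
    show "ln (norm (lin_form \<alpha> (f z))) \<le> ln (norm \<alpha>) + ln (norm (f z))"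
      by (rule ln_norm_lin_form_le[OF \<alpha> reduced_representation_nz[OF f(1)] nz])
  qed (use r in auto)
  also have "\<dots> = ln (norm \<alpha>) + log_mean f r"
    by (subst circle_mean_add) (use r continuous_ln_norm[OF f(1)] in auto)
  finally show ?thesis .
qed

text \<open>As \<open>CARD('i) \<ge> 2\<close>, some hyperplane passes through the point of the
  curve at 0. The corresponding form of \<open>f\<close> vanishes at 0, and this zero alone
  contributes \<open>ln s\<close> in Jensen's formula.\<close>

lemma log_mean_ge_ln_generic:
  fixes f :: "complex \<Rightarrow> complex^'i"
  assumes f: "reduced_representation f" "linearly_nondegenerate f" and card: "CARD('i) \<ge> 2"
  shows "\<exists>C Q. countable Q \<and> (\<forall>s>1. s \<notin> Q \<longrightarrow> ln s - C \<le> log_mean f s)"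
proof -
  have "CARD('i) \<le> Suc (vec.dim (UNIV \<inter> hyperplane (f 0)))"
    using dim_Int_hyperplane[of UNIV "f 0"] by (simp add: card_cart_basis)
  then have "vec.dim (hyperplane (f 0)) \<noteq> 0" using card by (simp del: vec.dim_eq_0)
  then obtain \<alpha> where \<alpha>: "\<alpha> \<in> hyperplane (f 0)" "\<alpha> \<noteq> 0" by auto
  define g where "g = (\<lambda>z. lin_form \<alpha> (f z))"
  have g: "nontrivial_entire g" unfolding g_def by (rule lin_form_nontrivial_entire[OF f \<alpha>(2)])
  have g0: "g 0 = 0" using \<alpha>(1) by (simp add: g_def hyperplane_eq lin_form_commute)
  have "ln s - (ln (norm \<alpha>) - leading_ln g) \<le> log_mean f s" if s: "s > 1" "s \<notin> zero_radii g" for s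
  proof -
    define t where "t = (\<lambda>a. real (zero_mult g a) * ln (s / (if a = 0 then 1 else norm a)))"
    have t: "t a \<ge> 0" if "a \<in> zeros_in g s" for a
      using that s unfolding t_def by (intro mult_nonneg_nonneg) (auto simp: zeros_in_def)
    have mem: "0 \<in> zeros_in g s" using g0 s by (simp add: zeros_in_def)
    have "ln s \<le> real (zero_mult g 0) * ln s"
      using zero_mult_pos_iff[OF g, of 0] g0 s by simp
    also have "\<dots> = t 0" by (simp add: t_def)
    also have "\<dots> \<le> sum t (zeros_in g s)"
      by (rule member_le_sum[OF mem]) (use t finite_zeros_in[OF g] in auto)
    finally have "leading_ln g + ln s \<le> circle_mean s (\<lambda>z. ln (norm (g z)))"
      using Jensen[OF g, of s] notin_zero_radii s by (force simp: t_def)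
    also have "\<dots> \<le> ln (norm \<alpha>) + log_mean f s"
      unfolding g_def by (rule circle_mean_lin_form_le[OF f \<alpha>(2)]) (use s in \<open>auto simp: g_def\<close>)
    finally show ?thesis by simp
  qed
  then show ?thesis using countable_zero_radii[OF g] by blast
qed

lemma log_mean_quasiconvex:
  assumes "reduced_representation f" "0 < r1" "r1 \<le> r" "r \<le> r2"
  shows "log_mean f r \<le> max (log_mean f r1) (log_mean f r2)"
  using log_mean_three_circles[OF assms(1,2), of r r2 0] assms
  by (cases "r = r1"; cases "r = r2") auto

text \<open>Quasiconvexity makes \<open>log_mean f\<close> increasing from any radius on where it
  exceeds its value at 1. It also carries the lower bound from a good radius in
  \<open>(r/2, r)\<close> to an excluded \<open>r\<close>, at the cost of
  \<open>ln 2\<close>.\<close>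

lemma log_mean_ge_ln:
  fixes f :: "complex \<Rightarrow> complex^'i"
  assumes f: "reduced_representation f" "linearly_nondegenerate f" and card: "CARD('i) \<ge> 2"
  obtains C r0 where "r0 \<ge> 1" "\<And>r. r \<ge> r0 \<Longrightarrow> ln r - C \<le> log_mean f r"
    "\<And>r s. r0 \<le> r \<Longrightarrow> r \<le> s \<Longrightarrow> log_mean f r \<le> log_mean f s"
proof -
  obtain C Q where CQ: "countable Q" "\<And>s. s > 1 \<Longrightarrow> s \<notin> Q \<Longrightarrow> ln s - C \<le> log_mean f s"
    using log_mean_ge_ln_generic[OF assms] by blast
  \<comment> \<open>Beyond this, the lower bound at any good radius above \<open>r / 2\<close>
    already exceeds \<open>log_mean f 1\<close>, so the maximum in quasiconvexity is not attained at
    1.\<close>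
  define r0 where "r0 = max 2 (2 * exp (log_mean f 1 + C + 1))"
  have lower: "ln r - (C + ln 2) \<le> log_mean f r" "log_mean f 1 < log_mean f r" if r: "r \<ge> r0" for r
  proof -
    have r2: "r \<ge> 2" "r / 2 \<ge> exp (log_mean f 1 + C + 1)" using r by (auto simp: r0_def)
    obtain s where s: "r / 2 < s" "s < r" "s \<notin> Q"
      using exists_between_avoiding[OF CQ(1), of "r/2" r] r2 by auto
    have "ln (r / 2) \<le> ln s" using s r2 by simp
    moreover have "log_mean f 1 + C + 1 \<le> ln (r / 2)" using r2 by (subst ln_ge_iff) auto
    moreover have "ln s - C \<le> log_mean f s" using CQ(2)[of s] s r2 by simp
    moreover have "log_mean f s \<le> max (log_mean f 1) (log_mean f r)"
      by (rule log_mean_quasiconvex[OF f(1)]) (use s r2 in auto)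
    moreover have "ln (r / 2) = ln r - ln 2" using r2 by (simp add: ln_div)
    ultimately show "ln r - (C + ln 2) \<le> log_mean f r" "log_mean f 1 < log_mean f r" by linarith+
  qed
  have "log_mean f r \<le> log_mean f s" if "r0 \<le> r" "r \<le> s" for r s
    using log_mean_quasiconvex[OF f(1), of 1 r s] lower(2)[of r] that by (auto simp: r0_def)
  then show ?thesis using lower(1) that[of r0 "C + ln 2"] by (auto simp: r0_def)
qed

text \<open>If the ratio does not tend to infinity, it lies below a fixed \<open>C\<close> at
  arbitrarily large radii \<open>r2\<close>. The three-circles bound between 1 and such an
  \<open>r2\<close> holds with the same power for every \<open>r\<close> in between.\<close>

lemma log_mean_dichotomy:
  fixes f :: "complex \<Rightarrow> complex^'i"
  assumes f: "reduced_representation f"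
  obtains (slow) p where "\<And>r. r > 1 \<Longrightarrow> log_mean f r \<le> real p * ln r + log_mean f 1"
    | (fast) "filterlim (\<lambda>r. log_mean f r / ln r) at_top at_top"
proof (cases "filterlim (\<lambda>r. log_mean f r / ln r) at_top at_top")
  case False
  then obtain C where C: "\<not> (\<forall>\<^sub>F r in at_top. C \<le> log_mean f r / ln r)"
    by (auto simp: filterlim_at_top)
  define q where "q = nat \<lceil>C\<rceil>"
  have q: "C \<le> real q" unfolding q_def by linarith
  have "log_mean f r \<le> real (q + 1) * ln r + log_mean f 1" if r: "r > 1" for r
  proof -
    \<comment> \<open>\<open>r2 \<ge> exp (- log_mean f 1)\<close> lets the surplus
      \<open>ln r2\<close>, from taking the power \<open>q + 1\<close> rather than \<open>q\<close>,
      absorb a negative \<open>log_mean f 1\<close>.\<close>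
    define R where "R = max (r + 1) (exp (- log_mean f 1))"
    obtain r2 where r2: "r2 \<ge> R" "log_mean f r2 / ln r2 < C"
      using C unfolding eventually_at_top_linorder by (metis not_le)
    have r2': "r2 > r" "exp (- log_mean f 1) \<le> r2" using r2(1) by (auto simp: R_def)
    have ln2: "ln r2 > 0" "- log_mean f 1 \<le> ln r2"
      using r2' r by (auto simp: ln_ge_iff)
    have "log_mean f r2 < C * ln r2" using r2(2) ln2 by (simp add: divide_less_eq)
    also have "\<dots> \<le> real q * ln r2" using q ln2 by (intro mult_right_mono) auto
    finally have "log_mean f r2 - real (q + 1) * ln r2 \<le> log_mean f 1"
      using ln2 by (simp add: algebra_simps)
    then show ?thesis
      using log_mean_three_circles[OF f, of 1 r r2 "q+1"] r r2' by simp
  qed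
  then show ?thesis by (rule slow)
qed (rule fast)

section \<open>Exceptional sets\<close>

lemma lmeasurable_countable_UN:
  fixes I :: "nat \<Rightarrow> real set"
  assumes I: "\<And>n. I n \<in> lmeasurable" "\<And>n. measure lebesgue (I n) \<le> c n" and c: "summable c"
  shows "(\<Union>n. I n) \<in> lmeasurable"
proof (rule fmeasurableI)
  show "(\<Union>n. I n) \<in> sets lebesgue" using I(1) by (auto intro: fmeasurableD)
  have c0: "c n \<ge> 0" for n using I(2)[of n] measure_nonneg[of lebesgue "I n"] by linarith
  have "emeasure lebesgue (\<Union>n. I n) \<le> (\<Sum>n. emeasure lebesgue (I n))"
    by (rule emeasure_subadditive_countably) (use I(1) in \<open>auto intro: fmeasurableD\<close>)
  also have "\<dots> \<le> (\<Sum>n. ennreal (c n))"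
    by (intro suminf_le) (use I in \<open>auto simp: emeasure_eq_measure2 ennreal_leI\<close>)
  also have "\<dots> = ennreal (suminf c)"
    by (rule suminf_ennreal2[OF c0 c])
  also have "\<dots> < \<infinity>" by simp
  finally show "emeasure lebesgue (\<Union>n. I n) < \<infinity>" .
qed

text \<open>The bad radii are sorted by the dyadic size of \<open>T\<close>. Two of them at level
  \<open>j\<close> differ by at most \<open>2 ^ (-j)\<close>: otherwise \<open>T\<close> would more
  than double between them and leave the level. So level \<open>j\<close> fits into an interval of
  that length, and the lengths are summable.\<close>

lemma Borel_growth:
  fixes T :: "real \<Rightarrow> real"
  assumes T1: "\<And>r. r \<ge> r0 \<Longrightarrow> T r \<ge> 1" and mono: "\<And>r s. r0 \<le> r \<Longrightarrow> r \<le> s \<Longrightarrow> T r \<le> T s"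
  obtains U where "U \<in> lmeasurable" "\<And>r. r \<ge> r0 \<Longrightarrow> r \<notin> U \<Longrightarrow> T (r + 1 / T r) \<le> 2 * T r"
proof -
  define E where "E = (\<lambda>j::nat. {r. r \<ge> r0 \<and> 2 ^ j \<le> T r \<and> T r < 2 ^ Suc j \<and> T (r + 1 / T r) > 2 * T r})"
  define I where "I = (\<lambda>j. {Inf (E j)..Inf (E j) + (1/2) ^ j})"
  have bdd: "bdd_below (E j)" for j by (rule bdd_belowI[of _ r0]) (auto simp: E_def)
  have EI: "r \<in> I j" if r: "r \<in> E j" for r j
  proof -
    have "Inf (E j) \<le> r" by (rule cInf_lower[OF r bdd])
    moreover have "r \<le> Inf (E j) + (1/2) ^ j"
    proof (rule ccontr)
      assume "\<not> ?thesis"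
      then have "Inf (E j) < r - (1/2) ^ j" by simp
      then obtain s where s: "s \<in> E j" "s < r - (1/2) ^ j"
        using cInf_lessD[of "E j"] r by blast
      have Ts: "2 ^ j \<le> T s" "s \<ge> r0" "T (s + 1 / T s) > 2 * T s" using s(1) by (auto simp: E_def)
      have "1 / T s \<le> 1 / 2 ^ j" using Ts(1) T1[OF Ts(2)] by (intro divide_left_mono mult_pos_pos) auto
      then have "s + 1 / T s \<le> r" using s(2) by (simp add: power_one_over)
      moreover have "0 \<le> 1 / T s" using T1[OF Ts(2)] by simp
      then have "r0 \<le> s + 1 / T s" using Ts(2) by linarith
      ultimately have "T (s + 1 / T s) \<le> T r" by (intro mono)
      moreover have "T r < 2 * 2 ^ j" using r by (simp add: E_def)
      ultimately show False using Ts by linarith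
    qed
    ultimately show ?thesis by (simp add: I_def)
  qed
  have "(\<Union>j. I j) \<in> lmeasurable"
    by (rule lmeasurable_countable_UN[of _ "\<lambda>j. (1/2) ^ j"]) (auto simp: I_def summable_geometric)
  moreover have "T (r + 1 / T r) \<le> 2 * T r" if r: "r \<ge> r0" "r \<notin> (\<Union>j. I j)" for r
  proof (rule ccontr)
    assume *: "\<not> ?thesis"
    obtain j :: nat where j: "2 ^ j \<le> T r" "T r < 2 ^ Suc j"
    proof -
      obtain m :: nat where "T r < 2 ^ m" using real_arch_pow[of 2 "T r"] by auto
      then obtain k where k: "T r < 2 ^ k" "\<And>i. i < k \<Longrightarrow> \<not> T r < 2 ^ i"
        using exists_least_iff[of "\<lambda>k. T r < 2 ^ k"] by blast
      have "k \<noteq> 0" using k(1) T1[OF r(1)] by (cases k) auto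
      then show ?thesis using that[of "k - 1"] k(1) k(2)[of "k - 1"] by simp
    qed
    then have "r \<in> E j" using * r by (simp add: E_def)
    then show False using EI r by blast
  qed
  ultimately show ?thesis using that by blast
qed

text \<open>The rank of a zero radius among the distinct zero radii is at most the zero count of any
  disc containing the zero, so an inverse square in the rank is a lower bound in terms of
  \<open>zero_count\<close>. The set \<open>U\<close> is fixed before \<open>R\<close>.\<close>

lemma zero_separation:
  assumes g: "nontrivial_entire g"
  obtains U where "U \<in> lmeasurable"
    "\<And>r a R. r \<notin> U \<Longrightarrow> g a = 0 \<Longrightarrow> norm a \<le> R \<Longrightarrow> 1 \<le> (real (zero_count g R))\<^sup>2 * \<bar>r - norm a\<bar>"
proof -
  define idx where "idx = (\<lambda>\<rho>. card (norm ` zeros_in g \<rho>))"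
  have mono: "idx \<rho> < idx \<rho>'" if "\<rho>' \<in> zero_radii g" "\<rho> < \<rho>'" for \<rho> \<rho>'
    unfolding idx_def
  proof (rule psubset_card_mono)
    show "norm ` zeros_in g \<rho> \<subset> norm ` zeros_in g \<rho>'"
      using that by (force simp: zeros_in_def zero_radii_def image_iff psubset_eq)
  qed (use finite_zeros_in[OF g] in simp)
  have inj: "inj_on idx (zero_radii g)"
    by (rule inj_onI) (metis mono less_irrefl linorder_neqE_linordered_idom)
  \<comment> \<open>Indices that are no rank give arbitrary centres; their intervals are still of
    summable length.\<close>
  define rad where "rad = inv_into (zero_radii g) idx"
  define I where "I = (\<lambda>k. {rad k - inverse (real k ^ 2)..rad k + inverse (real k ^ 2)})"
  have sm: "summable (\<lambda>k. 2 * inverse (real k ^ 2))"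
    by (intro summable_mult inverse_power_summable) auto
  have "(\<Union>k. I k) \<in> lmeasurable"
    by (rule lmeasurable_countable_UN[OF _ _ sm]) (auto simp: I_def)
  moreover have "1 \<le> (real (zero_count g R))\<^sup>2 * \<bar>r - norm a\<bar>" if r: "r \<notin> (\<Union>k. I k)" "g a = 0" "norm a \<le> R" for r a R
  proof -
    have ra: "norm a \<in> zero_radii g" using r by (simp add: zero_radii_def)
    then have "rad (idx (norm a)) = norm a" unfolding rad_def using inj by simp
    moreover have "r \<notin> I (idx (norm a))" using r by blast
    ultimately have lt: "inverse (real (idx (norm a)) ^ 2) < \<bar>r - norm a\<bar>"
      by (auto simp: I_def abs_if)
    have "idx (norm a) \<le> card (zeros_in g (norm a))"
      unfolding idx_def by (rule card_image_le[OF finite_zeros_in[OF g]])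
    also have "\<dots> \<le> card (zeros_in g R)"
      by (intro card_mono finite_zeros_in[OF g]) (use r in \<open>auto simp: zeros_in_def\<close>)
    also have "\<dots> = (\<Sum>a\<in>zeros_in g R. 1)" by simp
    also have "\<dots> \<le> zero_count g R"
      unfolding zero_count_def
    proof (rule sum_mono)
      fix b assume "b \<in> zeros_in g R"
      then have "zero_mult g b > 0" using zero_mult_pos_iff[OF g] by (simp add: zeros_in_def)
      then show "1 \<le> zero_mult g b" by simp
    qed
    finally have le: "idx (norm a) \<le> zero_count g R" .
    have pos: "idx (norm a) > 0"
      unfolding idx_def using finite_zeros_in[OF g] r by (auto simp: card_gt_0_iff zeros_in_def)
    have "1 = real (idx (norm a)) ^ 2 * inverse (real (idx (norm a)) ^ 2)" using pos by simp
    also have "\<dots> \<le> (real (zero_count g R))\<^sup>2 * \<bar>r - norm a\<bar>"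
      using le lt by (intro mult_mono power_mono) auto
    finally show ?thesis .
  qed
  ultimately show ?thesis using that by blast
qed

section \<open>Derivative bounds for quotients of entire functions\<close>

text \<open>If \<open>x \<le> M\<close> and \<open>0 \<le> M\<close>, then
  \<open>\<bar>x\<bar> \<le> 2 * M - x\<close>; an upper bound thus controls the mean of the
  absolute value once the mean of \<open>x\<close>, here \<open>ln R \<ge> 0\<close>, is
  known.\<close>

lemma circle_mean_abs_ln_dist_le:
  assumes a: "norm a < R" and R: "R \<ge> 1"
  shows "circle_mean R (\<lambda>z. \<bar>ln (norm (z - a))\<bar>) \<le> 2 * ln (2 * R + 1)"
proof -
  have cont: "continuous_on (sphere 0 R) (\<lambda>z. ln (norm (z - a)))"
    by (intro continuous_intros) (use a in auto)
  have "circle_mean R (\<lambda>z. \<bar>ln (norm (z - a))\<bar>) \<le> circle_mean R (\<lambda>z. 2 * ln (2 * R + 1) - ln (norm (z - a)))"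
  proof (rule circle_mean_mono)
    fix z :: complex assume z: "norm z = R"
    have "norm (z - a) \<le> 2 * R + 1" using norm_triangle_ineq4[of z a] z a by linarith
    moreover have "norm (z - a) > 0" using z a by auto
    ultimately have "ln (norm (z - a)) \<le> ln (2 * R + 1)" using R by simp
    moreover have "ln (2 * R + 1) \<ge> 0" using R by simp
    ultimately show "\<bar>ln (norm (z - a))\<bar> \<le> 2 * ln (2 * R + 1) - ln (norm (z - a))" by linarith
  qed (use cont R in \<open>auto intro!: continuous_intros\<close>)
  also have "\<dots> = 2 * ln (2 * R + 1) - ln R"
    by (subst circle_mean_diff[OF _ cont]) (use R a in \<open>auto simp: circle_mean_ln_dist\<close>)
  finally show ?thesis using R by (simp add: order_trans[OF _ _ ] ln_ge_zero add_increasing2 diff_le_eq)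
qed

text \<open>The logarithm of the modulus of the quotient is the sum over zeros and poles plus
  \<open>Re (h z)\<close>, so the mean of \<open>\<bar>Re (h z)\<bar>\<close> is at most
  \<open>K\<close> plus the means for the single factors. The first three terms of \<open>X\<close>
  meet the demands of \<open>quotient_higher_deriv_bound\<close>, the last is the Schwarz bound for
  \<open>deriv h\<close>.\<close>

lemma quotient_log_derivative_bound:
  assumes g: "nontrivial_entire g" and g0: "nontrivial_entire g0"
    and r: "norm z < R" "R \<ge> 1" and R: "R \<notin> zero_radii g" "R \<notin> zero_radii g0"
    and K: "circle_mean R (\<lambda>z. \<bar>ln (norm (g z)) - ln (norm (g0 z))\<bar>) \<le> K"
    and D: "D > 0" "\<And>a. g a = 0 \<or> g0 a = 0 \<Longrightarrow> norm a \<le> R \<Longrightarrow> 1 \<le> D * \<bar>norm z - norm a\<bar>"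
    and \<nu>: "\<nu> = real (zero_count g R + zero_count g0 R)"
    and X: "X = D + \<nu> * D + 1 / (R - norm z) + 8 * R * (K + \<nu> * (2 * ln (2 * R + 1))) / (R - norm z)\<^sup>2"
  shows "norm ((deriv ^^ k) (\<lambda>w. g w / g0 w) z) \<le> fact k * exp 2 * (2 * X) ^ k * norm (g z / g0 z)"
proof -
  define Z Z0 m m0 where "Z = zeros_in g R" and "Z0 = zeros_in g0 R" and "m = zero_mult g" and "m0 = zero_mult g0"
  have fin: "finite Z" "finite Z0" using finite_zeros_in g g0 by (auto simp: Z_def Z0_def)
  have R0: "R > 0" using r by simp
  obtain R1 h1 where h1: "R < R1" "h1 holomorphic_on ball 0 R1"
    "\<And>z. z \<in> ball 0 R1 \<Longrightarrow> g z = (\<Prod>a\<in>Z. (z - a) ^ m a) * exp (h1 z)"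
    using entire_factorization[OF g R0] unfolding Z_def m_def by metis
  obtain R2 h2 where h2: "R < R2" "h2 holomorphic_on ball 0 R2"
    "\<And>z. z \<in> ball 0 R2 \<Longrightarrow> g0 z = (\<Prod>a\<in>Z0. (z - a) ^ m0 a) * exp (h2 z)"
    using entire_factorization[OF g0 R0] unfolding Z0_def m0_def by metis
  define R' where "R' = min R1 R2"
  define h where "h = (\<lambda>z. h1 z - h2 z)"
  have R': "R < R'" using h1 h2 by (simp add: R'_def)
  have h_hol: "h holomorphic_on ball 0 R'"
    unfolding h_def by (intro holomorphic_intros holomorphic_on_subset[OF h1(2)] holomorphic_on_subset[OF h2(2)])
       (auto simp: R'_def)
  have Zlt: "norm a < R" if "a \<in> Z \<union> Z0" for a
    using that R by (auto simp: Z_def Z0_def zeros_in_def zero_radii_def less_le)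
  have \<nu>': "\<nu> = real (sum m Z + sum m0 Z0)" by (simp add: \<nu> zero_count_def Z_def Z0_def m_def m0_def)
  define K' where "K' = K + \<nu> * (2 * ln (2 * R + 1))"
  have mean: "circle_mean R (\<lambda>z. \<bar>Re (h z)\<bar>) \<le> K'"
  proof -
    define q where "q = (\<lambda>z. (\<Sum>a\<in>Z. real (m a) * \<bar>ln (norm (z - a))\<bar>))"
    define q0 where "q0 = (\<lambda>z. (\<Sum>a\<in>Z0. real (m0 a) * \<bar>ln (norm (z - a))\<bar>))"
    define e where "e = (\<lambda>z. \<bar>ln (norm (g z)) - ln (norm (g0 z))\<bar>)"
    have c1: "continuous_on (sphere 0 R) (\<lambda>z. real n * \<bar>ln (norm (z - a))\<bar>)" if "a \<in> Z \<union> Z0" for a n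
      by (intro continuous_intros) (use Zlt[OF that] in auto)
    have cq: "continuous_on (sphere 0 R) q" "continuous_on (sphere 0 R) q0"
      unfolding q_def q0_def using c1 by (auto intro!: continuous_on_sum)
    have ce: "continuous_on (sphere 0 R) e"
      unfolding e_def by (intro continuous_on_rabs continuous_on_diff continuous_ln_norm_entire g g0 R)
    have mq: "circle_mean R q \<le> real (sum m Z) * (2 * ln (2 * R + 1))"
    proof -
      have "circle_mean R q = (\<Sum>a\<in>Z. real (m a) * circle_mean R (\<lambda>z. \<bar>ln (norm (z - a))\<bar>))"
        unfolding q_def by (subst circle_mean_sum[OF fin(1)]) (use c1 R0 in \<open>auto simp: circle_mean_cmult\<close>)
      also have "\<dots> \<le> (\<Sum>a\<in>Z. real (m a) * (2 * ln (2 * R + 1)))"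
        by (intro sum_mono mult_left_mono circle_mean_abs_ln_dist_le Zlt r) auto
      finally show ?thesis by (simp add: sum_distrib_right)
    qed
    have mq0: "circle_mean R q0 \<le> real (sum m0 Z0) * (2 * ln (2 * R + 1))"
    proof -
      have "circle_mean R q0 = (\<Sum>a\<in>Z0. real (m0 a) * circle_mean R (\<lambda>z. \<bar>ln (norm (z - a))\<bar>))"
        unfolding q0_def by (subst circle_mean_sum[OF fin(2)]) (use c1 R0 in \<open>auto simp: circle_mean_cmult\<close>)
      also have "\<dots> \<le> (\<Sum>a\<in>Z0. real (m0 a) * (2 * ln (2 * R + 1)))"
        by (intro sum_mono mult_left_mono circle_mean_abs_ln_dist_le Zlt r) auto
      finally show ?thesis by (simp add: sum_distrib_right)
    qed
    have "circle_mean R (\<lambda>z. \<bar>Re (h z)\<bar>) \<le> circle_mean R (\<lambda>z. e z + (q z + q0 z))"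
    proof (rule circle_mean_mono)
      show "continuous_on (sphere 0 R) (\<lambda>z. \<bar>Re (h z)\<bar>)"
        by (intro continuous_intros continuous_on_subset[OF holomorphic_on_imp_continuous_on[OF h_hol]]) (use R' in auto)
      show "continuous_on (sphere 0 R) (\<lambda>z. e z + (q z + q0 z))"
        by (intro continuous_intros cq ce)
      fix z :: complex assume z: "norm z = R"
      have zn: "z \<notin> Z" "z \<notin> Z0" using Zlt[of z] z by auto
      have b: "z \<in> ball 0 R1" "z \<in> ball 0 R2" using z h1 h2 by auto
      have eq: "ln (norm (g z)) = (\<Sum>a\<in>Z. real (m a) * ln (norm (z - a))) + Re (h1 z)"
        unfolding h1(3)[OF b(1)] by (rule ln_norm_factorization[OF fin(1) zn(1)])
      have eq0: "ln (norm (g0 z)) = (\<Sum>a\<in>Z0. real (m0 a) * ln (norm (z - a))) + Re (h2 z)"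
        unfolding h2(3)[OF b(2)] by (rule ln_norm_factorization[OF fin(2) zn(2)])
      have "\<bar>\<Sum>a\<in>Z. real (m a) * ln (norm (z - a))\<bar> \<le> q z"
        unfolding q_def by (rule order.trans[OF sum_abs]) (simp add: abs_mult)
      moreover have "\<bar>\<Sum>a\<in>Z0. real (m0 a) * ln (norm (z - a))\<bar> \<le> q0 z"
        unfolding q0_def by (rule order.trans[OF sum_abs]) (simp add: abs_mult)
      moreover have "Re (h z) = Re (h1 z) - Re (h2 z)" by (simp add: h_def)
      ultimately show "\<bar>Re (h z)\<bar> \<le> e z + (q z + q0 z)" using eq eq0 unfolding e_def by linarith
    qed (use R0 in auto)
    also have "\<dots> = circle_mean R e + (circle_mean R q + circle_mean R q0)"
      using cq ce R0 by (subst circle_mean_add) (auto intro!: continuous_intros simp: circle_mean_add)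
    also have "\<dots> \<le> K + (real (sum m Z) * (2 * ln (2 * R + 1)) + real (sum m0 Z0) * (2 * ln (2 * R + 1)))"
      using mq mq0 K by (simp add: e_def)
    also have "\<dots> = K'" by (simp add: K'_def \<nu>' algebra_simps)
    finally show ?thesis .
  qed
  have "circle_mean R (\<lambda>z. 0) \<le> circle_mean R (\<lambda>z. \<bar>Re (h z)\<bar>)"
    by (rule circle_mean_mono) (use R' R0 in \<open>auto intro!: continuous_intros continuous_on_subset[OF holomorphic_on_imp_continuous_on[OF h_hol]]\<close>)
  then have K'0: "K' \<ge> 0" using mean by simp
  have parts: "0 \<le> D" "0 \<le> \<nu> * D" "0 \<le> 1 / (R - norm z)" "0 \<le> 8 * R * K' / (R - norm z)\<^sup>2"
    using D(1) r R0 K'0 by (auto simp: \<nu>)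
  have X': "X = D + \<nu> * D + 1 / (R - norm z) + 8 * R * K' / (R - norm z)\<^sup>2"
    by (simp add: X K'_def)
  show ?thesis
  proof (rule quotient_higher_deriv_bound[OF fin h_hol r(1) R' _ D(1)])
    fix w :: complex assume "w \<in> ball 0 R'"
    then have "w \<in> ball 0 R1" "w \<in> ball 0 R2" by (auto simp: R'_def)
    then show "g w / g0 w = (\<Prod>a\<in>Z. (w - a) ^ m a) * exp (h w) / (\<Prod>a\<in>Z0. (w - a) ^ m0 a)"
      using h1(3)[of w] h2(3)[of w] by (simp add: h_def exp_diff)
  next
    fix a :: complex assume "a \<in> Z \<union> Z0"
    then have "1 \<le> D * \<bar>norm z - norm a\<bar>" using D(2)[of a] by (auto simp: Z_def Z0_def zeros_in_def)
    also have "\<dots> \<le> D * norm (z - a)" using D(1) by (intro mult_left_mono norm_triangle_ineq3) auto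
    finally show "1 \<le> D * norm (z - a)" .
  next
    fix w :: complex assume w: "norm w \<le> (norm z + R) / 2"
    have wR: "norm w < R" using w r by simp
    have "norm (deriv h w) \<le> 2 * R / (R - norm w)\<^sup>2 * circle_mean R (\<lambda>z. \<bar>Re (h z)\<bar>)"
      by (rule Schwarz_derivative_bound[OF h_hol R0 R' wR])
    also have "\<dots> \<le> 2 * R / (R - norm w)\<^sup>2 * K'"
      using mean R0 by (intro mult_left_mono) auto
    \<comment> \<open>At most half of the gap between \<open>norm z\<close> and \<open>R\<close> is
      lost at \<open>w\<close>; squaring this half turns the 2 into the 8 of
      \<open>X\<close>.\<close>
    also have "\<dots> \<le> 2 * R / ((R - norm z) / 2)\<^sup>2 * K'"
      using w r R0 K'0 by (intro mult_right_mono divide_left_mono power_mono mult_pos_pos zero_less_power) auto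
    also have "\<dots> = 8 * R * K' / (R - norm z)\<^sup>2" by (simp add: power_divide)
    also have "\<dots> \<le> X" using parts unfolding X' by linarith
    finally show "norm (deriv h w) \<le> X" .
  next
    show "D \<le> X" using parts unfolding X' by linarith
    show "real (sum m Z + sum m0 Z0) * D \<le> X" using parts unfolding X' \<nu>'[symmetric] by linarith
    show "1 / (R - norm z) \<le> X" using parts unfolding X' by linarith
  qed
qed

text \<open>Since \<open>U\<close> and \<open>c\<close> are fixed before \<open>d\<close> and
  \<open>B\<close>, the gap can be adapted to the growth of \<open>f\<close> later. Jensen's formula
  between two radii below \<open>r + d\<close> gives O(B^2) zeros, hence \<open>D\<close> = O(B^4);
  the product of these two orders is the exponent 6.\<close>

lemma uniform_log_derivative_bound:
  fixes f :: "complex \<Rightarrow> complex^'i"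
  assumes f: "reduced_representation f" "linearly_nondegenerate f" and card: "CARD('i) \<ge> 2"
    and V: "finite V" "0 \<notin> V"
  obtains U c r0 where "U \<in> lmeasurable" "c \<ge> 1" "r0 \<ge> 1"
    "\<And>r d B \<alpha> \<beta> z k. \<lbrakk>r \<ge> r0; r \<notin> U; d > 0; B \<ge> 1; log_mean f (r + d) \<le> B; (r + d) / d \<le> B; 1 / d \<le> B;
       ln (2 * (r + d) + 1) \<le> B; \<alpha> \<in> V; \<beta> \<in> V; norm z = r\<rbrakk> \<Longrightarrow>
     norm ((deriv ^^ k) (\<lambda>w. lin_form \<alpha> (f w) / lin_form \<beta> (f w)) z) 
       \<le> fact k * exp 2 * (2 * (c * B ^ 6)) ^ k * norm (lin_form \<alpha> (f z) / lin_form \<beta> (f z))"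
proof -
  define g where "g = (\<lambda>\<alpha> z. lin_form \<alpha> (f z))"
  have g: "nontrivial_entire (g \<alpha>)" if "\<alpha> \<in> V" for \<alpha>
    unfolding g_def by (rule lin_form_nontrivial_entire[OF f]) (use that V in auto)
  obtain C0 r0 where r0: "r0 \<ge> 1" "\<And>r s. r0 \<le> r \<Longrightarrow> r \<le> s \<Longrightarrow> log_mean f r \<le> log_mean f s"
    using log_mean_ge_ln[OF f card] by metis
  have "\<exists>U. U \<in> lmeasurable \<and> (\<forall>r a R. r \<notin> U \<longrightarrow> g \<alpha> a = 0 \<longrightarrow> norm a \<le> R \<longrightarrow> 
      1 \<le> (real (zero_count (g \<alpha>) R))\<^sup>2 * \<bar>r - norm a\<bar>)" if "\<alpha> \<in> V" for \<alpha>
    using zero_separation[OF g[OF that]] by metis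
  then obtain U where U: "\<And>\<alpha>. \<alpha> \<in> V \<Longrightarrow> U \<alpha> \<in> lmeasurable" 
    "\<And>\<alpha> r a R. \<alpha> \<in> V \<Longrightarrow> r \<notin> U \<alpha> \<Longrightarrow> g \<alpha> a = 0 \<Longrightarrow> norm a \<le> R \<Longrightarrow> 
      1 \<le> (real (zero_count (g \<alpha>) R))\<^sup>2 * \<bar>r - norm a\<bar>"
    by metis
  define Q where "Q = (\<Union>\<alpha>\<in>V. zero_radii (g \<alpha>))"
  have Q: "countable Q" unfolding Q_def using V g by (intro countable_UN) (auto intro: countable_zero_radii countable_finite)
  define L where "L = (\<Sum>\<alpha>\<in>V. \<bar>ln (norm \<alpha>)\<bar> + \<bar>leading_ln (g \<alpha>)\<bar>)"
  have Lle: "\<bar>ln (norm \<alpha>)\<bar> \<le> L" "\<bar>leading_ln (g \<alpha>)\<bar> \<le> L" if "\<alpha> \<in> V" for \<alpha>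
  proof -
    have "\<bar>ln (norm \<alpha>)\<bar> + \<bar>leading_ln (g \<alpha>)\<bar> \<le> L"
      unfolding L_def by (rule member_le_sum[OF that, of "\<lambda>\<alpha>. \<bar>ln (norm \<alpha>)\<bar> + \<bar>leading_ln (g \<alpha>)\<bar>"]) (use V in auto)
    then show "\<bar>ln (norm \<alpha>)\<bar> \<le> L" "\<bar>leading_ln (g \<alpha>)\<bar> \<le> L" by linarith+
  qed
  have L0: "L \<ge> 0" unfolding L_def by (intro sum_nonneg) auto
  \<comment> \<open>The zero counts are at most \<open>e * B ^ 2\<close>: Jensen's formula bounds
    the count times \<open>ln (R2 / R)\<close> by \<open>B + 2 * L\<close>, and this logarithm is at
    least \<open>1 / (4 * B)\<close>.\<close>
  define e where "e = 4 * (1 + 2 * L)"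
  have e: "e \<ge> 4" using L0 by (simp add: e_def)
  \<comment> \<open>Four summands that bound, in units of \<open>B ^ 6\<close>, the four summands of
    \<open>X\<close> in their order.\<close>
  define c where "c = (1 + e\<^sup>2) + 2 * e * (1 + e\<^sup>2) + 4 + 128 * (6 * L + 2 + 4 * e)"
  have c1: "c \<ge> 1" using L0 e by (simp add: c_def)
  have bound: "norm ((deriv ^^ k) (\<lambda>w. g \<alpha> w / g \<beta> w) z) \<le> fact k * exp 2 * (2 * (c * B ^ 6)) ^ k * norm (g \<alpha> z / g \<beta> z)"
    if r: "r \<ge> r0" "r \<notin> (\<Union>\<alpha>\<in>V. U \<alpha>)" and d: "d > 0" and B: "B \<ge> 1" "log_mean f (r + d) \<le> B" "(r + d) / d \<le> B" "1 / d \<le> B"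
       "ln (2 * (r + d) + 1) \<le> B" and \<alpha>\<beta>: "\<alpha> \<in> V" "\<beta> \<in> V" and z: "norm z = r" for r d B \<alpha> \<beta> z k
  proof -
    have r1: "r \<ge> 1" using r r0 by simp
    \<comment> \<open>The circle of radius \<open>R\<close> carries the Schwarz integral and the one
      of radius \<open>R2\<close> counts the zeros up to \<open>R\<close>; both gaps, from
      \<open>r\<close> to \<open>R\<close> and from \<open>R\<close> to \<open>R2\<close>, exceed
      \<open>d / 4\<close>.\<close>
    obtain R where R: "r + d / 4 < R" "R < r + d / 2" "R \<notin> Q"
      using exists_between_avoiding[OF Q, of "r + d/4" "r + d/2"] d by auto
    obtain R2 where R2: "r + 3 * d / 4 < R2" "R2 < r + d" "R2 \<notin> Q"
      using exists_between_avoiding[OF Q, of "r + 3 * d/4" "r + d"] d by auto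
    have ord: "r < R" "R < R2" "1 < R" using R R2 d r1 by linarith+
    have Rn: "R \<notin> zero_radii (g \<gamma>)" "R2 \<notin> zero_radii (g \<gamma>)" if "\<gamma> \<in> V" for \<gamma>
      using that R R2 by (auto simp: Q_def)
    have MR: "log_mean f R \<le> B" "log_mean f R2 \<le> B"
      using r0(2)[of R "r + d"] r0(2)[of R2 "r + d"] B(2) R R2 r ord d by linarith+
    have up: "circle_mean s (\<lambda>z. ln (norm (g \<gamma> z))) \<le> ln (norm \<gamma>) + log_mean f s" 
      if "\<gamma> \<in> V" "s \<notin> zero_radii (g \<gamma>)" "s > 0" for \<gamma> s
      unfolding g_def by (rule circle_mean_lin_form_le[OF f]) (use that V in \<open>auto simp: g_def\<close>)
    have Lge: "ln (R2 / R) \<ge> 1 / (4 * B)"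
    proof -
      have "ln (R / R2) \<le> R / R2 - 1" using ord by (intro ln_le_minus_one) auto
      then have "ln (R2 / R) \<ge> (R2 - R) / R2" using ord by (simp add: ln_div diff_divide_distrib)
      moreover have "(R2 - R) / R2 \<ge> (d / 4) / (r + d)"
        using R R2 ord d r1 by (intro frac_le) auto
      moreover have "1 / B \<le> d / (r + d)" 
        using B(1,3) d r1 by (simp add: field_simps)
      moreover have "(d / 4) / (r + d) = (1 / 4) * (d / (r + d))" "1 / (4 * B) = (1 / 4) * (1 / B)" by simp_all
      ultimately show ?thesis by linarith
    qed
    have zc: "real (zero_count (g \<gamma>) R) \<le> e * B ^ 2" if \<gamma>: "\<gamma> \<in> V" for \<gamma>
    proof -
      have "leading_ln (g \<gamma>) + real (zero_count (g \<gamma>) R) * ln (R2 / R) \<le> circle_mean R2 (\<lambda>z. ln (norm (g \<gamma> z)))"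
        using circle_mean_ge_leading_ln[OF g[OF \<gamma>], of R R2] ord notin_zero_radii[of _ "g \<gamma>"] Rn(2)[OF \<gamma>] by auto
      also have "\<dots> \<le> ln (norm \<gamma>) + log_mean f R2" using up[OF \<gamma> Rn(2)[OF \<gamma>]] ord by simp
      finally have "real (zero_count (g \<gamma>) R) * ln (R2 / R) \<le> B + 2 * L"
        using Lle[OF \<gamma>] MR by linarith
      moreover have "real (zero_count (g \<gamma>) R) * (1 / (4 * B)) \<le> real (zero_count (g \<gamma>) R) * ln (R2 / R)"
        by (intro mult_left_mono Lge) auto
      ultimately have "real (zero_count (g \<gamma>) R) * (1 / (4 * B)) \<le> B + 2 * L" by linarith
      then have "real (zero_count (g \<gamma>) R) \<le> 4 * B * (B + 2 * L)" using B(1) by (simp add: field_simps)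
      also have "\<dots> \<le> 4 * B * (B + 2 * L * B)" using B(1) L0 by (intro mult_left_mono add_left_mono) (auto simp: mult_le_cancel_left1)
      also have "\<dots> = e * B ^ 2" by (simp add: e_def power2_eq_square algebra_simps)
      finally show ?thesis .
    qed
    define D where "D = 1 + (e * B ^ 2) ^ 2"
    define \<nu> where "\<nu> = real (zero_count (g \<alpha>) R + zero_count (g \<beta>) R)"
    define K where "K = 6 * L + 2 * B"
    define X where "X = D + \<nu> * D + 1 / (R - norm z) + 8 * R * (K + \<nu> * (2 * ln (2 * R + 1))) / (R - norm z)\<^sup>2"
    have D0: "D \<ge> 1" by (simp add: D_def)
    have sep: "1 \<le> D * \<bar>norm z - norm a\<bar>" if a: "g \<gamma> a = 0" "norm a \<le> R" and \<gamma>: "\<gamma> \<in> V" for \<gamma> a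
    proof -
      have "1 \<le> (real (zero_count (g \<gamma>) R))\<^sup>2 * \<bar>norm z - norm a\<bar>"
        using U(2)[OF \<gamma> _ a] r(2) z \<gamma> by auto
      also have "\<dots> \<le> D * \<bar>norm z - norm a\<bar>"
      proof (rule mult_right_mono)
        have "(real (zero_count (g \<gamma>) R))\<^sup>2 \<le> (e * B ^ 2) ^ 2" using zc[OF \<gamma>] by (intro power_mono) auto
        then show "(real (zero_count (g \<gamma>) R))\<^sup>2 \<le> D" by (simp add: D_def)
      qed auto
      finally show ?thesis .
    qed
    have low: "circle_mean R (\<lambda>z. ln (norm (g \<gamma> z))) \<ge> - L" if \<gamma>: "\<gamma> \<in> V" for \<gamma>
    proof -
      have "leading_ln (g \<gamma>) + real (zero_count (g \<gamma>) 1) * ln (R / 1) \<le> circle_mean R (\<lambda>z. ln (norm (g \<gamma> z)))"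
        using circle_mean_ge_leading_ln[OF g[OF \<gamma>], of 1 R] ord notin_zero_radii[of _ "g \<gamma>"] Rn(1)[OF \<gamma>] by auto
      moreover have "0 \<le> real (zero_count (g \<gamma>) 1) * ln (R / 1)" using ord by simp
      ultimately show ?thesis using Lle[OF \<gamma>] by linarith
    qed
    have Kb: "circle_mean R (\<lambda>z. \<bar>ln (norm (g \<alpha> z)) - ln (norm (g \<beta> z))\<bar>) \<le> K"
    proof -
      define x where "x = (\<lambda>\<gamma> z. ln (norm (g \<gamma> z)))"
      define F where "F = (\<lambda>z. ln (norm (f z)))"
      have cx: "continuous_on (sphere 0 R) (x \<gamma>)" if "\<gamma> \<in> V" for \<gamma>
        unfolding x_def by (rule continuous_ln_norm_entire[OF g[OF that] Rn(1)[OF that]])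
      have cF: "continuous_on (sphere 0 R) F" unfolding F_def by (rule continuous_ln_norm[OF f(1)])
      \<comment> \<open>Twice the larger value minus the sum is the absolute difference, and both
        values are at most \<open>L + F z\<close>. The means of \<open>x \<alpha>\<close> and
        \<open>x \<beta>\<close> are at least \<open>- L\<close>, which completes the 6 in
        \<open>K\<close>.\<close>
      have "circle_mean R (\<lambda>z. \<bar>x \<alpha> z - x \<beta> z\<bar>) \<le> circle_mean R (\<lambda>z. 4 * L + (2 * F z - (x \<alpha> z + x \<beta> z)))"
      proof (rule circle_mean_mono)
        fix z :: complex assume z: "norm z = R"
        have F: "x \<gamma> z \<le> ln (norm \<gamma>) + F z" if \<gamma>: "\<gamma> \<in> V" for \<gamma>
        proof -
          have nz: "g \<gamma> z \<noteq> 0" using Rn(1)[OF \<gamma>] z notin_zero_radii by blast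
          then show ?thesis
            unfolding x_def F_def g_def using \<gamma> V reduced_representation_nz[OF f(1)]
            by (intro ln_norm_lin_form_le) (auto simp: g_def)
        qed
        show "\<bar>x \<alpha> z - x \<beta> z\<bar> \<le> 4 * L + (2 * F z - (x \<alpha> z + x \<beta> z))"
          using F[OF \<alpha>\<beta>(1)] F[OF \<alpha>\<beta>(2)] Lle[OF \<alpha>\<beta>(1)] Lle[OF \<alpha>\<beta>(2)] by linarith
      qed (use ord cF cx \<alpha>\<beta> in \<open>auto intro!: continuous_intros\<close>)
      also have "\<dots> = 4 * L + (2 * circle_mean R F - (circle_mean R (x \<alpha>) + circle_mean R (x \<beta>)))"
        using ord cF cx \<alpha>\<beta> by (simp add: circle_mean_add circle_mean_diff circle_mean_cmult continuous_intros)
      also have "\<dots> \<le> K" using low[OF \<alpha>\<beta>(1)] low[OF \<alpha>\<beta>(2)] MR(1) by (simp add: x_def F_def K_def)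
      finally show ?thesis by (simp add: x_def)
    qed
    have "norm ((deriv ^^ k) (\<lambda>w. g \<alpha> w / g \<beta> w) z) \<le> fact k * exp 2 * (2 * X) ^ k * norm (g \<alpha> z / g \<beta> z)"
    proof (rule quotient_log_derivative_bound[OF g[OF \<alpha>\<beta>(1)] g[OF \<alpha>\<beta>(2)] _ _ Rn(1)[OF \<alpha>\<beta>(1)] Rn(1)[OF \<alpha>\<beta>(2)] Kb _ _ \<nu>_def X_def])
      show "\<And>a. g \<alpha> a = 0 \<or> g \<beta> a = 0 \<Longrightarrow> norm a \<le> R \<Longrightarrow> 1 \<le> D * \<bar>norm z - norm a\<bar>"
        using sep \<alpha>\<beta> by blast
    qed (use ord z D0 in auto)
    also have "\<dots> \<le> fact k * exp 2 * (2 * (c * B ^ 6)) ^ k * norm (g \<alpha> z / g \<beta> z)"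
    proof -
      have B0: "B \<ge> 0" using B by simp
      have \<nu>: "0 \<le> \<nu>" "\<nu> \<le> 2 * (e * B ^ 2)" using zc[OF \<alpha>\<beta>(1)] zc[OF \<alpha>\<beta>(2)] by (auto simp: \<nu>_def)
      have pw: "B ^ i \<le> B ^ 6" if "i \<le> 6" for i using that B(1) by (intro power_increasing) auto
      have t1: "D \<le> (1 + e\<^sup>2) * B ^ 6" "D \<le> (1 + e\<^sup>2) * B ^ 4"
      proof -
        have "D = 1 + e\<^sup>2 * B ^ 4" by (simp add: D_def power_mult_distrib)
        moreover have "1 \<le> B ^ 4" using B(1) by simp
        ultimately show "D \<le> (1 + e\<^sup>2) * B ^ 4" by (simp add: algebra_simps)
        also have "\<dots> \<le> (1 + e\<^sup>2) * B ^ 6" by (intro mult_left_mono pw) auto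
        finally show "D \<le> (1 + e\<^sup>2) * B ^ 6" .
      qed
      have t2: "\<nu> * D \<le> 2 * e * (1 + e\<^sup>2) * B ^ 6"
      proof -
        have "\<nu> * D \<le> (2 * (e * B ^ 2)) * ((1 + e\<^sup>2) * B ^ 4)"
          using \<nu> t1(2) D0 e by (intro mult_mono) auto
        also have "\<dots> = 2 * e * (1 + e\<^sup>2) * (B ^ 2 * B ^ 4)" by (simp add: mult_ac)
        also have "B ^ 2 * B ^ 4 = B ^ 6" by (simp flip: power_add)
        finally show ?thesis .
      qed
      have Rr: "R - norm z \<ge> d / 4" using R z by simp
      have t3: "1 / (R - norm z) \<le> 4 * B ^ 6"
      proof -
        have "1 / (R - norm z) \<le> 1 / (d / 4)" using Rr d by (intro divide_left_mono) auto
        also have "\<dots> = 4 * (1 / d)" by simp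
        also have "\<dots> \<le> 4 * B ^ 1" using B(4) by simp
        also have "\<dots> \<le> 4 * B ^ 6" by (intro mult_left_mono pw) auto
        finally show ?thesis .
      qed
      have t4: "8 * R * (K + \<nu> * (2 * ln (2 * R + 1))) / (R - norm z)\<^sup>2 \<le> 128 * (6 * L + 2 + 4 * e) * B ^ 6"
      proof -
        have lnR: "0 \<le> ln (2 * R + 1)" "ln (2 * R + 1) \<le> B"
        proof -
          have "ln (2 * R + 1) \<le> ln (2 * (r + d) + 1)" using ord R d r1 by simp
          then show "ln (2 * R + 1) \<le> B" using B(5) by linarith
        qed (use ord in simp)
        have "K + \<nu> * (2 * ln (2 * R + 1)) \<le> (6 * L * B ^ 3 + 2 * B ^ 3) + 2 * (e * B ^ 2) * (2 * B)"
        proof (rule add_mono)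
          have "B ^ 1 \<le> B ^ 3" "1 \<le> B ^ 3" using B(1) by (intro power_increasing, auto)
          then show "K \<le> 6 * L * B ^ 3 + 2 * B ^ 3" 
            unfolding K_def using L0 by (intro add_mono) (auto simp: mult_le_cancel_left1)
          show "\<nu> * (2 * ln (2 * R + 1)) \<le> 2 * (e * B ^ 2) * (2 * B)"
            using \<nu> lnR e B0 by (intro mult_mono) auto
        qed
        also have "\<dots> = (6 * L + 2 + 4 * e) * B ^ 3" by (simp add: algebra_simps power2_eq_square power3_eq_cube)
        finally have num: "K + \<nu> * (2 * ln (2 * R + 1)) \<le> (6 * L + 2 + 4 * e) * B ^ 3" .
        have nonneg: "0 \<le> (6 * L + 2 + 4 * e) * B ^ 3" using L0 e B0 by auto
        have "8 * R * (K + \<nu> * (2 * ln (2 * R + 1))) / (R - norm z)\<^sup>2 \<le> 8 * (r + d) * ((6 * L + 2 + 4 * e) * B ^ 3) / (d / 4)\<^sup>2"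
        proof (intro frac_le mult_mono num power_mono Rr)
          show "0 \<le> 8 * (r + d) * ((6 * L + 2 + 4 * e) * B ^ 3)" using nonneg r1 d by simp
          show "0 \<le> K + \<nu> * (2 * ln (2 * R + 1))" using L0 B0 \<nu> lnR by (simp add: K_def)
        qed (use R d r1 in auto)
        also have "\<dots> = 128 * ((6 * L + 2 + 4 * e) * B ^ 3) * ((r + d) / d * (1 / d))"
          by (simp add: power2_eq_square)
        also have "\<dots> \<le> 128 * ((6 * L + 2 + 4 * e) * B ^ 3) * (B * B)"
          by (intro mult_left_mono mult_mono B B0) (use nonneg d in auto)
        also have "\<dots> = 128 * (6 * L + 2 + 4 * e) * B ^ 5"
          by (simp add: power_numeral_reduce)
        also have "\<dots> \<le> 128 * (6 * L + 2 + 4 * e) * B ^ 6"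
          by (intro mult_left_mono pw) (use L0 e in auto)
        finally show ?thesis .
      qed
      have "X \<le> (1 + e\<^sup>2) * B ^ 6 + 2 * e * (1 + e\<^sup>2) * B ^ 6 + 4 * B ^ 6 + 128 * (6 * L + 2 + 4 * e) * B ^ 6"
        unfolding X_def by (intro add_mono t1 t2 t3 t4)
      also have "\<dots> = c * B ^ 6" by (simp only: c_def distrib_right)
      finally have Xle: "X \<le> c * B ^ 6" .
      have "K \<ge> 0" using L0 B0 by (simp add: K_def)
      moreover have "ln (2 * R + 1) \<ge> 0" "R > 0" "R - norm z > 0" using ord z by auto
      ultimately have "X \<ge> 0" unfolding X_def using \<nu> D0 by (intro add_nonneg_nonneg divide_nonneg_nonneg mult_nonneg_nonneg) auto
      then show ?thesis using Xle by (intro mult_right_mono mult_left_mono power_mono) auto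
    qed
    finally show ?thesis .
  qed
  have "(\<Union>\<alpha>\<in>V. U \<alpha>) \<in> lmeasurable"
    using V U(1) by (intro fmeasurable.finite_UN) auto
  then show ?thesis
    by (rule that[of _ c r0]) (use c1 r0 bound in \<open>auto simp: g_def\<close>)
qed

section \<open>The second main theorem\<close>

text \<open>The Wronskian of the forms is \<open>det B\<close> times that of \<open>f\<close>.
  Dividing all forms by the \<open>l\<close>-th takes out its power of exponent
  \<open>CARD('i)\<close>, and dividing column \<open>j\<close> by \<phi>\<open>\<^sub>j\<close>
  leaves a matrix invariant under scaling of \<open>f\<close>; the factors taken out multiply to the
  product of all forms.\<close>

lemma ln_wronskian_le:
  fixes f :: "complex \<Rightarrow> complex^'i::{finite,linorder}" and B :: "complex^'i::{finite,linorder}^'i::{finite,linorder}"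
  assumes f: "reduced_representation f" and B: "det B \<noteq> 0"
    and nz: "\<And>j. lin_form (B $ j) (f z) \<noteq> 0" and W: "wronskian f z \<noteq> 0"
  shows "ln (norm (wronskian f z)) + ln (norm (det B)) \<le> 
    (\<Sum>j\<in>UNIV. ln (norm (lin_form (B $ j) (f z)))) + ln (fact CARD('i)) + 
    (\<Sum>i\<in>UNIV. \<Sum>j\<in>UNIV. ln (1 + norm ((deriv ^^ coord_pos (i::'i)) 
        (\<lambda>w. lin_form (B $ j) (f w) / lin_form (B $ l) (f w)) z / (lin_form (B $ j) (f z) / lin_form (B $ l) (f z)))))"
proof -
  define g where "g = (\<lambda>j w. lin_form (B $ j) (f w))"
  define \<phi> where "\<phi> = (\<lambda>j w. g j w / g l w)"
  have g_hol: "g j holomorphic_on S" for j S unfolding g_def by (rule lin_form_holomorphic[OF f])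
  have gz: "g j z \<noteq> 0" for j using nz by (simp add: g_def)
  define S where "S = {w. g l w \<noteq> 0}"
  have "open S"
    unfolding S_def
    by (intro open_Collect_neq holomorphic_on_imp_continuous_on g_hol continuous_on_const)
  have zS: "z \<in> S" using gz by (simp add: S_def)
  have \<phi>_hol: "\<phi> j holomorphic_on S" for j unfolding \<phi>_def by (intro holomorphic_intros g_hol) (simp add: S_def)
  have "(deriv ^^ k) (g j) z = (deriv ^^ k) (\<lambda>w. g l w * \<phi> j w) z" for j k
    by (rule higher_deriv_transform_within_open[OF g_hol _ \<open>open S\<close> zS])
       (simp_all add: holomorphic_on_mult g_hol \<phi>_hol, simp add: \<phi>_def S_def)
  then have "wronskian (\<lambda>w. \<chi> j. g j w) z = wronskian (\<lambda>w. \<chi> j. g l w * (\<chi> j. \<phi> j w) $ j) z"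
    by (simp add: wronskian_eq)
  also have "\<dots> = g l z ^ CARD('i) * wronskian (\<lambda>w. \<chi> j. \<phi> j w) z"
    by (rule wronskian_mult[OF _ g_hol \<open>open S\<close> zS]) (simp add: \<phi>_hol)
  also have "wronskian (\<lambda>w. \<chi> j. g j w) z = det B * wronskian f z"
    unfolding g_def by (rule wronskian_matrix_mult) (rule reduced_representation_holomorphic[OF f])
  finally have 1: "det B * wronskian f z = g l z ^ CARD('i) * wronskian (\<lambda>w. \<chi> j. \<phi> j w) z" .
  define M where "M = (\<chi> (i::'i) j. (deriv ^^ coord_pos i) (\<phi> j) z / \<phi> j z)"
  define \<Delta> where "\<Delta> = (\<chi> (i::'i) j. if i = j then \<phi> j z else 0)"
  have \<phi>z: "\<phi> j z \<noteq> 0" for j using gz by (simp add: \<phi>_def)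
  have "(\<chi> (i::'i) j. (deriv ^^ coord_pos i) (\<lambda>w. (\<chi> j. \<phi> j w) $ j) z) = M ** \<Delta>"
    using \<phi>z by (simp add: M_def \<Delta>_def vec_eq_iff matrix_matrix_mult_def if_distrib[of "\<lambda>x. _ * x"] cong: if_cong)
  then have "wronskian (\<lambda>w. \<chi> j. \<phi> j w) z = det M * det \<Delta>"
    unfolding wronskian_eq by (simp only: det_mul)
  also have "det \<Delta> = (\<Prod>j\<in>UNIV. \<phi> j z)"
    by (subst det_diagonal) (auto simp: \<Delta>_def)
  finally have "det B * wronskian f z = (g l z ^ CARD('i) * (\<Prod>j\<in>UNIV. \<phi> j z)) * det M"
    using 1 by simp
  also have "g l z ^ CARD('i) * (\<Prod>j\<in>UNIV. \<phi> j z) = (\<Prod>j\<in>UNIV. g l z * \<phi> j z)"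
    by (simp add: prod.distrib)
  also have "\<dots> = (\<Prod>j\<in>UNIV. g j z)" using gz by (simp add: \<phi>_def)
  finally have 2: "det B * wronskian f z = (\<Prod>j\<in>UNIV. g j z) * det M" .
  then have M0: "det M \<noteq> 0" using B W by auto
  have "ln (norm (det B * wronskian f z)) = ln (norm (wronskian f z)) + ln (norm (det B))"
    using B W by (simp add: norm_mult ln_mult)
  moreover have "ln (norm ((\<Prod>j\<in>UNIV. g j z) * det M)) = (\<Sum>j\<in>UNIV. ln (norm (g j z))) + ln (norm (det M))"
  proof -
    have "ln (\<Prod>j\<in>UNIV. norm (g j z)) = (\<Sum>j\<in>UNIV. ln (norm (g j z)))"
      by (rule ln_prod) (use gz in auto)
    moreover have "(\<Prod>j\<in>UNIV. norm (g j z)) > 0" by (intro prod_pos) (use gz in auto)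
    ultimately show ?thesis using M0 gz by (simp add: norm_mult ln_mult prod_norm[symmetric])
  qed
  ultimately have "ln (norm (wronskian f z)) + ln (norm (det B)) = (\<Sum>j\<in>UNIV. ln (norm (g j z))) + ln (norm (det M))"
    using 2 by simp
  then show ?thesis
    using ln_norm_det_le[OF M0] by (simp add: M_def g_def \<phi>_def)
qed

text \<open>Integrability of the proximity integrands is left open: a non-integrable \<psi> has
  integral 0 by convention. Such terms may be dropped from the pointwise bound as well, because
  \<open>\<psi> k t + c\<close> is nonnegative.\<close>

lemma sum_integral_le_integral:
  fixes \<psi> :: "'k \<Rightarrow> real \<Rightarrow> real"
  assumes "finite I" "\<And>k t. k \<in> I \<Longrightarrow> t \<in> {a..b} \<Longrightarrow> 0 \<le> \<psi> k t + c" and c: "c \<ge> 0"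
    and le: "\<And>t. t \<in> {a..b} \<Longrightarrow> (\<Sum>k\<in>I. \<psi> k t + c) \<le> u t" and u: "u integrable_on {a..b}"
  shows "(\<Sum>k\<in>I. integral {a..b} (\<psi> k)) \<le> integral {a..b} u"
proof -
  define J where "J = {k\<in>I. \<psi> k integrable_on {a..b}}"
  have J: "finite J" "J \<subseteq> I" using assms(1) by (auto simp: J_def)
  have "(\<Sum>k\<in>I. integral {a..b} (\<psi> k)) = (\<Sum>k\<in>J. integral {a..b} (\<psi> k))"
    by (rule sum.mono_neutral_right) (auto simp: J_def assms(1) not_integrable_integral)
  also have "\<dots> = integral {a..b} (\<lambda>t. \<Sum>k\<in>J. \<psi> k t)"
    by (rule integral_sum[symmetric]) (auto simp: J_def assms(1))
  also have "\<dots> \<le> integral {a..b} u"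
  proof (rule integral_le[OF _ u])
    show "(\<lambda>t. \<Sum>k\<in>J. \<psi> k t) integrable_on {a..b}" by (rule integrable_sum) (auto simp: J_def assms(1))
    fix t assume t: "t \<in> {a..b}"
    have "(\<Sum>k\<in>J. \<psi> k t) \<le> (\<Sum>k\<in>J. \<psi> k t + c)" using c by (intro sum_mono) auto
    also have "\<dots> \<le> (\<Sum>k\<in>I. \<psi> k t + c)" using J t assms(1,2) by (intro sum_mono2) auto
    also have "\<dots> \<le> u t" by (rule le[OF t])
    finally show "(\<Sum>k\<in>J. \<psi> k t) \<le> u t" .
  qed
  finally show ?thesis .
qed

text \<open>The matrix selected at a point varies along the circle; finiteness of all possibilities
  gives one constant for the whole plane.\<close>

lemma finite_matrices_rows_in:
  assumes "finite V"
  shows "finite {B :: 'a^'m^'n::finite. \<forall>i. B $ i \<in> V}"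
proof -
  have "{B :: 'a^'m^'n::finite. \<forall>i. B $ i \<in> V} \<subseteq> vec_lambda ` (\<Pi>\<^sub>E i\<in>UNIV. V)"
  proof
    fix B :: "'a^'m^'n::finite" assume "B \<in> {B. \<forall>i. B $ i \<in> V}"
    then have "vec_nth B \<in> (\<Pi>\<^sub>E i\<in>UNIV. V)" by auto
    then show "B \<in> vec_lambda ` (\<Pi>\<^sub>E i\<in>UNIV. V)" by (metis image_eqI vec_nth_inverse)
  qed
  moreover have "finite (\<Pi>\<^sub>E i\<in>(UNIV::'n set). V)" using assms by (intro finite_PiE) auto
  ultimately show ?thesis by (meson finite_imageI finite_subset)
qed

text \<open>The inequality is kept with free \<open>d\<close> and \<open>B\<close>, since the two
  growth cases need different gaps; \<open>U\<close> and \<open>C\<close> serve both. The pointwise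
  estimate is averaged and Jensen's formula replaces the Wronskian mean by
  \<open>ramification\<close>.\<close>

lemma second_main_estimate:
  fixes f :: "complex \<Rightarrow> complex^'i::{finite,linorder}" and A :: "(complex^'i::{finite,linorder}) set set"
  assumes f: "reduced_representation f" "linearly_nondegenerate f" and card: "CARD('i) = n + 1" "n \<ge> 1"
    and A: "finite A" "\<forall>H\<in>A. is_hyperplane H" "complete_hyperplanes A"
  obtains U C r0 where "U \<in> lmeasurable" "C \<ge> 0" "r0 \<ge> 1"
    "\<And>r d B. \<lbrakk>r \<ge> r0; r \<notin> U; d > 0; B \<ge> 1; log_mean f (r + d) \<le> B; (r + d) / d \<le> B; 1 / d \<le> B;
       ln (2 * (r + d) + 1) \<le> B\<rbrakk> \<Longrightarrow>
     (\<Sum>k=1..n. proximity A k r f) + ramification r f \<le> (real n + 1) * characteristic r f + C * (1 + ln B)"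
proof -
  obtain V where V: "finite V" "0 \<notin> V" "hyperplane ` V = A" "vec.span V = UNIV"
    using complete_hyperplanes_normals[OF A] by blast
  have card2: "CARD('i) \<ge> 2" using card by simp
  obtain U c r0 where U: "U \<in> lmeasurable" "c \<ge> 1" "r0 \<ge> 1"
    "\<And>r d B \<alpha> \<beta> z k. \<lbrakk>r \<ge> r0; r \<notin> U; d > 0; B \<ge> 1; log_mean f (r + d) \<le> B; (r + d) / d \<le> B; 1 / d \<le> B;
       ln (2 * (r + d) + 1) \<le> B; \<alpha> \<in> V; \<beta> \<in> V; norm z = r\<rbrakk> \<Longrightarrow>
     norm ((deriv ^^ k) (\<lambda>w. lin_form \<alpha> (f w) / lin_form \<beta> (f w)) z) 
       \<le> fact k * exp 2 * (2 * (c * B ^ 6)) ^ k * norm (lin_form \<alpha> (f z) / lin_form \<beta> (f z))"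
    by (rule uniform_log_derivative_bound[OF f card2 V(1,2)]) blast
  have W: "nontrivial_entire (wronskian f)"
    using wronskian_nontrivial[OF reduced_representation_holomorphic[OF f(1)] f(2)]
      wronskian_holomorphic[OF reduced_representation_holomorphic[OF f(1)] open_UNIV]
    by (simp add: nontrivial_entire_def)
  have gV: "nontrivial_entire (\<lambda>z. lin_form \<alpha> (f z))" if "\<alpha> \<in> V" for \<alpha>
    by (rule lin_form_nontrivial_entire[OF f]) (use that V in auto)
  define Q where "Q = zero_radii (wronskian f) \<union> (\<Union>\<alpha>\<in>V. zero_radii (\<lambda>z. lin_form \<alpha> (f z)))"
  have "countable Q" unfolding Q_def using V gV W
    by (intro countable_Un countable_UN) (auto intro: countable_zero_radii countable_finite)
  then have Q: "Q \<in> lmeasurable"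
    by (intro negligible_imp_measurable) 
      (simp add: negligible_iff_null_sets null_sets_completionI countable_imp_null_set_lborel)
  define Bs where "Bs = {B :: complex^'i::{finite,linorder}^'i::{finite,linorder}. \<forall>i. B $ i \<in> V}"
  have Bs: "finite Bs" unfolding Bs_def by (rule finite_matrices_rows_in[OF V(1)])
  \<comment> \<open>The part of the pointwise bound that depends on the selected forms but not on
    the point.\<close>
  define b where "b = (\<lambda>B :: complex^'i::{finite,linorder}^'i::{finite,linorder}. (\<Sum>i\<in>UNIV. ln (norm (B $ i))) - ln (norm (det B)))"
  define C1 where "C1 = (\<Sum>B\<in>Bs. \<bar>b B\<bar>)"
  have C1: "b B \<le> C1" if "B \<in> Bs" for B
  proof -
    have "\<bar>b B\<bar> \<le> C1" unfolding C1_def by (rule member_le_sum[OF that, of "\<lambda>B. \<bar>b B\<bar>"]) (use Bs in auto)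
    then show ?thesis by simp
  qed
  define N where "N = real CARD('i)"
  \<comment> \<open>Chosen so that \<open>1 + fact k * exp 2 * Y ^ k \<le> q * Y ^ CARD('i)\<close>
    for all occurring orders \<open>k\<close>, as \<open>Y \<ge> 1\<close>.\<close>
  define q :: real where "q = 1 + fact CARD('i) * exp 2"
  have q1: "q \<ge> 1" by (simp add: q_def)
  define C2 where "C2 = N * ln 2 + C1 + ln (fact CARD('i)) + N * N * (ln q + N * ln (2 * c))"
  define C3 where "C3 = C2 + N * ln (norm (f 0)) - leading_ln (wronskian f)"
  define C where "C = \<bar>C3\<bar> + N * N * (N * 6)"
  have N0: "N \<ge> 0" by (simp add: N_def)
  have main: "(\<Sum>k=1..n. proximity A k r f) + ramification r f \<le> (real n + 1) * characteristic r f + C * (1 + ln B)"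
    if r: "r \<ge> r0" "r \<notin> U \<union> Q" and hyp: "d > 0" "B \<ge> 1" "log_mean f (r + d) \<le> B" "(r + d) / d \<le> B" "1 / d \<le> B"
       "ln (2 * (r + d) + 1) \<le> B" for r d B
  proof -
    define Y where "Y = 2 * (c * B ^ 6)"
    have B6: "B ^ 6 \<ge> 1" using hyp(2) by simp
    have Y1: "Y \<ge> 1" using U(2) mult_mono[OF U(2) B6] by (simp add: Y_def)
    have r1: "r \<ge> 1" using r U(3) by simp
    define E where "E = ln q + N * ln Y"
    define u where "u = (\<lambda>z. (N * ln 2 + C1 + ln (fact CARD('i)) + N * N * E) + (N * ln (norm (f z)) - ln (norm (wronskian f z))))"
    have pt: "(\<Sum>k\<in>{1..n}. ln (1 / flat_dist A k (f z)) + ln (sqrt 2)) \<le> u z"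
      and pos: "\<And>k. k \<in> {1..n} \<Longrightarrow> 0 \<le> ln (1 / flat_dist A k (f z)) + ln (sqrt 2)"
      if z: "norm z = r" for z
    proof -
      have fz: "f z \<noteq> 0" by (rule reduced_representation_nz[OF f(1)])
      have gz: "lin_form \<alpha> (f z) \<noteq> 0" if "\<alpha> \<in> V" for \<alpha>
        using that r z notin_zero_radii[of z "\<lambda>z. lin_form \<alpha> (f z)"] by (auto simp: Q_def)
      have Wz: "wronskian f z \<noteq> 0" using r z notin_zero_radii[of z "wronskian f"] by (auto simp: Q_def)
      have rng: "{1..<CARD('i)} = {1..n}" using card by auto
      note fd = flat_dist_sum_bound[OF V(1,2,4) fz gz, unfolded V(3) rng]
      show "\<And>k. k \<in> {1..n} \<Longrightarrow> 0 \<le> ln (1 / flat_dist A k (f z)) + ln (sqrt 2)" by (rule fd(1))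
      obtain M :: "complex^'i::{finite,linorder}^'i::{finite,linorder}" where M: "\<And>i. M $ i \<in> V" "det M \<noteq> 0" and
        le: "(\<Sum>k\<in>{1..n}. ln (1 / flat_dist A k (f z)) + ln (sqrt 2)) \<le> 
          (\<Sum>i\<in>UNIV. ln 2 + ln (norm (M $ i) * norm (f z) / norm (lin_form (M $ i) (f z))))"
        using fd(2) by blast
      have Mn: "norm (M $ i) > 0" "norm (lin_form (M $ i) (f z)) > 0" for i
        using M(1)[of i] V(2) gz[OF M(1)] by auto
      have fn: "norm (f z) > 0" using fz by simp
      \<comment> \<open>Any index serves as the common denominator.\<close>
      obtain l :: 'i where True by simp
      have ent: "ln (1 + norm ((deriv ^^ coord_pos (i::'i)) 
        (\<lambda>w. lin_form (M $ j) (f w) / lin_form (M $ l) (f w)) z / (lin_form (M $ j) (f z) / lin_form (M $ l) (f z)))) \<le> E" for i j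
      proof -
        define t where "t = norm (lin_form (M $ j) (f z) / lin_form (M $ l) (f z))"
        have t: "t > 0" using Mn by (simp add: t_def norm_divide)
        have "norm ((deriv ^^ coord_pos i) (\<lambda>w. lin_form (M $ j) (f w) / lin_form (M $ l) (f w)) z) 
          \<le> fact (coord_pos i) * exp 2 * Y ^ coord_pos i * t"
          unfolding Y_def t_def by (rule U(4)) (use r hyp M(1) z in auto)
        also have "\<dots> \<le> fact CARD('i) * exp 2 * Y ^ CARD('i) * t"
          using coord_pos_less_card[of i] Y1 t
          by (intro mult_right_mono mult_mono fact_mono power_increasing) auto
        finally have "norm ((deriv ^^ coord_pos i) (\<lambda>w. lin_form (M $ j) (f w) / lin_form (M $ l) (f w)) z) / t
           \<le> fact CARD('i) * exp 2 * Y ^ CARD('i)" using t by (simp add: divide_le_eq)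
        moreover have "1 \<le> Y ^ CARD('i)" using Y1 by simp
        ultimately have "1 + norm ((deriv ^^ coord_pos i) (\<lambda>w. lin_form (M $ j) (f w) / lin_form (M $ l) (f w)) z) / t
           \<le> q * Y ^ CARD('i)" by (simp add: q_def algebra_simps)
        moreover have "0 < 1 + norm ((deriv ^^ coord_pos i) (\<lambda>w. lin_form (M $ j) (f w) / lin_form (M $ l) (f w)) z) / t"
          using t by (intro add_pos_nonneg) auto
        ultimately have "ln (1 + norm ((deriv ^^ coord_pos i) (\<lambda>w. lin_form (M $ j) (f w) / lin_form (M $ l) (f w)) z) / t)
          \<le> ln (q * Y ^ CARD('i))" by (intro ln_mono) auto
        also have "\<dots> = E" using q1 Y1 by (simp add: ln_mult ln_realpow E_def N_def)
        finally show ?thesis by (simp only: t_def norm_divide)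
      qed
      have "ln (norm (wronskian f z)) + ln (norm (det M)) \<le> 
        (\<Sum>j\<in>UNIV. ln (norm (lin_form (M $ j) (f z)))) + ln (fact CARD('i)) + 
        (\<Sum>i\<in>UNIV. \<Sum>j\<in>UNIV. ln (1 + norm ((deriv ^^ coord_pos (i::'i)) 
        (\<lambda>w. lin_form (M $ j) (f w) / lin_form (M $ l) (f w)) z / (lin_form (M $ j) (f z) / lin_form (M $ l) (f z)))))"
        by (rule ln_wronskian_le[OF f(1) M(2) _ Wz]) (use gz M(1) in auto)
      also have "(\<Sum>i\<in>UNIV. \<Sum>j\<in>UNIV. ln (1 + norm ((deriv ^^ coord_pos (i::'i)) 
        (\<lambda>w. lin_form (M $ j) (f w) / lin_form (M $ l) (f w)) z / (lin_form (M $ j) (f z) / lin_form (M $ l) (f z)))))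
         \<le> (\<Sum>i\<in>(UNIV::'i set). \<Sum>j\<in>(UNIV::'i set). E)"
        by (intro sum_mono ent)
      also have "\<dots> = N * N * E" by (simp add: N_def)
      finally have low: "- (\<Sum>j\<in>UNIV. ln (norm (lin_form (M $ j) (f z)))) \<le> 
         ln (fact CARD('i)) + N * N * E - ln (norm (wronskian f z)) - ln (norm (det M))" by simp
      have "(\<Sum>i\<in>UNIV. ln 2 + ln (norm (M $ i) * norm (f z) / norm (lin_form (M $ i) (f z)))) =
         (\<Sum>i\<in>UNIV. ln 2 + (ln (norm (M $ i)) + ln (norm (f z)) - ln (norm (lin_form (M $ i) (f z)))))"
        by (intro sum.cong refl) (use Mn fn in \<open>simp add: ln_mult ln_div\<close>)
      also have "\<dots> = N * ln 2 + (\<Sum>i\<in>UNIV. ln (norm (M $ i))) + N * ln (norm (f z)) - (\<Sum>j\<in>UNIV. ln (norm (lin_form (M $ j) (f z))))"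
        by (simp add: sum.distrib sum_subtractf N_def)
      finally have "(\<Sum>k\<in>{1..n}. ln (1 / flat_dist A k (f z)) + ln (sqrt 2)) \<le>
         N * ln 2 + (\<Sum>i\<in>UNIV. ln (norm (M $ i))) + N * ln (norm (f z)) - (\<Sum>j\<in>UNIV. ln (norm (lin_form (M $ j) (f z))))"
        using le by simp
      moreover have "(\<Sum>i\<in>UNIV. ln (norm (M $ i))) - ln (norm (det M)) \<le> C1"
        using C1[of M] M(1) by (simp add: b_def Bs_def)
      ultimately show "(\<Sum>k\<in>{1..n}. ln (1 / flat_dist A k (f z)) + ln (sqrt 2)) \<le> u z"
        unfolding u_def using low by linarith
    qed
    have cW: "continuous_on (sphere 0 r) (\<lambda>z. ln (norm (wronskian f z)))"
      by (rule continuous_ln_norm_entire[OF W]) (use r in \<open>auto simp: Q_def\<close>)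
    have cf: "continuous_on (sphere 0 r) (\<lambda>z. ln (norm (f z)))" by (rule continuous_ln_norm[OF f(1)])
    have cu: "continuous_on (sphere 0 r) u"
      unfolding u_def by (intro continuous_intros cW cf)
    have "(\<Sum>k\<in>{1..n}. integral {-pi..pi} (\<lambda>t. ln (1 / flat_dist A k (f (complex_of_real r * cis t))))) \<le>
        integral {-pi..pi} (\<lambda>t. u (complex_of_real r * cis t))"
      by (rule sum_integral_le_integral[where c = "ln (sqrt 2)"])
         (use r1 pt pos in \<open>auto simp: norm_mult intro!: circle_integrable[OF cu]\<close>)
    then have "1 / (2 * pi) * (\<Sum>k\<in>{1..n}. integral {-pi..pi} (\<lambda>t. ln (1 / flat_dist A k (f (complex_of_real r * cis t))))) \<le>
        1 / (2 * pi) * integral {-pi..pi} (\<lambda>t. u (complex_of_real r * cis t))"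
      by (intro mult_left_mono) auto
    then have "(\<Sum>k=1..n. proximity A k r f) \<le> circle_mean r u"
      by (simp add: proximity_def circle_mean_def sum_distrib_left sum_divide_distrib)
    also have "circle_mean r u = (N * ln 2 + C1 + ln (fact CARD('i)) + N * N * E) + 
       (N * log_mean f r - circle_mean r (\<lambda>z. ln (norm (wronskian f z))))"
      unfolding u_def using cW cf r1
      by (simp add: circle_mean_add circle_mean_diff circle_mean_cmult continuous_intros)
    also have "circle_mean r (\<lambda>z. ln (norm (wronskian f z))) = ramification r f + leading_ln (wronskian f)"
      using ramification_eq[OF W, of r] r1 r notin_zero_radii[of _ "wronskian f"] by (auto simp: Q_def)
    also have "log_mean f r = characteristic r f + ln (norm (f 0))"
      by (simp add: characteristic_def circle_mean_def)
    \<comment> \<open>The only place where \<open>B\<close> enters: \<open>Y\<close> is a multiple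
      of \<open>B ^ 6\<close>, so its logarithm contributes \<open>6 * ln B\<close>.\<close>
    also have "N * N * E = N * N * (ln q + N * ln (2 * c)) + N * N * (N * 6) * ln B"
    proof -
      have "ln Y = ln (2 * c) + 6 * ln B" 
        unfolding Y_def using U(2) hyp(2) by (simp add: ln_mult ln_realpow)
      then show ?thesis by (simp add: E_def algebra_simps)
    qed
    finally have fin1: "(\<Sum>k=1..n. proximity A k r f) + ramification r f \<le> N * characteristic r f + C3 + N * N * (N * 6) * ln B"
      by (simp add: C3_def C2_def algebra_simps)
    have "C3 + N * N * (N * 6) * ln B \<le> C * (1 + ln B)"
    proof -
      have "ln B \<ge> 0" using hyp(2) by simp
      then have "0 \<le> \<bar>C3\<bar> * ln B" "0 \<le> N * N * (N * 6)" using N0 by auto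
      then show ?thesis by (simp add: C_def algebra_simps)
    qed
    moreover have "N = real n + 1" using card by (simp add: N_def)
    ultimately show ?thesis using fin1 by simp
  qed
  show ?thesis
    by (rule that[of "U \<union> Q" C r0])
       (use U Q main N0 in \<open>auto simp: C_def intro!: fmeasurable.Un\<close>)
qed

section \<open>Comparison of the error with the characteristic\<close>

text \<open>The left side is of iterated logarithmic order. On the right stands the lower bound for
  \<open>T\<close> rather than \<open>T\<close>, which makes the claim purely about elementary
  functions.\<close>

lemma eventually_ln_bound_slow:
  fixes P Q C D \<epsilon> :: real
  assumes "P > 0" "\<epsilon> > 0"
  shows "\<forall>\<^sub>F r in at_top. C * (1 + ln (P * ln (2 * r) + Q + 2 + ln (4 * r + 1))) \<le> \<epsilon> * (ln r - D)"
proof -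
  have "((\<lambda>r. (1 + ln (P * ln (2 * r) + Q + 2 + ln (4 * r + 1))) / (ln r - D)) \<longlongrightarrow> 0) at_top"
    using assms(1) by real_asymp
  then have "((\<lambda>r. C * ((1 + ln (P * ln (2 * r) + Q + 2 + ln (4 * r + 1))) / (ln r - D))) \<longlongrightarrow> C * 0) at_top"
    by (intro tendsto_intros)
  then have "\<forall>\<^sub>F r in at_top. C * ((1 + ln (P * ln (2 * r) + Q + 2 + ln (4 * r + 1))) / (ln r - D)) < \<epsilon>"
    using assms(2) by (intro order_tendstoD) auto
  moreover have "\<forall>\<^sub>F r in at_top. ln r - D > 0" by real_asymp
  ultimately show ?thesis
    by eventually_elim (simp add: divide_less_eq less_imp_le)
qed

lemma eventually_ln_bound_fast:
  fixes T :: "real \<Rightarrow> real"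
  assumes T: "filterlim T at_top at_top" "filterlim (\<lambda>r. T r / ln r) at_top at_top" and "\<epsilon> > 0"
  shows "\<forall>\<^sub>F r in at_top. C * (1 + ln ((2 * r + 2 + Q) * (T r + 1))) \<le> \<epsilon> * T r"
proof -
  \<comment> \<open>The logarithm splits into a part in \<open>r\<close> and a part in
    \<open>T r\<close>; \<open>K\<close> times each is at most \<open>T r\<close>, and
    \<open>\<bar>C\<bar> + 1 = \<epsilon> / 4 * K\<close> turns their sum into at most
    \<open>\<epsilon> / 2 * T r\<close>.\<close>
  define K where "K = 4 * (\<bar>C\<bar> + 1) / \<epsilon>"
  have K: "K > 0" using assms by (simp add: K_def)
  have "((\<lambda>t::real. (1 + ln (t + 1)) / t) \<longlongrightarrow> 0) at_top" by real_asymp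
  then have "((\<lambda>r. (1 + ln (T r + 1)) / T r) \<longlongrightarrow> 0) at_top" by (rule filterlim_compose[OF _ T(1)])
  then have "\<forall>\<^sub>F r in at_top. (1 + ln (T r + 1)) / T r < 1 / K"
    using K by (intro order_tendstoD) auto
  moreover have "\<forall>\<^sub>F r in at_top. T r \<ge> 1" using T(1) by (simp add: filterlim_at_top)
  moreover have "\<forall>\<^sub>F r in at_top. T r / ln r \<ge> 2 * K" using T(2) by (simp add: filterlim_at_top)
  moreover have "\<forall>\<^sub>F r in at_top. 1 \<le> 2 * r + 2 + Q \<and> ln (2 * r + 2 + Q) \<le> 2 * ln r \<and> ln r > 0"
    by (intro eventually_conj) real_asymp+
  ultimately show ?thesis
  proof eventually_elim
    case (elim r)
    have "2 * K * ln r \<le> T r" using elim by (simp add: le_divide_eq)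
    then have 1: "K * ln (2 * r + 2 + Q) \<le> T r"
    proof -
      have "K * ln (2 * r + 2 + Q) \<le> K * (2 * ln r)" using elim K by (intro mult_left_mono) auto
      also have "\<dots> = 2 * K * ln r" by simp
      finally show ?thesis using \<open>2 * K * ln r \<le> T r\<close> by linarith
    qed
    have 2: "K * (1 + ln (T r + 1)) \<le> T r" using elim K by (simp add: divide_less_eq field_simps)
    define y where "y = 1 + ln ((2 * r + 2 + Q) * (T r + 1))"
    have y: "y = ln (2 * r + 2 + Q) + (1 + ln (T r + 1))"
      using elim by (simp add: y_def ln_mult)
    have y0: "y \<ge> 0" using elim unfolding y by (intro add_nonneg_nonneg) auto
    have "C * y \<le> (\<bar>C\<bar> + 1) * y" using y0 by (intro mult_right_mono) auto
    also have "\<dots> = \<epsilon> / 4 * (K * y)" using assms(3) by (simp add: K_def)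
    also have "\<dots> \<le> \<epsilon> / 4 * (2 * T r)"
      using 1 2 assms(3) by (intro mult_left_mono) (auto simp: y algebra_simps)
    also have "\<dots> \<le> \<epsilon> * T r" using elim assms(3) by simp
    finally show ?case by (simp add: y_def)
  qed
qed

theorem theorem1:
  fixes n :: nat
    and f :: "complex \<Rightarrow> complex^'i::{finite,linorder}"
    and A :: "(complex^'i::{finite,linorder}) set set"
  assumes "CARD('i) = n + 1" and "n \<ge> 1"
    and "reduced_representation f" and "linearly_nondegenerate f"
    and "finite A" and "\<forall>H\<in>A. is_hyperplane H" and "complete_hyperplanes A"
  shows "\<exists>(S :: real \<Rightarrow> real) (E :: real set).
           E \<subseteq> {0<..} \<and> E \<in> lmeasurable \<and>
           S \<in> o[inf at_top (principal (- E))](\<lambda>r. characteristic r f) \<and>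
           (\<forall>r>0. (\<Sum>k=1..n. proximity A k r f) + ramification r f
                    \<le> (real n + 1) * characteristic r f + S r)"
proof -
  define T where "T = (\<lambda>r. characteristic r f)"
  define m where "m = ln (norm (f 0))"
  define exc where "exc = (\<lambda>r. (\<Sum>k=1..n. proximity A k r f) + ramification r f - (real n + 1) * T r)"
  have TM: "log_mean f r = T r + m" for r
    by (simp add: T_def m_def characteristic_def circle_mean_def)
  have Tc: "characteristic r f = T r" for r by (simp add: T_def)
  have card2: "CARD('i) \<ge> 2" using assms by simp
  obtain U C r0 where U: "U \<in> lmeasurable" "C \<ge> 0" "r0 \<ge> 1" and
    est0: "\<And>r d B. \<lbrakk>r \<ge> r0; r \<notin> U; d > 0; B \<ge> 1; log_mean f (r + d) \<le> B; (r + d) / d \<le> B; 1 / d \<le> B;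
       ln (2 * (r + d) + 1) \<le> B\<rbrakk> \<Longrightarrow>
     (\<Sum>k=1..n. proximity A k r f) + ramification r f \<le> (real n + 1) * characteristic r f + C * (1 + ln B)"
    by (rule second_main_estimate[OF assms(3,4,1,2,5,6,7)]) blast
  have est: "exc r \<le> C * (1 + ln B)"
    if "r \<ge> r0" "r \<notin> U" "d > 0" "B \<ge> 1" "T (r + d) + m \<le> B" "(r + d) / d \<le> B" "1 / d \<le> B"
       "ln (2 * (r + d) + 1) \<le> B" for r d B
    using est0[of r d B] that by (simp add: exc_def Tc TM)
  obtain C' r1 where r1: "r1 \<ge> 1" "\<And>r. r \<ge> r1 \<Longrightarrow> ln r - C' \<le> T r + m" 
      "\<And>r s. r1 \<le> r \<Longrightarrow> r \<le> s \<Longrightarrow> T r \<le> T s"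
    using log_mean_ge_ln[OF assms(3,4) card2] unfolding TM by (metis add_le_cancel_right)
  have Tlow: "\<forall>\<^sub>F r in at_top. ln r - (C' + m) \<le> T r"
    using eventually_ge_at_top[of r1] by eventually_elim (use r1(2) in force)
  have "filterlim (\<lambda>r::real. ln r - (C' + m)) at_top at_top" by real_asymp
  then have Tinf: "filterlim T at_top at_top"
    using Tlow by (rule filterlim_at_top_mono)
  \<comment> \<open>The exceptional set precedes \<epsilon>: one set has to serve every \<epsilon>
    for the little-o statement.\<close>
  have "\<exists>U'. U' \<in> lmeasurable \<and> (\<forall>\<epsilon>>0. \<forall>\<^sub>F r in at_top. r \<notin> U' \<longrightarrow> exc r \<le> \<epsilon> * T r)"
  proof (rule log_mean_dichotomy[OF assms(3)])
    fix p assume p: "\<And>r. r > 1 \<Longrightarrow> log_mean f r \<le> real p * ln r + log_mean f 1"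
    define Q where "Q = \<bar>log_mean f 1\<bar>"
    \<comment> \<open>Taken for the gap \<open>d = r\<close>: the summands dominate the growth at
      \<open>2 * r\<close>, the ratio \<open>(r + r) / r = 2\<close>, and
      \<open>ln (4 * r + 1)\<close>.\<close>
    define B where "B = (\<lambda>r. (real p + 1) * ln (2 * r) + Q + 2 + ln (4 * r + 1))"
    have "\<forall>\<^sub>F r in at_top. r \<notin> U \<longrightarrow> exc r \<le> \<epsilon> * T r" if \<epsilon>: "\<epsilon> > 0" for \<epsilon>
    proof -
      have "\<forall>\<^sub>F r in at_top. C * (1 + ln (B r)) \<le> \<epsilon> * (ln r - (C' + m))"
        unfolding B_def by (rule eventually_ln_bound_slow) (use \<epsilon> in auto)
      then show ?thesis
        using eventually_ge_at_top[of r0] eventually_ge_at_top[of 2] Tlow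
      proof eventually_elim
        case (elim r)
        have lns: "ln (2 * r) \<ge> 0" "ln (4 * r + 1) \<ge> 0" "real p * ln (2 * r) \<ge> 0" using elim by auto
        have Q0: "Q \<ge> 0" "log_mean f 1 \<le> Q" by (auto simp: Q_def)
        have "exc r \<le> C * (1 + ln (B r))" if "r \<notin> U"
        proof (rule est[OF _ that, of r])
          have Bexp: "B r = real p * ln (2 * r) + ln (2 * r) + Q + 2 + ln (4 * r + 1)"
            by (simp add: B_def distrib_right)
          then have "B r \<ge> 2" using lns Q0 by linarith
          moreover have "1 / r \<le> 1" "(r + r) / r = 2" using elim by auto
          ultimately show "B r \<ge> 1" "1 / r \<le> B r" "(r + r) / r \<le> B r" by linarith+
          have "T (r + r) + m \<le> real p * ln (2 * r) + Q"
            using p[of "r + r"] elim Q0 by (simp add: TM)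
          then show "T (r + r) + m \<le> B r" using lns Q0 Bexp by linarith
          have "2 * (r + r) + 1 = 4 * r + 1" by simp
          then show "ln (2 * (r + r) + 1) \<le> B r" using lns Q0 Bexp by (simp only:)
        qed (use elim in auto)
        moreover have "\<epsilon> * (ln r - (C' + m)) \<le> \<epsilon> * T r" using elim \<epsilon> by (intro mult_left_mono) auto
        ultimately show ?case using elim by linarith
      qed
    qed
    then show ?thesis using U(1) by blast
  next
    assume fast: "filterlim (\<lambda>r. log_mean f r / ln r) at_top at_top"
    have Tfast: "filterlim (\<lambda>r. T r / ln r) at_top at_top"
    proof -
      have "((\<lambda>r::real. - m / ln r) \<longlongrightarrow> 0) at_top" by real_asymp
      then have "filterlim (\<lambda>r. - m / ln r + log_mean f r / ln r) at_top at_top"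
        using fast by (rule filterlim_tendsto_add_at_top)
      then show ?thesis by (simp add: TM add_divide_distrib)
    qed
    have "\<forall>\<^sub>F r in at_top. T r \<ge> 1" using Tinf by (simp add: filterlim_at_top)
    then obtain r2 where r2: "\<And>r. r \<ge> r2 \<Longrightarrow> T r \<ge> 1" by (auto simp: eventually_at_top_linorder)
    obtain U2 where U2: "U2 \<in> lmeasurable" "\<And>r. r \<ge> max r1 r2 \<Longrightarrow> r \<notin> U2 \<Longrightarrow> T (r + 1 / T r) \<le> 2 * T r"
      using Borel_growth[of "max r1 r2" T] r2 r1(3) by auto
    define Q where "Q = \<bar>m\<bar>"
    have Q: "0 \<le> Q" "m \<le> Q" by (auto simp: Q_def)
    \<comment> \<open>Taken for the gap \<open>d = 1 / T r\<close>, where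
      \<open>(r + d) / d = r * T r + 1\<close> and Borel's lemma bounds the growth by
      \<open>2 * T r + m\<close>; as a product, \<open>B\<close> has a logarithm that splits into
      parts of order \<open>ln r\<close> and \<open>ln (T r)\<close>.\<close>
    define B where "B = (\<lambda>r. (2 * r + 2 + Q) * (T r + 1))"
    have "\<forall>\<^sub>F r in at_top. r \<notin> U \<union> U2 \<longrightarrow> exc r \<le> \<epsilon> * T r" if \<epsilon>: "\<epsilon> > 0" for \<epsilon>
    proof -
      have "\<forall>\<^sub>F r in at_top. C * (1 + ln (B r)) \<le> \<epsilon> * T r"
        unfolding B_def by (rule eventually_ln_bound_fast[OF Tinf Tfast \<epsilon>])
      then show ?thesis
        using eventually_ge_at_top[of r0] eventually_ge_at_top[of "max r1 r2"]
      proof eventually_elim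
        case (elim r)
        have r: "r \<ge> 1" "T r \<ge> 1" using elim r1(1) r2 by auto
        have inv: "1 / T r \<le> 1" using r by simp
        have pos: "0 \<le> r * T r" "0 \<le> Q * T r" using r Q by auto
        have Bexp: "B r = 2 * (r * T r) + 2 * r + 2 * T r + 2 + Q * T r + Q" by (simp add: B_def algebra_simps)
        have "exc r \<le> C * (1 + ln (B r))" if "r \<notin> U \<union> U2"
        proof (rule est[of _ "1 / T r"])
          show "B r \<ge> 1" unfolding Bexp using pos r Q by linarith
          show "1 / (1 / T r) \<le> B r" unfolding Bexp using pos r Q by simp
          have "(r + 1 / T r) / (1 / T r) = r * T r + 1" using r by (simp add: field_simps)
          then show "(r + 1 / T r) / (1 / T r) \<le> B r" unfolding Bexp using pos r Q by linarith
          have "T (r + 1 / T r) \<le> 2 * T r" by (rule U2(2)) (use elim that in auto)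
          then show "T (r + 1 / T r) + m \<le> B r" unfolding Bexp using pos r Q by linarith
          have "ln (2 * (r + 1 / T r) + 1) \<le> 2 * (r + 1 / T r)"
            using ln_le_minus_one[of "2 * (r + 1 / T r) + 1"] r by (simp add: add_pos_pos)
          also have "\<dots> \<le> 2 * (r + 1)" by (intro mult_left_mono add_left_mono inv) auto
          also have "\<dots> = 2 * r + 2" by simp
          also have "\<dots> \<le> B r" unfolding Bexp using pos r Q by linarith
          finally show "ln (2 * (r + 1 / T r) + 1) \<le> B r" .
        qed (use elim that r in auto)
        then show ?case using elim by linarith
      qed
    qed
    moreover have "U \<union> U2 \<in> lmeasurable" using U(1) U2(1) by (rule fmeasurable.Un)
    ultimately show ?thesis by blast
  qed
  then obtain U' where U': "U' \<in> lmeasurable" "\<And>\<epsilon>. \<epsilon> > 0 \<Longrightarrow> \<forall>\<^sub>F r in at_top. r \<notin> U' \<longrightarrow> exc r \<le> \<epsilon> * T r"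
    by blast
  define E where "E = U' \<inter> {0<..}"
  \<comment> \<open>The positive part makes the inequality hold for all \<open>r\<close>, while the
    little-o claim needs only the upper bound for \<open>exc\<close> off \<open>E\<close>.\<close>
  define S where "S = (\<lambda>r. max 0 (exc r))"
  have "E \<in> lmeasurable"
    unfolding E_def using U'(1) by (intro fmeasurable_Int_fmeasurable) auto
  moreover have "S \<in> o[inf at_top (principal (- E))](\<lambda>r. characteristic r f)"
  proof (rule landau_o.smallI)
    fix c :: real assume c: "c > 0"
    have "\<forall>\<^sub>F r in at_top. T r \<ge> 0" using Tinf by (simp add: filterlim_at_top)
    with U'(2)[OF c] eventually_gt_at_top[of 0] have "\<forall>\<^sub>F r in at_top. r \<in> - E \<longrightarrow> norm (S r) \<le> c * norm (T r)"
      by eventually_elim (use c in \<open>auto simp: E_def S_def\<close>)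
    then show "\<forall>\<^sub>F r in inf at_top (principal (- E)). norm (S r) \<le> c * norm (characteristic r f)"
      by (simp add: eventually_inf_principal T_def)
  qed
  moreover have "(\<Sum>k=1..n. proximity A k r f) + ramification r f \<le> (real n + 1) * characteristic r f + S r" for r
    by (simp add: S_def exc_def T_def)
  ultimately show ?thesis by (intro exI[of _ S] exI[of _ E]) (auto simp: E_def)
qed

end
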